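(* Let $1\le p\le2$ and $p^{-1}+p'^{-1}=1$. If $\gamma$ is a monotone or convex curve in $\mathbb{C}_+$, then the operator $\mathcal{L}_\gamma$ (the Laplace transform restricted to $\gamma$) acts continuously from $L^p(\mathbb{R}_+)$ to $L^{p'}(\gamma)$. Moreover, we have the uniform norm estimates $$\sup_{\gamma\in\mathrm{Mon}(\mathbb{C}_+)}\|\mathcal{L}_\gamma\|_{L^p(\mathbb{R}_+)\to L^{p'}(\gamma)}\le(224\,\pi)^{1/p'}$$ and $$\sup_{\gamma\in\mathrm{Conv}(\mathbb{C}_+)}\|\mathcal{L}_\gamma\|_{L^p(\mathbb{R}_+)\to L^{p'}(\gamma)}\le(16\cdot224\,\pi)^{1/p'},$$ where $\mathrm{Mon}(\mathbb{C}_+)$ and $\mathrm{Conv}(\mathbb{C}_+)$ are the classes of all monotone, respectively convex, curves in $\mathbb{C}_+$.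
   Context: $\mathbb{R}_+=(0,\infty)$ and $\mathbb{C}_+=\{z:\mathrm{Re}\,z>0\}$. A rectifiable curve $\gamma$ in $\mathbb{C}_+$ is parametrized by arclength, $z=z(s)=x(s)+iy(s)$, $s\in I$, $I\subset\mathbb{R}$ an interval. $\mathcal{L}_\gamma f(s)=\int_0^\infty f(t)e^{-z(s)t}\,dt$, $s\in I$. $L^{p'}(\gamma)$ is taken with respect to arclength measure. The curve is monotone if both coordinate functions $x(s)$, $y(s)$ are monotone (each either nondecreasing or nonincreasing). A closed curve is convex if it is the boundary of a convex set (traversed once). A non-closed curve $\gamma:[a,b]\to\mathbb{C}$ is convex if the closed curve obtained by joining the points $\gamma(a)$ and $\gamma(b)$ by a straight segment is convex. If the parameter interval $I$ is not compact, $\gamma$ is convex if, for an exhaustion of $I$ by an increasing sequence of compact intervals $I_1\subset I_2\subset\cdots$, each restriction $\gamma|_{I_n}$ is convex. *)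

theory Defs
  imports "HOL-Analysis.Analysis" "HOL-Probability.Essential_Supremum"
begin

subsection \<open>Lebesgue spaces of complex-valued functions\<close>

text \<open>Exponents range over \<^typ>\<open>ennreal\<close>; only values at least 1, including infinity, are relevant.
  Elements of the spaces are functions rather than classes modulo null sets.\<close>

definition Lp_norm :: "ennreal \<Rightarrow> 'a measure \<Rightarrow> ('a \<Rightarrow> complex) \<Rightarrow> ennreal" where
  "Lp_norm p M f =
     (if p = \<infinity> then esssup M (\<lambda>x. ennreal (norm (f x)))
      else let J = (\<integral>\<^sup>+ x. ennreal (norm (f x) powr enn2real p) \<partial>M)
           in if J = \<infinity> then \<infinity> else ennreal (enn2real J powr (1 / enn2real p)))"

definition Lp_space :: "ennreal \<Rightarrow> 'a measure \<Rightarrow> ('a \<Rightarrow> complex) set" where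
  "Lp_space p M = {f \<in> borel_measurable M. Lp_norm p M f < \<infinity>}"

definition continuous_Lp_operator ::
  "ennreal \<Rightarrow> 'a measure \<Rightarrow> ennreal \<Rightarrow> 'b measure \<Rightarrow> (('a \<Rightarrow> complex) \<Rightarrow> 'b \<Rightarrow> complex) \<Rightarrow> bool" where
  "continuous_Lp_operator p M q N T \<longleftrightarrow>
     (\<forall>f\<in>Lp_space p M. T f \<in> Lp_space q N) \<and>
     (\<forall>f\<in>Lp_space p M. \<forall>g\<in>Lp_space p M. \<forall>c d.
        AE s in N. T (\<lambda>x. c * f x + d * g x) s = c * T f s + d * T g s) \<and>
     (\<forall>f\<in>Lp_space p M. \<forall>e>0. \<exists>d>0. \<forall>g\<in>Lp_space p M.
        Lp_norm p M (\<lambda>x. g x - f x) < d \<longrightarrow> Lp_norm q N (\<lambda>s. T g s - T f s) < e)"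

definition Lp_operator_norm ::
  "ennreal \<Rightarrow> 'a measure \<Rightarrow> ennreal \<Rightarrow> 'b measure \<Rightarrow> (('a \<Rightarrow> complex) \<Rightarrow> 'b \<Rightarrow> complex) \<Rightarrow> ennreal" where
  "Lp_operator_norm p M q N T = (SUP f\<in>{f\<in>Lp_space p M. Lp_norm p M f \<le> 1}. Lp_norm q N (T f))"


subsection \<open>Curves parametrized by arclength\<close>

definition curve_length :: "(real \<Rightarrow> complex) \<Rightarrow> real \<Rightarrow> real \<Rightarrow> ennreal" where
  "curve_length z a b =
     (SUP (n, \<tau>)\<in>{(n, \<tau>). mono_on {..n} \<tau> \<and> \<tau> 0 = a \<and> \<tau> n = b}.
        \<Sum>i<n. ennreal (dist (z (\<tau> i)) (z (\<tau> (Suc i)))))"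

text \<open>A curve is a pair of a parameter interval \<open>I\<close> and a map \<open>z\<close>, whose values outside \<open>I\<close> are
  irrelevant. The total length may be infinite. Since a curve is parametrized by arclength, the
  arclength measure is Lebesgue measure on \<open>I\<close>.\<close>

definition arclength_curves :: "complex set \<Rightarrow> (real set \<times> (real \<Rightarrow> complex)) set" where
  "arclength_curves S =
     {(I, z). is_interval I \<and> z ` I \<subseteq> S \<and>
        (\<forall>a\<in>I. \<forall>b\<in>I. a \<le> b \<longrightarrow> curve_length z a b = ennreal (b - a))}"

definition monotone_curves :: "complex set \<Rightarrow> (real set \<times> (real \<Rightarrow> complex)) set" where
  "monotone_curves S =
     {(I, z) \<in> arclength_curves S.
        (mono_on I (\<lambda>s. Re (z s)) \<or> antimono_on I (\<lambda>s. Re (z s))) \<and>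
        (mono_on I (\<lambda>s. Im (z s)) \<or> antimono_on I (\<lambda>s. Im (z s)))}"

text \<open>A convex set without interior points, i.e. a segment, is regarded as a degenerate two-gon: its
  boundary is traversed once if it is passed forth and back, so that each inner point is visited
  twice. With this convention straight segments are convex curves.\<close>

definition traversed_once :: "(real \<Rightarrow> complex) \<Rightarrow> bool" where
  "traversed_once c \<longleftrightarrow>
     simple_path c \<or>
     (\<exists>u v. u \<noteq> v \<and> path_image c = closed_segment u v \<and>
        (\<forall>w\<in>{u, v}. card {t\<in>{0..<1}. c t = w} = 1) \<and>
        (\<forall>w\<in>open_segment u v. card {t\<in>{0..<1}. c t = w} = 2))"

definition convex_closed_curve :: "(real \<Rightarrow> complex) \<Rightarrow> bool" where
  "convex_closed_curve c \<longleftrightarrow>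
     path c \<and> pathfinish c = pathstart c \<and> traversed_once c \<and>
     (\<exists>K. convex K \<and> path_image c = frontier K)"

definition convex_on_compact :: "real \<Rightarrow> real \<Rightarrow> (real \<Rightarrow> complex) \<Rightarrow> bool" where
  "convex_on_compact a b z \<longleftrightarrow>
     a \<le> b \<and>
     (if z a = z b then convex_closed_curve (subpath a b z)
      else convex_closed_curve (subpath a b z +++ linepath (z b) (z a)))"

definition convex_curves :: "complex set \<Rightarrow> (real set \<times> (real \<Rightarrow> complex)) set" where
  "convex_curves S =
     {(I, z) \<in> arclength_curves S.
        if compact I then \<exists>a b. I = {a..b} \<and> convex_on_compact a b z
        else \<exists>a b :: nat \<Rightarrow> real.
               incseq (\<lambda>n. {a n..b n}) \<and> (\<Union>n. {a n..b n}) = I \<and>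
               (\<forall>n. convex_on_compact (a n) (b n) z)}"


subsection \<open>The Laplace transform along a curve\<close>

definition right_halfplane :: "complex set" where
  "right_halfplane = {z. Re z > 0}"

definition laplace_curve :: "(real \<Rightarrow> complex) \<Rightarrow> (real \<Rightarrow> complex) \<Rightarrow> real \<Rightarrow> complex" where
  "laplace_curve z f s = (LINT t|lebesgue_on {0<..}. f t * exp (- z s * of_real t))"

end

theory Submission
  imports Defs "HOL-Probability.Probability" "HOL-Complex_Analysis.Complex_Analysis"
begin

text \<open>
  For \<open>p = 1\<close> the bound is trivial, and the other exponents follow from \<open>p = 2\<close> by Riesz--Thorin
  interpolation, whose exact constant gives the power \<open>1 / p'\<close>.

  For \<open>p = 2\<close> let \<open>F\<close> be the Laplace transform of \<open>f\<close>, \<open>u = \<bar>F\<bar>\<^sup>2\<close>, and \<open>G\<close> the Laplace transform of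
  \<open>\<bar>f\<bar>\<close>. Along an arc on which both coordinates are monotone, \<open>ds \<le> \<bar>dx\<bar> + \<bar>dy\<bar>\<close>. The part
  with \<open>\<bar>dx\<bar>\<close> is controlled by \<open>u \<le> G(x)\<^sup>2\<close> and Hilbert's inequality
  \<open>\<integral> G(x)\<^sup>2 dx \<le> \<pi> \<parallel>f\<parallel>\<^sup>2\<close>. For the part with \<open>\<bar>dy\<bar>\<close>, integrating \<open>u\<^sub>x\<^sub>x + u\<^sub>y\<^sub>y = 4 \<bar>F'\<bar>\<^sup>2\<close>
  twice in \<open>x\<close> gives \<open>u = 4 P - W\<^sub>y\<close> with \<open>P(x, y) = \<integral> (\<xi> - x) \<bar>F'(\<xi> + \<i> y)\<bar>\<^sup>2 d\<xi>\<close> and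
  \<open>W(x, y) = \<integral> (\<xi> - x) u\<^sub>y(\<xi>, y) d\<xi>\<close>, both over \<open>\<xi> > x\<close>. Here \<open>P(x, y) \<le> Q(y) = P(0, y)\<close>, whose integral
  is at most a multiple of \<open>\<parallel>f\<parallel>\<^sup>2\<close> by Plancherel, \<open>\<bar>W\<bar> \<le> \<pi> \<parallel>f\<parallel>\<^sup>2\<close>, and \<open>\<bar>W\<^sub>x\<bar> \<le> G(x)\<^sup>2\<close>.
  All these quantities are double integrals of \<open>f(t)\<close> and the conjugate of \<open>f(t')\<close> against explicit
  kernels in \<open>t\<close> and \<open>t'\<close>, and the estimates are carried out there. The resulting constant is
  \<open>10 \<pi>\<close>.

  On a convex curve each level set of a coordinate has at most two points, apart from exceptional
  levels. So each coordinate is monotone on three pieces and the curve splits into nine monotone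
  arcs.
\<close>

subsection \<open>Dini derivatives and the three lines theorem\<close>

text \<open>The two terms of \<open>u = 4 P - W\<^sub>y\<close> are treated differently.
  \<open>P\<close> decreases in \<open>x\<close>, so it may be moved to the imaginary axis, where it
  depends on \<open>y\<close> alone. \<open>W\<^sub>y\<close> has no sign and is never estimated:
  along a curve \<open>W\<^sub>y dy = dW - W\<^sub>x dx\<close>, so it costs only the values of the
  bounded function \<open>W\<close> at the two ends and one more copy of
  \<open>G(x)\<^sup>2 \<bar>dx\<bar>\<close>. Monotonicity turns \<bar>dx\<bar> and \<bar>dy\<bar>
  into signed differentials; then \<open>W\<close> and the primitives of \<open>G\<^sup>2\<close>
  and \<open>Q\<close> are evaluated at the ends of the arc only, whatever the arc does in between.

  The identity and the interpolation are carried out where convergence is no issue: for bounded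
  \<open>f\<close> on a compact interval inside the open half-line, and for compact parameter
  intervals. The constants do not depend on these choices, so limits give the general case. The
  margin is wide: \<open>10 * pi \<le> 224 * pi\<close> for monotone curves,
  \<open>9 * 10 * pi \<le> 16 * 224 * pi\<close> for convex ones.\<close>

lemma nonincreasing_if_right_Dini_le_0:
  fixes D :: "real \<Rightarrow> real"
  assumes "a \<le> b" and cont: "continuous_on {a..b} D"
    and loc: "\<And>s e. a \<le> s \<Longrightarrow> s < b \<Longrightarrow> 0 < e \<Longrightarrow> \<exists>h>0. s + h \<le> b \<and> D (s + h) - D s \<le> e * h"
  shows "D b \<le> D a"
proof (rule field_le_epsilon)
  fix e0 :: real assume "0 < e0"
  define e where "e = e0 / (b - a + 1)"
  have "0 < e" using \<open>0 < e0\<close> \<open>a \<le> b\<close> by (simp add: e_def)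
  define E where "E r = D r - D a - e * (r - a)" for r
  have contE: "continuous_on {a..b} E"
    unfolding E_def by (intro continuous_intros cont)
  have E_b: "E b \<le> 0"
  proof (rule ccontr)
    assume "\<not> E b \<le> 0"
    define S where "S = {r\<in>{a..b}. E r \<le> 0}"
    have "closed S"
      unfolding S_def by (rule continuous_on_closed_Collect_le[OF contE continuous_on_const closed_atLeastAtMost])
    moreover have "bounded S" unfolding S_def by (rule bounded_subset[of "{a..b}"]) auto
    moreover have "a \<in> S" using \<open>a \<le> b\<close> by (simp add: S_def E_def)
    \<comment> \<open>\<open>c\<close> is the last point of \<open>S\<close>. If it lay before
      \<open>b\<close>, the local hypothesis would give a later point at which \<open>E\<close> is
      not larger, again in \<open>S\<close>.\<close>
    ultimately obtain c where c: "c \<in> S" "\<And>r. r \<in> S \<Longrightarrow> r \<le> c"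
      using compact_attains_sup[of S] by (auto simp: compact_eq_bounded_closed)
    then have "a \<le> c" "c < b" using \<open>\<not> E b \<le> 0\<close> by (auto simp: S_def order_le_less)
    from loc[OF this \<open>0 < e\<close>] obtain h where h: "0 < h" "c + h \<le> b" "D (c + h) - D c \<le> e * h" by blast
    then have "E (c + h) \<le> E c" by (simp add: E_def algebra_simps)
    then have "c + h \<in> S" using c(1) h \<open>a \<le> c\<close> by (auto simp: S_def)
    with c(2) h(1) show False by force
  qed
  have "e * (b - a) \<le> e0"
    using \<open>a \<le> b\<close> \<open>0 < e0\<close> by (simp add: e_def field_simps)
  then show "D b \<le> D a + e0" using E_b by (simp add: E_def)
qed

text \<open>Dividing by the \<open>w\<close>-th power of \<open>K\<close> normalizes both edges to
  1. The factor \<open>exp (e * (w * w - 1))\<close> has modulus at most 1 on the strip and decays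
  in the imaginary direction. So the purely qualitative bound \<open>B\<close> is beaten on the
  horizontal sides of a tall rectangle, the maximum principle applies there, and finally
  \<open>e\<close> tends to 0.\<close>

lemma three_lines:
  fixes F :: "complex \<Rightarrow> complex"
  assumes hol: "F holomorphic_on UNIV" and K: "0 < K"
    and bdd: "\<And>w. 0 \<le> Re w \<Longrightarrow> Re w \<le> 1 \<Longrightarrow> norm (F w) \<le> B"
    and left: "\<And>w. Re w = 0 \<Longrightarrow> norm (F w) \<le> 1"
    and right: "\<And>w. Re w = 1 \<Longrightarrow> norm (F w) \<le> K"
    and \<theta>: "0 \<le> \<theta>" "\<theta> \<le> 1"
  shows "norm (F (of_real \<theta>)) \<le> K powr \<theta>"
proof -
  define k where "k = ln K"
  define G where "G e w = F w * exp (- (of_real k * w)) * exp (of_real e * (w * w - 1))" for e :: real and w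
  have nG: "norm (G e w) = norm (F w) * exp (- k * Re w) * exp (e * ((Re w)\<^sup>2 - (Im w)\<^sup>2 - 1))" for e w
    by (simp add: G_def norm_mult norm_exp_eq_Re power2_eq_square)
  define B' where "B' = max B 1 * exp \<bar>k\<bar>"
  have B'1: "1 \<le> B'" unfolding B'_def
    using mult_mono[of 1 "max B 1" 1 "exp \<bar>k\<bar>"] by simp
  have *: "norm (F (of_real \<theta>)) * exp (- k * \<theta>) * exp (e * (\<theta>\<^sup>2 - 1)) \<le> 1" if e: "0 < e" for e
  proof -
    \<comment> \<open>At height \<open>R\<close> the decay \<open>exp (- e * R\<^sup>2)\<close>
      compensates \<open>B'\<close>. The added 1 keeps \<open>R\<close> positive when
      \<open>B' = 1\<close>.\<close>
    define R where "R = 1 + sqrt (ln B' / e)"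
    have R: "0 < R" "ln B' \<le> e * R\<^sup>2"
    proof -
      have "0 \<le> ln B' / e" using B'1 e by simp
      then show "0 < R" by (simp add: R_def add_pos_nonneg)
      have "ln B' / e = (sqrt (ln B' / e))\<^sup>2" using \<open>0 \<le> ln B' / e\<close> by simp
      also have "\<dots> \<le> R\<^sup>2" unfolding R_def using \<open>0 \<le> ln B' / e\<close> by (intro power_mono) auto
      finally show "ln B' \<le> e * R\<^sup>2" using e by (simp add: field_simps)
    qed
    let ?S = "cbox (Complex 0 (-R)) (Complex 1 R)"
    have "norm (G e (of_real \<theta>)) \<le> 1"
    proof (rule maximum_modulus_frontier[of "G e" ?S])
      have "G e holomorphic_on UNIV" unfolding G_def by (intro holomorphic_intros hol)
      then show "G e holomorphic_on interior ?S" "continuous_on (closure ?S) (G e)"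
        by (auto intro: holomorphic_on_subset holomorphic_on_imp_continuous_on)
      show "of_real \<theta> \<in> ?S" using \<theta> R by (auto simp: in_cbox_complex_iff)
      fix w assume "w \<in> frontier ?S"
      then have w: "w \<in> ?S" "w \<notin> box (Complex 0 (-R)) (Complex 1 R)"
        by (auto simp: frontier_def interior_cbox)
      then have re: "0 \<le> Re w" "Re w \<le> 1" by (auto simp: in_cbox_complex_iff)
      then have sq: "(Re w)\<^sup>2 \<le> 1" by (simp add: power_le_one)
      from w consider "Re w = 0" | "Re w = 1" | "\<bar>Im w\<bar> = R"
        by (auto simp: in_cbox_complex_iff in_box_complex_iff)
      then show "norm (G e w) \<le> 1"
      proof cases
        case 1
        have "e * (- (Im w)\<^sup>2 - 1) \<le> 0" using e zero_le_power2[of "Im w"] by (intro mult_nonneg_nonpos) linarith+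
        then have "exp (e * (- (Im w)\<^sup>2 - 1)) \<le> 1" by simp
        then show ?thesis using left[OF 1] 1 by (simp add: nG mult_le_one)
      next
        case 2
        have "norm (F w) * exp (- k) \<le> 1" using right[OF 2] K by (simp add: k_def exp_minus field_simps)
        moreover have "exp (e * (- (Im w)\<^sup>2)) \<le> 1" using e by simp
        ultimately show ?thesis using 2 by (simp add: nG mult_le_one)
      next
        case 3
        have "norm (F w) * exp (- k * Re w) \<le> B'"
          unfolding B'_def
        proof (intro mult_mono)
          show "norm (F w) \<le> max B 1" using bdd[OF re] by simp
          have "- k * Re w \<le> \<bar>k * Re w\<bar>" using abs_ge_minus_self[of "k * Re w"] by simp
          also have "\<dots> = \<bar>k\<bar> * Re w" using re by (simp add: abs_mult)
          also have "\<dots> \<le> \<bar>k\<bar>" using re by (intro mult_left_le) auto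
          finally have "- k * Re w \<le> \<bar>k\<bar>" .
          then show "exp (- k * Re w) \<le> exp \<bar>k\<bar>" by simp
        qed auto
        moreover have "exp (e * ((Re w)\<^sup>2 - (Im w)\<^sup>2 - 1)) \<le> exp (- ln B')"
        proof -
          have "(Im w)\<^sup>2 = R\<^sup>2" using 3 by (metis power2_abs)
          then have "e * ((Re w)\<^sup>2 - (Im w)\<^sup>2 - 1) \<le> e * (- R\<^sup>2)"
            using e sq by (intro mult_left_mono) auto
          then show ?thesis using R by simp
        qed
        moreover have "exp (- ln B') = 1 / B'" using B'1 by (simp add: exp_minus inverse_eq_divide)
        ultimately have "norm (G e w) \<le> B' * (1 / B')"
          unfolding nG using B'1 by (intro mult_mono) auto
        then show ?thesis using B'1 by simp
      qed
    qed auto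
    then show ?thesis by (simp add: nG)
  qed
  have "((\<lambda>e. norm (F (of_real \<theta>)) * exp (- k * \<theta>) * exp (e * (\<theta>\<^sup>2 - 1)))
      \<longlongrightarrow> norm (F (of_real \<theta>)) * exp (- k * \<theta>) * exp (0 * (\<theta>\<^sup>2 - 1))) (at_right 0)"
    by (intro tendsto_intros)
  then have "norm (F (of_real \<theta>)) * exp (- k * \<theta>) * exp (0 * (\<theta>\<^sup>2 - 1)) \<le> 1"
    by (rule tendsto_upperbound) (use * in \<open>auto intro!: eventually_at_right_less[THEN eventually_mono]\<close>)
  then show ?thesis using K
    by (simp add: k_def powr_def exp_minus field_simps)
qed

lemma lipschitz_continuous_on:
  fixes z :: "real \<Rightarrow> complex"
  assumes "\<And>s s'. s \<in> I \<Longrightarrow> s' \<in> I \<Longrightarrow> s \<le> s' \<Longrightarrow> norm (z s' - z s) \<le> s' - s"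
  shows "continuous_on I z"
proof (rule continuous_onI)
  fix s e :: real assume s: "s \<in> I" "0 < e"
  have "dist (z s') (z s) \<le> dist s' s" if "s' \<in> I" for s'
    using assms[of s s'] assms[of s' s] s that by (cases "s \<le> s'") (auto simp: dist_norm norm_minus_commute)
  then show "\<exists>d>0. \<forall>x'\<in>I. dist x' s < d \<longrightarrow> dist (z x') (z s) \<le> e"
    using s by (intro exI[of _ e]) force
qed

lemma antimono_limit_0:
  fixes g :: "real \<Rightarrow> real"
  assumes "\<And>x. (g has_real_derivative g' x) (at x)" "\<And>x. g' x \<le> 0" "(g \<longlongrightarrow> 0) at_top"
  shows "0 \<le> g x" "x \<le> y \<Longrightarrow> g y \<le> g x"
proof -
  show *: "x \<le> y \<Longrightarrow> g y \<le> g x" for x y using assms by (metis DERIV_nonpos_imp_nonincreasing)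
  show "0 \<le> g x"
    by (rule tendsto_upperbound[OF assms(3)]) (use eventually_mono[OF eventually_ge_at_top[of x] *] in auto)
qed

lemma borel_measurable_cnj[measurable (raw)]:
  "g \<in> borel_measurable N \<Longrightarrow> (\<lambda>w. cnj (g w)) \<in> borel_measurable N"
  by (rule borel_measurable_continuous_on[OF continuous_on_cnj[OF continuous_on_id]])

subsection \<open>Schur's test\<close>

text \<open>By weighted AM-GM, \<open>F x * F y \<le> h y * g x + h x * g y\<close> with
  \<open>g = F\<^sup>2 / (2 h)\<close>. This splits the double integral into two halves that agree
  by the symmetry of \<open>k\<close>, and the hypothesis on \<open>h\<close> bounds each of them
  with the constant \<open>C / 2\<close>.\<close>

lemma schur_test:
  fixes k :: "'a \<times> 'a \<Rightarrow> ennreal" and F h :: "'a \<Rightarrow> real"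
  assumes "sigma_finite_measure \<mu>"
    and k[measurable]: "k \<in> borel_measurable (\<mu> \<Otimes>\<^sub>M \<mu>)" and sym: "\<And>x y. k (x, y) = k (y, x)"
    and [measurable]: "F \<in> borel_measurable \<mu>" "h \<in> borel_measurable \<mu>"
    and F: "\<And>x. 0 \<le> F x" and h: "\<And>x. x \<in> space \<mu> \<Longrightarrow> 0 < h x"
    and k_h: "\<And>x. x \<in> space \<mu> \<Longrightarrow> (\<integral>\<^sup>+y. k (x, y) * ennreal (h y) \<partial>\<mu>) \<le> ennreal (C * h x)" and "0 \<le> C"
  shows "(\<integral>\<^sup>+w. k w * ennreal (F (fst w) * F (snd w)) \<partial>(\<mu> \<Otimes>\<^sub>M \<mu>)) \<le> ennreal C * (\<integral>\<^sup>+x. ennreal ((F x)\<^sup>2) \<partial>\<mu>)"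
proof -
  interpret sigma_finite_measure \<mu> by fact
  interpret pair_sigma_finite \<mu> \<mu> by unfold_locales
  define g where "g x = (F x)\<^sup>2 / (2 * h x)" for x
  have [measurable]: "g \<in> borel_measurable \<mu>" unfolding g_def by measurable
  have g0: "x \<in> space \<mu> \<Longrightarrow> 0 \<le> g x" for x using h[of x] by (simp add: g_def)
  let ?S = "\<integral>\<^sup>+x. (\<integral>\<^sup>+y. k (x, y) * ennreal (h y) * ennreal (g x) \<partial>\<mu>) \<partial>\<mu>"
  let ?E = "\<integral>\<^sup>+x. ennreal ((F x)\<^sup>2) \<partial>\<mu>"
  have half: "?S \<le> ennreal (C / 2) * ?E"
  proof -
    have "?S
        \<le> (\<integral>\<^sup>+x. ennreal (C / 2) * ennreal ((F x)\<^sup>2) \<partial>\<mu>)"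
    proof (rule nn_integral_mono)
      fix x assume x: "x \<in> space \<mu>"
      have "(\<integral>\<^sup>+y. k (x, y) * ennreal (h y) * ennreal (g x) \<partial>\<mu>) = (\<integral>\<^sup>+y. k (x, y) * ennreal (h y) \<partial>\<mu>) * ennreal (g x)"
        using x by (intro nn_integral_multc) measurable
      also have "\<dots> \<le> ennreal (C * h x) * ennreal (g x)" using k_h[OF x] by (rule mult_right_mono) simp
      also have "\<dots> = ennreal (C / 2) * ennreal ((F x)\<^sup>2)"
        using h[OF x] g0[OF x] \<open>0 \<le> C\<close> by (simp add: g_def ennreal_mult[symmetric])
      finally show "(\<integral>\<^sup>+y. k (x, y) * ennreal (h y) * ennreal (g x) \<partial>\<mu>) \<le> ennreal (C / 2) * ennreal ((F x)\<^sup>2)" .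
    qed
    then show ?thesis by (simp add: nn_integral_cmult)
  qed
  have "(\<integral>\<^sup>+w. k w * ennreal (F (fst w) * F (snd w)) \<partial>(\<mu> \<Otimes>\<^sub>M \<mu>))
     \<le> (\<integral>\<^sup>+w. k w * ennreal (h (snd w)) * ennreal (g (fst w)) + k w * ennreal (h (fst w)) * ennreal (g (snd w)) \<partial>(\<mu> \<Otimes>\<^sub>M \<mu>))"
  proof (rule nn_integral_mono)
    fix w assume w: "w \<in> space (\<mu> \<Otimes>\<^sub>M \<mu>)"
    define x y where "x = fst w" and "y = snd w"
    have xy: "x \<in> space \<mu>" "y \<in> space \<mu>" using w by (auto simp: x_def y_def space_pair_measure)
    have "0 \<le> (F x * h y - F y * h x)\<^sup>2" by simp
    then have "F x * F y \<le> h y * g x + h x * g y"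
      using h[OF xy(1)] h[OF xy(2)]
      by (simp add: g_def field_simps power2_eq_square)
    then have "ennreal (F x * F y) \<le> ennreal (h y) * ennreal (g x) + ennreal (h x) * ennreal (g y)"
      using h[OF xy(1)] h[OF xy(2)] g0 xy by (simp add: ennreal_mult[symmetric] ennreal_plus[symmetric] del: ennreal_plus)
    then have "k w * ennreal (F x * F y) \<le> k w * (ennreal (h y) * ennreal (g x) + ennreal (h x) * ennreal (g y))"
      by (rule mult_left_mono) simp
    then show "k w * ennreal (F (fst w) * F (snd w)) \<le> k w * ennreal (h (snd w)) * ennreal (g (fst w)) + k w * ennreal (h (fst w)) * ennreal (g (snd w))"
      by (simp add: x_def y_def algebra_simps)
  qed
  also have "\<dots> = (\<integral>\<^sup>+w. k w * ennreal (h (snd w)) * ennreal (g (fst w)) \<partial>(\<mu> \<Otimes>\<^sub>M \<mu>)) + (\<integral>\<^sup>+w. k w * ennreal (h (fst w)) * ennreal (g (snd w)) \<partial>(\<mu> \<Otimes>\<^sub>M \<mu>))"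
    by (intro nn_integral_add) measurable
  also have "(\<integral>\<^sup>+w. k w * ennreal (h (snd w)) * ennreal (g (fst w)) \<partial>(\<mu> \<Otimes>\<^sub>M \<mu>)) = ?S"
    using sigma_finite_measure.nn_integral_fst[OF assms(1), of "\<lambda>w. k w * ennreal (h (snd w)) * ennreal (g (fst w))" \<mu>] by simp
  also have "(\<integral>\<^sup>+w. k w * ennreal (h (fst w)) * ennreal (g (snd w)) \<partial>(\<mu> \<Otimes>\<^sub>M \<mu>)) = (\<integral>\<^sup>+y. (\<integral>\<^sup>+x. k (x, y) * ennreal (h x) * ennreal (g y) \<partial>\<mu>) \<partial>\<mu>)"
    by (subst nn_integral_snd[symmetric]) (auto simp: split_beta')
  also have "\<dots> = ?S"
    by (subst sym) simp
  also note add_mono[OF half half]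
  also have "ennreal (C / 2) * ?E + ennreal (C / 2) * ?E = ennreal C * ?E"
    using \<open>0 \<le> C\<close> by (simp add: distrib_right[symmetric] ennreal_plus[symmetric] del: ennreal_plus)
  finally show ?thesis .
qed


text \<open>The weight \<open>1 / sqrt r\<close> is the classical one for Hilbert's kernel: over the
  whole half-line the integral would equal \<open>pi / sqrt t\<close>. An antiderivative is
  \<open>2 / sqrt t * arctan (sqrt r / sqrt t)\<close>.\<close>

lemma hilbert_kernel_test:
  fixes m M t :: real
  assumes "0 < m" "m \<le> t" "t \<le> M"
  shows "(\<integral>\<^sup>+r. ennreal (1 / (t + r)) * ennreal (1 / sqrt r) \<partial>lebesgue_on {m..M}) \<le> ennreal (pi * (1 / sqrt t))"
proof -
  have t: "0 < t" "m \<le> M" using assms by auto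
  have "(\<integral>\<^sup>+r. ennreal (1 / (t + r)) * ennreal (1 / sqrt r) \<partial>lebesgue_on {m..M})
      = (\<integral>\<^sup>+r. ennreal (1 / (t + r)) * ennreal (1 / sqrt r) * indicator {m..M} r \<partial>lborel)"
    by (subst nn_integral_restrict_space) (auto simp: nn_integral_completion)
  also have "\<dots> = (\<integral>\<^sup>+r. ennreal (1 / (t + r) * (1 / sqrt r)) * indicator {m..M} r \<partial>lborel)"
    using assms by (intro nn_integral_cong) (auto simp: ennreal_mult'[symmetric] indicator_def)
  also have "\<dots> = ennreal (2 / sqrt t * arctan (sqrt M / sqrt t) - 2 / sqrt t * arctan (sqrt m / sqrt t))"
  proof (rule nn_integral_FTC_Icc)
    fix r assume r: "r \<in> {m..M}"
    then have "0 < r" using assms by simp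
    have eq: "2 / sqrt t * (inverse (1 + (sqrt r / sqrt t)\<^sup>2) * (inverse (sqrt r) / 2 / sqrt t)) = 1 / (t + r) * (1 / sqrt r)"
    proof -
      have "1 + (sqrt r / sqrt t)\<^sup>2 = (t + r) / t" using \<open>0 < r\<close> t by (simp add: power_divide field_simps)
      moreover have "2 / sqrt t * (x * (inverse (sqrt r) / 2 / sqrt t)) = x * inverse (sqrt r) / (sqrt t * sqrt t)" for x
        by simp
      ultimately have "2 / sqrt t * (inverse (1 + (sqrt r / sqrt t)\<^sup>2) * (inverse (sqrt r) / 2 / sqrt t)) = inverse ((t + r) / t) * inverse (sqrt r) / t"
        using t by (simp only: real_sqrt_mult_self abs_of_pos)
      then show ?thesis using t \<open>0 < r\<close> by (simp add: inverse_eq_divide)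
    qed
    have "((\<lambda>r. 2 / sqrt t * arctan (sqrt r / sqrt t)) has_real_derivative
        2 / sqrt t * (inverse (1 + (sqrt r / sqrt t)\<^sup>2) * (inverse (sqrt r) / 2 / sqrt t))) (at r)"
      by (rule DERIV_cmult[OF DERIV_chain2[OF DERIV_arctan DERIV_cdivide[OF DERIV_real_sqrt[OF \<open>0 < r\<close>]]]])
    then show "((\<lambda>r. 2 / sqrt t * arctan (sqrt r / sqrt t)) has_real_derivative 1 / (t + r) * (1 / sqrt r)) (at r)"
      by (simp only: eq)
    show "0 \<le> 1 / (t + r) * (1 / sqrt r)" using \<open>0 < r\<close> t by simp
  qed (use t in auto)
  also have "\<dots> \<le> ennreal (pi * (1 / sqrt t))"
  proof (rule ennreal_leI)
    have "0 \<le> arctan (sqrt m / sqrt t)" using assms by simp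
    moreover have "arctan (sqrt M / sqrt t) \<le> pi / 2" using arctan_ubound less_imp_le by blast
    ultimately have "arctan (sqrt M / sqrt t) - arctan (sqrt m / sqrt t) \<le> pi / 2" by linarith
    then have "2 / sqrt t * (arctan (sqrt M / sqrt t) - arctan (sqrt m / sqrt t)) \<le> 2 / sqrt t * (pi / 2)"
      using t by (intro mult_left_mono) auto
    then show "2 / sqrt t * arctan (sqrt M / sqrt t) - 2 / sqrt t * arctan (sqrt m / sqrt t) \<le> pi * (1 / sqrt t)"
      by (simp add: algebra_simps)
  qed
  finally show ?thesis .
qed

text \<open>The integrand is \<open>sqrt (2 * pi) / Y\<close> times the normal density with mean
  \<open>t\<close> and standard deviation \<open>1 / Y\<close>, whose total mass is 1.\<close>

lemma gaussian_kernel_test: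
  fixes m M t Y :: real
  assumes "0 < Y"
  shows "(\<integral>\<^sup>+r. ennreal (exp (- (Y * (t - r))\<^sup>2 / 2)) \<partial>lebesgue_on {m..M}) \<le> ennreal (sqrt (2 * pi) / Y)"
proof -
  have "(\<integral>\<^sup>+r. ennreal (exp (- (Y * (t - r))\<^sup>2 / 2)) \<partial>lebesgue_on {m..M})
      = (\<integral>\<^sup>+r. ennreal (exp (- (Y * (t - r))\<^sup>2 / 2)) * indicator {m..M} r \<partial>lborel)"
    by (subst nn_integral_restrict_space) (auto simp: nn_integral_completion)
  also have "\<dots> \<le> (\<integral>\<^sup>+r. ennreal (sqrt (2 * pi) / Y) * ennreal (normal_density t (1 / Y) r) \<partial>lborel)"
  proof (rule nn_integral_mono)
    fix r
    have "exp (- (Y * (t - r))\<^sup>2 / 2) = sqrt (2 * pi) / Y * normal_density t (1 / Y) r"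
      using assms by (simp add: normal_density_def real_sqrt_divide real_sqrt_mult power_mult_distrib power2_commute[of t r] divide_simps mult.commute)
    then show "ennreal (exp (- (Y * (t - r))\<^sup>2 / 2)) * indicator {m..M} r \<le> ennreal (sqrt (2 * pi) / Y) * ennreal (normal_density t (1 / Y) r)"
      using assms by (simp add: ennreal_mult[symmetric] indicator_def)
  qed
  also have "\<dots> = ennreal (sqrt (2 * pi) / Y) * 1"
    using assms prob_space.emeasure_space_1[OF prob_space_normal_density[of "1 / Y" t]]
    by (simp add: nn_integral_cmult emeasure_density)
  finally show ?thesis by simp
qed

subsection \<open>Exponential double integrals\<close>

lemma norm_exp_minus_linear_le:
  fixes w :: complex
  shows "norm (exp w - 1 - w) \<le> exp (norm w) * (norm w)\<^sup>2"
proof -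
  have "norm (exp w - (\<Sum>i\<le>1. w ^ i / fact i)) \<le> exp \<bar>Re w\<bar> * (norm w) ^ Suc 1 / fact 1"
    by (rule Taylor_exp)
  also have "\<dots> \<le> exp (norm w) * (norm w)\<^sup>2"
    using abs_Re_le_cmod[of w] by (auto simp: power2_eq_square intro!: mult_right_mono)
  finally show ?thesis by (simp add: algebra_simps)
qed

text \<open>This models double Laplace integrals: \<open>N\<close> will be the product of two copies
  of the measure in \<open>t\<close>, \<open>\<alpha>\<close> the sum and \<open>\<beta>\<close> the
  difference of the two variables. The bound \<open>R\<close> makes \<open>expint g\<close> converge
  at every complex point when \<open>g\<close> is bounded.\<close>

locale exp_kernel = finite_measure N for N :: "'a measure" +
  fixes \<alpha> \<beta> :: "'a \<Rightarrow> real" and R :: real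
  assumes \<alpha>_meas[measurable]: "\<alpha> \<in> borel_measurable N" and \<beta>_meas[measurable]: "\<beta> \<in> borel_measurable N"
    and R: "0 < R" "\<And>w. w \<in> space N \<Longrightarrow> \<bar>\<alpha> w\<bar> \<le> R" "\<And>w. w \<in> space N \<Longrightarrow> \<bar>\<beta> w\<bar> \<le> R"
begin

definition expk :: "complex \<Rightarrow> 'a \<Rightarrow> complex" where
  "expk \<zeta> w = exp (- of_real (Re \<zeta> * \<alpha> w) - \<i> * of_real (Im \<zeta> * \<beta> w))"

definition expint :: "('a \<Rightarrow> complex) \<Rightarrow> complex \<Rightarrow> complex" where
  "expint g \<zeta> = (LINT w|N. g w * expk \<zeta> w)"

definition bdd_meas :: "('a \<Rightarrow> complex) \<Rightarrow> bool" where
  "bdd_meas g \<longleftrightarrow> g \<in> borel_measurable N \<and> (\<exists>c. \<forall>w\<in>space N. norm (g w) \<le> c)"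

lemma bdd_measD: "bdd_meas g \<Longrightarrow> g \<in> borel_measurable N"
  by (simp add: bdd_meas_def)

lemma bdd_measE:
  assumes "bdd_meas g" obtains c where "0 < c" "\<And>w. w \<in> space N \<Longrightarrow> norm (g w) \<le> c"
proof -
  from assms obtain c where "\<forall>w\<in>space N. norm (g w) \<le> c" by (auto simp: bdd_meas_def)
  then show thesis by (intro that[of "max c 1"]) auto
qed

lemma bdd_meas_mult: assumes "bdd_meas g" "bdd_meas h" shows "bdd_meas (\<lambda>w. g w * h w)"
proof -
  obtain c d where "0 < c" "\<And>w. w \<in> space N \<Longrightarrow> norm (g w) \<le> c"
    "0 < d" "\<And>w. w \<in> space N \<Longrightarrow> norm (h w) \<le> d" using assms by (metis bdd_measE)
  then have "\<forall>w\<in>space N. norm (g w * h w) \<le> c * d"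
    by (auto simp: norm_mult intro!: mult_mono intro: less_imp_le)
  then show ?thesis using assms unfolding bdd_meas_def by (auto intro: borel_measurable_times)
qed

lemma bdd_meas_\<alpha>: "bdd_meas (\<lambda>w. of_real (\<alpha> w))" and bdd_meas_\<beta>: "bdd_meas (\<lambda>w. of_real (\<beta> w))"
  unfolding bdd_meas_def using R by (auto intro!: exI[of _ R])

lemma bdd_meas_expk: "bdd_meas (expk \<zeta>)"
proof -
  have "norm (expk \<zeta> w) \<le> exp (\<bar>Re \<zeta>\<bar> * R)" if "w \<in> space N" for w
  proof -
    have "- (Re \<zeta> * \<alpha> w) \<le> \<bar>Re \<zeta>\<bar> * \<bar>\<alpha> w\<bar>" by (simp flip: abs_mult)
    also have "\<dots> \<le> \<bar>Re \<zeta>\<bar> * R" using R(2)[OF that] by (intro mult_left_mono) auto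
    finally show ?thesis by (simp add: expk_def norm_exp_eq_Re)
  qed
  moreover have "expk \<zeta> \<in> borel_measurable N" unfolding expk_def by measurable
  ultimately show ?thesis by (auto simp: bdd_meas_def)
qed

lemma bdd_meas_integrable: assumes "bdd_meas g" shows "integrable N g"
proof -
  obtain c where "0 < c" "\<And>w. w \<in> space N \<Longrightarrow> norm (g w) \<le> c" using assms by (metis bdd_measE)
  then show ?thesis using assms by (intro integrable_const_bound[of _ c]) (auto simp: bdd_meas_def)
qed

lemma expint_integrable: "bdd_meas g \<Longrightarrow> integrable N (\<lambda>w. g w * expk \<zeta> w)"
  by (intro bdd_meas_integrable bdd_meas_mult bdd_meas_expk)

lemma norm_expint_le:
  assumes "bdd_meas g" shows "norm (expint g \<zeta>) \<le> (LINT w|N. norm (g w) * exp (- (Re \<zeta> * \<alpha> w)))"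
proof -
  have "norm (expint g \<zeta>) \<le> (LINT w|N. norm (g w * expk \<zeta> w))"
    unfolding expint_def by (rule integral_norm_bound)
  then show ?thesis by (simp add: norm_mult expk_def norm_exp_eq_Re)
qed

text \<open>In general \<open>expk\<close> is not holomorphic in \<open>\<zeta>\<close>, as
  \<open>\<alpha>\<close> and \<open>\<beta>\<close> differ, so the derivative is only real linear.
  It comes from a quadratic bound on the remainder of the exponential that is uniform in
  \<open>w\<close>.\<close>

lemma expint_has_derivative:
  assumes g: "bdd_meas g"
  shows "(expint g has_derivative
     (\<lambda>h. - of_real (Re h) * expint (\<lambda>w. of_real (\<alpha> w) * g w) \<zeta>
          - \<i> * of_real (Im h) * expint (\<lambda>w. of_real (\<beta> w) * g w) \<zeta>)) (at \<zeta>)"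
proof -
  obtain c where c: "0 < c" "\<And>w. w \<in> space N \<Longrightarrow> norm (g w) \<le> c" using g by (metis bdd_measE)
  obtain d where d: "0 < d" "\<And>w. w \<in> space N \<Longrightarrow> norm (expk \<zeta> w) \<le> d" using bdd_meas_expk by (metis bdd_measE)
  let ?L = "\<lambda>h. - of_real (Re h) * expint (\<lambda>w. of_real (\<alpha> w) * g w) \<zeta>
          - \<i> * of_real (Im h) * expint (\<lambda>w. of_real (\<beta> w) * g w) \<zeta>"
  have "linear ?L" by (rule linearI) (auto simp: algebra_simps scaleR_conv_of_real)
  then have bl: "bounded_linear ?L" by (simp add: linear_conv_bounded_linear)
  \<comment> \<open>\<open>c\<close> and \<open>d\<close> bound \<open>g\<close> and
    \<open>expk \<zeta>\<close>. The remaining factor bounds the second-order remainder of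
    \<open>exp (v w)\<close>, where \<open>norm (v w) \<le> norm h * (2 * R)\<close> and
    \<open>norm h \<le> 1\<close>.\<close>
  define C where "C = c * (d * (exp (2 * R) * (2 * R)\<^sup>2)) * measure N (space N)"
  have C0: "0 \<le> C" using c(1) d(1) by (simp add: C_def)
  have main: "norm (expint g (\<zeta> + h) - expint g \<zeta> - ?L h) \<le> C * (norm h)\<^sup>2" if h: "norm h \<le> 1" for h
  proof -
    define v where "v w = - of_real (Re h * \<alpha> w) - \<i> * of_real (Im h * \<beta> w)" for w
    have v_meas: "v \<in> borel_measurable N" unfolding v_def by measurable
    have v_le: "norm (v w) \<le> norm h * (2 * R)" if "w \<in> space N" for w
    proof -
      have "norm (v w) \<le> \<bar>Re h\<bar> * \<bar>\<alpha> w\<bar> + \<bar>Im h\<bar> * \<bar>\<beta> w\<bar>"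
        unfolding v_def by (intro order.trans[OF norm_triangle_ineq4]) (simp add: norm_mult abs_mult)
      also have "\<dots> \<le> norm h * R + norm h * R"
        using R(2,3)[OF that] abs_Re_le_cmod[of h] abs_Im_le_cmod[of h]
        by (intro add_mono mult_mono) auto
      finally show ?thesis by (simp add: algebra_simps)
    qed
    have L: "?L h = (LINT w|N. g w * expk \<zeta> w * v w)"
    proof -
      have "(LINT w|N. g w * expk \<zeta> w * v w) = (LINT w|N. - of_real (Re h) * (of_real (\<alpha> w) * g w * expk \<zeta> w)
             - \<i> * of_real (Im h) * (of_real (\<beta> w) * g w * expk \<zeta> w))"
        unfolding v_def by (intro Bochner_Integration.integral_cong) (auto simp: algebra_simps)
      also have "\<dots> = ?L h"
        unfolding expint_def
        by (subst Bochner_Integration.integral_diff)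
          (auto intro!: integrable_mult_right expint_integrable bdd_meas_mult bdd_meas_\<alpha> bdd_meas_\<beta> g simp del: mult_minus_left)
      finally show ?thesis by simp
    qed
    have split: "expk (\<zeta> + h) w = expk \<zeta> w * exp (v w)" for w
      unfolding expk_def v_def by (simp add: exp_add[symmetric] algebra_simps)
    have bv: "bdd_meas v" using v_meas v_le unfolding bdd_meas_def by (auto intro!: exI[of _ "norm h * (2*R)"])
    have "expint g (\<zeta> + h) - expint g \<zeta> - ?L h = (LINT w|N. g w * (expk \<zeta> w * (exp (v w) - 1 - v w)))"
    proof -
      have "expint g (\<zeta> + h) - expint g \<zeta> - ?L h =
        (LINT w|N. g w * expk (\<zeta> + h) w - g w * expk \<zeta> w - g w * expk \<zeta> w * v w)"
        unfolding L unfolding expint_def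
        by (subst Bochner_Integration.integral_diff Bochner_Integration.integral_diff,
            (intro Bochner_Integration.integrable_diff expint_integrable g bdd_meas_integrable bdd_meas_mult bdd_meas_expk bv)+)+ simp
      then show ?thesis by (simp add: split algebra_simps)
    qed
    also have "norm \<dots> \<le> (LINT w|N. norm (g w * (expk \<zeta> w * (exp (v w) - 1 - v w))))"
      by (rule integral_norm_bound)
    also have "\<dots> \<le> (LINT w|N. c * (d * (exp (2 * R) * (norm h * (2 * R))\<^sup>2)))"
    proof (rule integral_mono_AE')
      show "AE w in N. norm (g w * (expk \<zeta> w * (exp (v w) - 1 - v w))) \<le> c * (d * (exp (2 * R) * (norm h * (2 * R))\<^sup>2))"
      proof (intro AE_I2)
        fix w assume w: "w \<in> space N"
        have "norm (v w) \<le> 2 * R" using v_le[OF w] h R(1)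
          by (meson dual_order.trans mult_le_cancel_right1 mult_left_le_one_le norm_ge_zero order_less_imp_le mult_pos_pos zero_less_numeral)
        have "norm (exp (v w) - 1 - v w) \<le> exp (norm (v w)) * (norm (v w))\<^sup>2" by (rule norm_exp_minus_linear_le)
        also have "\<dots> \<le> exp (2 * R) * (norm h * (2 * R))\<^sup>2"
          using v_le[OF w] \<open>norm (v w) \<le> 2 * R\<close> by (intro mult_mono power_mono) auto
        finally show "norm (g w * (expk \<zeta> w * (exp (v w) - 1 - v w))) \<le> c * (d * (exp (2 * R) * (norm h * (2 * R))\<^sup>2))"
          unfolding norm_mult using c d w by (intro mult_mono) (auto intro: less_imp_le)
      qed
    qed (use c(1) d(1) in \<open>auto intro!: AE_I2 mult_nonneg_nonneg\<close>)
    also have "\<dots> = C * (norm h)\<^sup>2" by (simp add: C_def power_mult_distrib algebra_simps)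
    finally show ?thesis .
  qed
  show ?thesis
    unfolding has_derivative_at_alt
  proof (intro conjI allI impI bl)
    fix e :: real assume e: "0 < e"
    show "\<exists>d>0. \<forall>y. norm (y - \<zeta>) < d \<longrightarrow> norm (expint g y - expint g \<zeta> - ?L (y - \<zeta>)) \<le> e * norm (y - \<zeta>)"
    proof (intro exI[of _ "min 1 (e / (C + 1))"] conjI allI impI)
      show "0 < min 1 (e / (C + 1))" using e C0 by simp
      fix y assume y: "norm (y - \<zeta>) < min 1 (e / (C + 1))"
      then have "C * norm (y - \<zeta>) \<le> C * (e / (C + 1))" using C0 by (intro mult_left_mono) auto
      also have "\<dots> \<le> e" using C0 e by (simp add: field_simps)
      finally have "C * norm (y - \<zeta>) * norm (y - \<zeta>) \<le> e * norm (y - \<zeta>)" by (rule mult_right_mono) simp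
      with main[of "y - \<zeta>"] y show "norm (expint g y - expint g \<zeta> - ?L (y - \<zeta>)) \<le> e * norm (y - \<zeta>)"
        by (simp add: power2_eq_square mult.assoc)
    qed
  qed
qed

lemma expint_DERIV_Re:
  assumes "bdd_meas g"
  shows "((\<lambda>x. Re (expint g (Complex x y))) has_real_derivative - Re (expint (\<lambda>w. of_real (\<alpha> w) * g w) (Complex x y))) (at x)"
proof -
  note expint_has_derivative[OF assms, of "Complex x y"]
  moreover have "((\<lambda>x. Complex x y) has_derivative (\<lambda>h. of_real h)) (at x)"
    unfolding Complex_eq by (auto intro!: derivative_eq_intros)
  ultimately have "((\<lambda>x. expint g (Complex x y)) has_derivative (\<lambda>h. - of_real h * expint (\<lambda>w. of_real (\<alpha> w) * g w) (Complex x y))) (at x)"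
    using has_derivative_compose[of "\<lambda>x. Complex x y" _ x UNIV "expint g"] by fastforce
  then have "((\<lambda>x. Re (expint g (Complex x y))) has_derivative (\<lambda>h. Re (- of_real h * expint (\<lambda>w. of_real (\<alpha> w) * g w) (Complex x y)))) (at x)"
    by (rule bounded_linear.has_derivative[OF bounded_linear_Re])
  then show ?thesis unfolding has_field_derivative_def
    by (rule has_derivative_eq_rhs) (auto simp: fun_eq_iff)
qed

lemma expint_add: "bdd_meas g \<Longrightarrow> bdd_meas h \<Longrightarrow> expint (\<lambda>w. g w + h w) \<zeta> = expint g \<zeta> + expint h \<zeta>"
  unfolding expint_def by (simp add: distrib_right expint_integrable)

lemma expint_cmult: "expint (\<lambda>w. c * g w) \<zeta> = c * expint g \<zeta>"
  unfolding expint_def by (simp add: mult.assoc)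

lemma expint_cong:
  "(\<And>w. w \<in> space N \<Longrightarrow> g w = h w) \<Longrightarrow> expint g \<zeta> = expint h \<zeta>"
  unfolding expint_def by (intro Bochner_Integration.integral_cong) auto

end

subsection \<open>The Laplace transform along a monotone arc\<close>

text \<open>With \<open>f\<close> bounded and supported in \<open>{m..M}\<close>, away from 0, even
  the kernels with negative powers of \<open>t + t'\<close> are bounded. Fubini and differentiation
  under the integral then need no further care.\<close>

locale laplace_L2 =
  fixes m M c :: real and f :: "real \<Rightarrow> complex"
  assumes mM: "0 < m" "m \<le> M"
    and f_meas[measurable]: "f \<in> borel_measurable (lebesgue_on {m..M})"
    and f_bdd: "\<And>t. t \<in> {m..M} \<Longrightarrow> norm (f t) \<le> c"
begin

abbreviation "\<mu> \<equiv> lebesgue_on {m..M}"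
abbreviation "\<mu>2 \<equiv> \<mu> \<Otimes>\<^sub>M \<mu>"
abbreviation \<alpha> :: "real \<times> real \<Rightarrow> real" where "\<alpha> w \<equiv> fst w + snd w"
abbreviation \<beta> :: "real \<times> real \<Rightarrow> real" where "\<beta> w \<equiv> fst w - snd w"

sublocale \<mu>: finite_measure \<mu>
  by (rule finite_measure_lebesgue_on) auto

sublocale pair_sigma_finite \<mu> \<mu> ..

lemma id_meas[measurable]: "(\<lambda>t. t) \<in> borel_measurable \<mu>"
  by (rule measurable_restrict_space1) (rule measurable_completion, simp)

lemma finite_\<mu>2: "finite_measure \<mu>2"
  by (rule finite_measure_pair_measure) unfold_locales

lemma fst_meas[measurable]: "fst \<in> borel_measurable \<mu>2" and snd_meas[measurable]: "snd \<in> borel_measurable \<mu>2"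
  using measurable_compose[OF measurable_fst id_meas] measurable_compose[OF measurable_snd id_meas] by auto

lemma space_\<mu>2: "w \<in> space \<mu>2 \<longleftrightarrow> fst w \<in> {m..M} \<and> snd w \<in> {m..M}"
  by (cases w) (simp add: space_pair_measure)

sublocale K: exp_kernel \<mu>2 \<alpha> \<beta> "2 * M"
proof -
  interpret finite_measure \<mu>2 by (rule finite_\<mu>2)
  show "exp_kernel \<mu>2 \<alpha> \<beta> (2 * M)"
    by unfold_locales (use mM in \<open>auto simp: space_\<mu>2\<close>)
qed

section \<open>Double integrals of f and their majorants\<close>

definition absq :: "real \<times> real \<Rightarrow> real" where
  "absq w = norm (f (fst w)) * norm (f (snd w))"

definition energy :: real where
  "energy = (LINT t|\<mu>. (norm (f t))\<^sup>2)"

definition F :: "complex \<Rightarrow> complex" where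
  "F \<zeta> = (LINT t|\<mu>. f t * exp (- \<zeta> * of_real t))"

text \<open>The dictionary of the proof: multiplying \<open>k\<close> by \<open>\<alpha>\<close>
  means \<open>- d/dx\<close>, multiplying it by \<open>\<beta>\<close> means
  \<open>\<i> d/dy\<close>, and dividing it by \<open>\<alpha>\<close> means integrating from
  \<open>x\<close> to infinity.\<close>

definition form :: "(real \<times> real \<Rightarrow> real) \<Rightarrow> complex \<Rightarrow> complex" where
  "form k = K.expint (\<lambda>w. of_real (k w) * (f (fst w) * cnj (f (snd w))))"

definition bdd_kernel :: "(real \<times> real \<Rightarrow> real) \<Rightarrow> bool" where
  "bdd_kernel k \<longleftrightarrow> k \<in> borel_measurable \<mu>2 \<and> (\<exists>b. \<forall>w\<in>space \<mu>2. \<bar>k w\<bar> \<le> b)"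

lemma f_comp_meas[measurable]: "(\<lambda>w. f (fst w)) \<in> borel_measurable \<mu>2" "(\<lambda>w. f (snd w)) \<in> borel_measurable \<mu>2"
  using measurable_compose[OF measurable_fst f_meas] measurable_compose[OF measurable_snd f_meas] by auto

lemma bdd_meas_f: "K.bdd_meas (\<lambda>w. f (fst w))" "K.bdd_meas (\<lambda>w. cnj (f (snd w)))"
  unfolding K.bdd_meas_def using f_bdd by (auto simp: space_\<mu>2 intro!: exI[of _ c] borel_measurable_cnj)

lemma bdd_meas_real: "bdd_kernel k \<Longrightarrow> K.bdd_meas (\<lambda>w. of_real (k w))"
  unfolding K.bdd_meas_def bdd_kernel_def by auto

lemma bdd_meas_form: "bdd_kernel k \<Longrightarrow> K.bdd_meas (\<lambda>w. of_real (k w) * (f (fst w) * cnj (f (snd w))))"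
  by (intro K.bdd_meas_mult bdd_meas_f bdd_meas_real)

lemma bdd_meas_absq: "bdd_kernel k \<Longrightarrow> K.bdd_meas (\<lambda>w. of_real (k w * absq w))"
proof (rule bdd_meas_real)
  assume "bdd_kernel k"
  then obtain b where b: "\<forall>w\<in>space \<mu>2. \<bar>k w\<bar> \<le> b" and [measurable]: "k \<in> borel_measurable \<mu>2"
    by (auto simp: bdd_kernel_def)
  have "\<bar>k w * absq w\<bar> \<le> b * (c * c)" if "w \<in> space \<mu>2" for w
  proof -
    have "\<bar>absq w\<bar> \<le> c * c" using that f_bdd[of "fst w"] f_bdd[of "snd w"]
      by (auto simp: absq_def space_\<mu>2 abs_mult intro!: mult_mono intro: order.trans[OF norm_ge_zero])
    then show ?thesis using b that
      by (auto simp: abs_mult intro!: mult_mono intro: order.trans[OF abs_ge_zero])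
  qed
  moreover have "absq \<in> borel_measurable \<mu>2" unfolding absq_def by measurable
  ultimately show "bdd_kernel (\<lambda>w. k w * absq w)" unfolding bdd_kernel_def by (auto simp del: split_paired_All intro!: exI[of _ "b * (c * c)"])
qed

lemma bdd_kernel_absq_integrable: "bdd_kernel k \<Longrightarrow> integrable \<mu>2 (\<lambda>w. k w * absq w)"
  using integrable_Re[OF K.bdd_meas_integrable[OF bdd_meas_absq]] by (simp only: Re_complex_of_real)

lemma form_has_derivative:
  assumes "bdd_kernel k" "\<And>w. w \<in> space \<mu>2 \<Longrightarrow> k1 w = \<alpha> w * k w" "\<And>w. w \<in> space \<mu>2 \<Longrightarrow> k2 w = \<beta> w * k w"
  shows "(form k has_derivative (\<lambda>h. - of_real (Re h) * form k1 \<zeta> - \<i> * of_real (Im h) * form k2 \<zeta>)) (at \<zeta>)"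
proof -
  have "form k1 \<zeta> = K.expint (\<lambda>w. of_real (\<alpha> w) * (of_real (k w) * (f (fst w) * cnj (f (snd w))))) \<zeta>"
    unfolding form_def using assms(2) by (intro K.expint_cong) (simp add: mult.assoc flip: of_real_add)
  moreover have "form k2 \<zeta> = K.expint (\<lambda>w. of_real (\<beta> w) * (of_real (k w) * (f (fst w) * cnj (f (snd w))))) \<zeta>"
    unfolding form_def using assms(3) by (intro K.expint_cong) (simp add: mult.assoc flip: of_real_diff)
  ultimately show ?thesis
    using K.expint_has_derivative[OF bdd_meas_form[OF assms(1)], of \<zeta>] by (simp add: form_def)
qed

text \<open>The same double integral with \<open>f\<close> replaced by its modulus, at the real
  point \<open>x\<close>. It dominates forms because the modulus of \<open>expk\<close> depends on
  the real part only.\<close>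

definition majorant :: "(real \<times> real \<Rightarrow> real) \<Rightarrow> real \<Rightarrow> real" where
  "majorant l x = (LINT w|\<mu>2. l w * absq w * exp (- (x * \<alpha> w)))"

lemma majorant_integrand:
  "of_real (l w * absq w * exp (- (x * \<alpha> w))) = of_real (l w * absq w) * K.expk (Complex x 0) w"
  by (simp add: K.expk_def exp_of_real[symmetric])

lemma majorant_kint: "of_real (majorant l x) = K.expint (\<lambda>w. of_real (l w * absq w)) (Complex x 0)"
  unfolding majorant_def K.expint_def majorant_integrand[symmetric] by (rule integral_complex_of_real[symmetric])

lemma majorant_integrable:
  assumes "bdd_kernel l" shows "integrable \<mu>2 (\<lambda>w. l w * absq w * exp (- (x * \<alpha> w)))"
  using integrable_Re[OF K.expint_integrable[OF bdd_meas_absq[OF assms], of "Complex x 0"]]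
  unfolding majorant_integrand[symmetric] by (simp only: Re_complex_of_real)

lemma norm_form_le:
  assumes "bdd_kernel k" "bdd_kernel l" "\<And>w. w \<in> space \<mu>2 \<Longrightarrow> \<bar>k w\<bar> \<le> l w"
  shows "norm (form k \<zeta>) \<le> majorant l (Re \<zeta>)"
proof -
  have "norm (form k \<zeta>) \<le> (LINT w|\<mu>2. norm (of_real (k w) * (f (fst w) * cnj (f (snd w)))) * exp (- (Re \<zeta> * \<alpha> w)))"
    unfolding form_def by (intro K.norm_expint_le bdd_meas_form assms)
  also have "\<dots> \<le> majorant l (Re \<zeta>)"
    unfolding majorant_def
  proof (rule integral_mono_AE'[OF majorant_integrable[OF assms(2)]]; intro AE_I2)
    fix w assume w: "w \<in> space \<mu>2"
    show "norm (of_real (k w) * (f (fst w) * cnj (f (snd w)))) * exp (- (Re \<zeta> * \<alpha> w)) \<le> l w * absq w * exp (- (Re \<zeta> * \<alpha> w))"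
      using assms(3)[OF w] by (auto simp: norm_mult absq_def intro!: mult_right_mono)
    show "0 \<le> l w * absq w * exp (- (Re \<zeta> * \<alpha> w))"
      using assms(3)[OF w] by (auto simp: absq_def intro!: mult_nonneg_nonneg)
  qed
  finally show ?thesis .
qed

text \<open>The decay comes from \<open>\<alpha> \<ge> 2 * m\<close> on the support. It makes all
  forms vanish as \<open>x\<close> tends to infinity, and at the same time reduces bounds for
  \<open>x \<ge> 0\<close> to bounds at \<open>x = 0\<close>.\<close>

lemma majorant_le:
  assumes l: "bdd_kernel l" "\<And>w. w \<in> space \<mu>2 \<Longrightarrow> 0 \<le> l w" and "0 \<le> x"
  shows "\<bar>majorant l x\<bar> \<le> exp (- (2 * m * x)) * (LINT w|\<mu>2. l w * absq w)"
proof -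
  have nn: "0 \<le> l w * absq w" if "w \<in> space \<mu>2" for w using l(2)[OF that] by (simp add: absq_def)
  have "\<bar>majorant l x\<bar> = majorant l x"
    unfolding majorant_def using nn by (intro abs_of_nonneg integral_nonneg_AE AE_I2) simp
  also have "\<dots> \<le> (LINT w|\<mu>2. exp (- (2 * m * x)) * (l w * absq w))"
    unfolding majorant_def
  proof (rule integral_mono_AE'; (intro AE_I2)?)
    show "integrable \<mu>2 (\<lambda>w. exp (- (2 * m * x)) * (l w * absq w))"
      by (intro integrable_mult_right bdd_kernel_absq_integrable l)
    fix w assume w: "w \<in> space \<mu>2"
    have "x * (2 * m) \<le> x * \<alpha> w" using w assms(3) by (intro mult_left_mono) (auto simp: space_\<mu>2)
    then have "exp (- (x * \<alpha> w)) \<le> exp (- (2 * m * x))" by (simp add: algebra_simps)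
    then show "l w * absq w * exp (- (x * \<alpha> w)) \<le> exp (- (2 * m * x)) * (l w * absq w)"
      using nn[OF w] by (metis mult.commute mult_left_mono)
    show "0 \<le> exp (- (2 * m * x)) * (l w * absq w)" using nn[OF w] by simp
  qed
  finally show ?thesis by simp
qed

text \<open>The exponent splits as \<open>- \<zeta> * t - cnj \<zeta> * t'\<close>, so a product
  kernel gives the product of an integral and its conjugate. With \<open>r = f\<close> this is the
  squared modulus of \<open>F\<close>, with \<open>r t = t * f t\<close> that of its
  derivative.\<close>

lemma expint_rank_one:
  assumes [measurable]: "r \<in> borel_measurable \<mu>" and r: "\<And>t. t \<in> {m..M} \<Longrightarrow> norm (r t) \<le> b"
  shows "K.expint (\<lambda>w. r (fst w) * cnj (r (snd w))) \<zeta>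
     = of_real ((norm (LINT t|\<mu>. r t * exp (- \<zeta> * of_real t)))\<^sup>2)"
proof -
  define G where "G t = r t * exp (- \<zeta> * of_real t)" for t
  have r2[measurable]: "(\<lambda>w. r (fst w)) \<in> borel_measurable \<mu>2" "(\<lambda>w. r (snd w)) \<in> borel_measurable \<mu>2"
    using measurable_compose[OF measurable_fst assms(1)] measurable_compose[OF measurable_snd assms(1)] by auto
  have "K.bdd_meas (\<lambda>w. r (fst w))" "K.bdd_meas (\<lambda>w. cnj (r (snd w)))"
    unfolding K.bdd_meas_def using r by (auto simp: space_\<mu>2 intro!: exI[of _ b] borel_measurable_cnj)
  then have bd: "K.bdd_meas (\<lambda>w. r (fst w) * cnj (r (snd w)))" by (rule K.bdd_meas_mult)
  have eq: "r (fst w) * cnj (r (snd w)) * K.expk \<zeta> w = G (fst w) * cnj (G (snd w))" for w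
  proof -
    have e: "- of_real (Re \<zeta> * \<alpha> w) - \<i> * of_real (Im \<zeta> * \<beta> w) = - \<zeta> * of_real (fst w) + cnj (- \<zeta> * of_real (snd w))"
      by (simp add: complex_eq_iff algebra_simps)
    show ?thesis unfolding K.expk_def e exp_add G_def by (simp add: exp_cnj algebra_simps)
  qed
  have int: "integrable \<mu>2 (\<lambda>w. G (fst w) * cnj (G (snd w)))"
    using K.expint_integrable[OF bd, of \<zeta>] by (simp add: eq)
  have "K.expint (\<lambda>w. r (fst w) * cnj (r (snd w))) \<zeta> = (LINT w|\<mu>2. G (fst w) * cnj (G (snd w)))"
    unfolding K.expint_def eq ..
  also have "\<dots> = (LINT t|\<mu>. LINT s|\<mu>. G t * cnj (G s))"
    using integral_fst'[OF int] by simp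
  also have "\<dots> = (LINT t|\<mu>. G t) * cnj (LINT s|\<mu>. G s)"
    by (simp add: integral_cnj)
  also have "\<dots> = of_real ((norm (LINT t|\<mu>. G t))\<^sup>2)"
    by (metis complex_norm_square)
  finally show ?thesis by (simp add: G_def)
qed

lemma f_sq_integrable: "integrable \<mu> (\<lambda>t. (norm (f t))\<^sup>2)"
  using f_bdd by (intro \<mu>.integrable_const_bound[of _ "c\<^sup>2"]) (auto intro!: AE_I2 power_mono)

lemma energy_eq: "(\<integral>\<^sup>+t. ennreal ((norm (f t))\<^sup>2) \<partial>\<mu>) = ennreal energy"
  unfolding energy_def using f_sq_integrable by (intro nn_integral_eq_integral) auto

lemma energy_nonneg: "0 \<le> energy"
  unfolding energy_def by (intro integral_nonneg_AE) auto

section \<open>Schur bounds for the Hilbert and Gaussian kernels\<close>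

lemma schur_integral:
  assumes "bdd_kernel k" and k0: "\<And>w. 0 \<le> k w" and sym: "\<And>x y. k (x, y) = k (y, x)"
    and "h \<in> borel_measurable \<mu>" "\<And>x. x \<in> {m..M} \<Longrightarrow> 0 < h x" "0 \<le> C"
    and "\<And>x. x \<in> {m..M} \<Longrightarrow> (\<integral>\<^sup>+y. ennreal (k (x, y)) * ennreal (h y) \<partial>\<mu>) \<le> ennreal (C * h x)"
  shows "(LINT w|\<mu>2. k w * absq w) \<le> C * energy"
proof -
  have [measurable]: "k \<in> borel_measurable \<mu>2" using assms(1) by (simp add: bdd_kernel_def)
  have "ennreal (LINT w|\<mu>2. k w * absq w) = (\<integral>\<^sup>+w. ennreal (k w * absq w) \<partial>\<mu>2)"
    using k0 by (intro nn_integral_eq_integral[symmetric] bdd_kernel_absq_integrable assms) (auto simp: absq_def)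
  also have "\<dots> = (\<integral>\<^sup>+w. ennreal (k w) * ennreal (norm (f (fst w)) * norm (f (snd w))) \<partial>\<mu>2)"
    using k0 by (simp add: absq_def ennreal_mult'[symmetric])
  also have "\<dots> \<le> ennreal C * (\<integral>\<^sup>+x. ennreal ((norm (f x))\<^sup>2) \<partial>\<mu>)"
    using assms by (intro schur_test[where h = h]) (auto intro: \<mu>.sigma_finite_measure_axioms)
  also have "\<dots> = ennreal (C * energy)"
    using assms energy_nonneg by (simp add: energy_eq ennreal_mult)
  finally show ?thesis using assms energy_nonneg by simp
qed

lemma bdd_kernel_hilbert: "bdd_kernel (\<lambda>w. 1 / \<alpha> w)"
  unfolding bdd_kernel_def using mM
  by (auto intro!: exI[of _ "1 / (2 * m)"] simp: space_\<mu>2 field_simps)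

lemma hilbert: "(LINT w|\<mu>2. 1 / \<alpha> w * absq w) \<le> pi * energy"
proof -
  \<comment> \<open>The absolute value changes nothing on the space of \<open>\<mu>2\<close>, but
    \<open>schur_integral\<close> asks for a kernel that is nonnegative everywhere.\<close>
  have "(LINT w|\<mu>2. \<bar>1 / \<alpha> w\<bar> * absq w) \<le> pi * energy"
  proof (rule schur_integral[where h = "\<lambda>t. 1 / sqrt t"])
    show "bdd_kernel (\<lambda>w. \<bar>1 / \<alpha> w\<bar>)" using bdd_kernel_hilbert by (auto simp: bdd_kernel_def)
    fix x assume x: "x \<in> {m..M}"
    then show "0 < 1 / sqrt x" using mM by auto
    have "(\<integral>\<^sup>+y. ennreal \<bar>1 / \<alpha> (x, y)\<bar> * ennreal (1 / sqrt y) \<partial>\<mu>) = (\<integral>\<^sup>+y. ennreal (1 / (x + y)) * ennreal (1 / sqrt y) \<partial>\<mu>)"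
      using x mM by (intro nn_integral_cong) auto
    also have "\<dots> \<le> ennreal (pi * (1 / sqrt x))"
      using x mM by (intro hilbert_kernel_test) auto
    finally show "(\<integral>\<^sup>+y. ennreal \<bar>1 / \<alpha> (x, y)\<bar> * ennreal (1 / sqrt y) \<partial>\<mu>) \<le> ennreal (pi * (1 / sqrt x))" .
  qed (auto simp: add.commute)
  also have "(LINT w|\<mu>2. \<bar>1 / \<alpha> w\<bar> * absq w) = (LINT w|\<mu>2. 1 / \<alpha> w * absq w)"
    using mM by (intro Bochner_Integration.integral_cong) (auto simp: space_\<mu>2)
  finally show ?thesis .
qed

lemma gaussian:
  assumes "0 < Y"
  shows "(LINT w|\<mu>2. exp (- (Y * \<beta> w)\<^sup>2 / 2) * absq w) \<le> sqrt (2 * pi) / Y * energy"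
proof (rule schur_integral[where h = "\<lambda>t. 1"])
  show "bdd_kernel (\<lambda>w. exp (- (Y * \<beta> w)\<^sup>2 / 2))" unfolding bdd_kernel_def by (auto intro!: exI[of _ 1])
  fix x y show "exp (- (Y * \<beta> (x, y))\<^sup>2 / 2) = exp (- (Y * \<beta> (y, x))\<^sup>2 / 2)"
    by (simp add: power_mult_distrib power2_commute)
next
  fix x
  show "(\<integral>\<^sup>+y. ennreal (exp (- (Y * \<beta> (x, y))\<^sup>2 / 2)) * ennreal 1 \<partial>\<mu>) \<le> ennreal (sqrt (2 * pi) / Y * 1)"
    using gaussian_kernel_test[OF assms, where t = x and m = m and M = M] by simp
qed (use assms in auto)

lemma bdd_kernelI: "k \<in> borel_measurable \<mu>2 \<Longrightarrow> (\<And>w. w \<in> space \<mu>2 \<Longrightarrow> \<bar>k w\<bar> \<le> b) \<Longrightarrow> bdd_kernel k"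
  by (metis bdd_kernel_def)

lemma bdd_kernel_mult: assumes "bdd_kernel k" "bdd_kernel l" shows "bdd_kernel (\<lambda>w. k w * l w)"
proof -
  obtain b d where "\<forall>w\<in>space \<mu>2. \<bar>k w\<bar> \<le> b" "\<forall>w\<in>space \<mu>2. \<bar>l w\<bar> \<le> d" using assms by (auto simp: bdd_kernel_def)
  then have "\<bar>k w * l w\<bar> \<le> b * d" if "w \<in> space \<mu>2" for w
    using that by (auto simp: abs_mult intro!: mult_mono intro: order.trans[OF abs_ge_zero])
  then show ?thesis using assms by (intro bdd_kernelI) (auto simp: bdd_kernel_def)
qed

lemma bdd_kernel_basic: "bdd_kernel (\<lambda>w. 1)" "bdd_kernel (\<lambda>w. fst w)" "bdd_kernel (\<lambda>w. snd w)" "bdd_kernel \<beta>" "bdd_kernel (\<lambda>w. inverse (\<alpha> w))"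
  using mM bdd_kernel_hilbert
  by (auto simp: space_\<mu>2 inverse_eq_divide intro: bdd_kernelI[where b = 1]) (auto simp: space_\<mu>2 intro!: bdd_kernelI[where b = M])

lemma \<alpha>_pos: "w \<in> space \<mu>2 \<Longrightarrow> 0 < \<alpha> w" and \<beta>_le_\<alpha>: "w \<in> space \<mu>2 \<Longrightarrow> \<bar>\<beta> w\<bar> \<le> \<alpha> w"
  using mM by (auto simp: space_\<mu>2)

text \<open>With the notation of the introduction, \<open>W = Im (form kW)\<close>, \<open>W\<^sub>x = - Im (form kWx)\<close>,
  \<open>W\<^sub>y = - Re (form kWy)\<close>, \<open>P = Re (form kP)\<close>, and \<open>kP1\<close>, \<open>kP2\<close> give \<open>- P\<^sub>x\<close>, \<open>P\<^sub>x\<^sub>x\<close>.\<close>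

definition "kW w = \<beta> w * inverse (\<alpha> w) * inverse (\<alpha> w)"
definition "kWx w = \<beta> w * inverse (\<alpha> w)"
definition "kWy w = kWx w * kWx w"
definition "kP w = fst w * snd w * inverse (\<alpha> w) * inverse (\<alpha> w)"
definition "kP1 w = fst w * snd w * inverse (\<alpha> w)"
definition "kP2 w = fst w * snd w"

lemma bdd_kernel_kernels: "bdd_kernel kW" "bdd_kernel kWx" "bdd_kernel kWy" "bdd_kernel kP" "bdd_kernel kP1" "bdd_kernel kP2"
  unfolding kW_def kWx_def kWy_def kP_def kP1_def kP2_def by (intro bdd_kernel_mult bdd_kernel_basic)+

lemma form_add: "bdd_kernel k \<Longrightarrow> bdd_kernel l \<Longrightarrow> form (\<lambda>w. k w + l w) \<zeta> = form k \<zeta> + form l \<zeta>"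
  unfolding form_def by (simp add: distrib_right K.expint_add bdd_meas_form)

lemma form_cong: "(\<And>w. w \<in> space \<mu>2 \<Longrightarrow> k w = l w) \<Longrightarrow> form k \<zeta> = form l \<zeta>"
  unfolding form_def by (intro K.expint_cong) simp

text \<open>Divide \<open>4 t t' + (t - t')\<^sup>2 = (t + t')\<^sup>2\<close> by its right-hand
  side: on the level of kernels this is the Laplacian identity for \<open>u\<close> after two
  integrations in \<open>x\<close>.\<close>

lemma form_decomp: "form (\<lambda>w. 1) \<zeta> = 4 * form kP \<zeta> + form kWy \<zeta>"
proof -
  have "form (\<lambda>w. 1) \<zeta> = form (\<lambda>w. 4 * kP w + kWy w) \<zeta>"
  proof (rule form_cong)
    fix w assume "w \<in> space \<mu>2"
    then have "\<alpha> w * inverse (\<alpha> w) = 1" using \<alpha>_pos[of w] by (intro right_inverse) simp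
    moreover have "4 * kP w + kWy w = (\<alpha> w * inverse (\<alpha> w))\<^sup>2"
      by (simp add: kP_def kWy_def kWx_def power2_eq_square algebra_simps)
    ultimately show "1 = 4 * kP w + kWy w" by simp
  qed
  also have "\<dots> = 4 * form kP \<zeta> + form kWy \<zeta>"
  proof -
    have "bdd_kernel (\<lambda>w. 4)" by (rule bdd_kernelI[where b = 4]) auto
    then show ?thesis
      by (subst form_add) (auto intro!: bdd_kernel_kernels bdd_kernel_mult simp: form_def K.expint_cmult mult.assoc)
  qed
  finally show ?thesis .
qed

lemma form_1: "form (\<lambda>w. 1) \<zeta> = of_real ((norm (F \<zeta>))\<^sup>2)"
  unfolding form_def F_def using expint_rank_one[OF f_meas f_bdd] by simp

text \<open>The kernel \<open>t * t'\<close> has rank one, and its form is the squared modulus of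
  the derivative of \<open>F\<close>.\<close>

lemma Re_form_kP2: "0 \<le> Re (form kP2 \<zeta>)"
proof -
  have "form kP2 \<zeta> = K.expint (\<lambda>w. of_real (fst w) * f (fst w) * cnj (of_real (snd w) * f (snd w))) \<zeta>"
    unfolding form_def kP2_def by (intro K.expint_cong) (simp add: mult_ac)
  also have "\<dots> = of_real ((norm (LINT t|\<mu>. of_real t * f t * exp (- \<zeta> * of_real t)))\<^sup>2)"
  proof (rule expint_rank_one)
    show "(\<lambda>t. of_real t * f t) \<in> borel_measurable \<mu>" by measurable
    fix t assume "t \<in> {m..M}"
    then show "norm (of_real t * f t) \<le> M * c" using mM f_bdd[of t]
      by (auto simp: norm_mult intro!: mult_mono)
  qed
  finally show ?thesis by simp
qed

lemma form_tendsto_0: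
  assumes "bdd_kernel k" shows "((\<lambda>x. Re (form k (Complex x y))) \<longlongrightarrow> 0) at_top"
proof -
  have abs: "bdd_kernel (\<lambda>w. \<bar>k w\<bar>)" using assms by (auto simp: bdd_kernel_def)
  define C where "C = (LINT w|\<mu>2. \<bar>k w\<bar> * absq w)"
  have "\<bar>Re (form k (Complex x y))\<bar> \<le> exp (- (2 * m * x)) * C" if "0 \<le> x" for x
  proof -
    have "\<bar>Re (form k (Complex x y))\<bar> \<le> norm (form k (Complex x y))" by (rule abs_Re_le_cmod)
    also have "\<dots> \<le> majorant (\<lambda>w. \<bar>k w\<bar>) (Re (Complex x y))"
      by (intro norm_form_le assms abs) simp
    also have "\<dots> \<le> exp (- (2 * m * x)) * C"
      using majorant_le[OF abs _ that] unfolding C_def by simp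
    finally show ?thesis .
  qed
  then have *: "eventually (\<lambda>x. norm (Re (form k (Complex x y))) \<le> exp (- (2 * m * x)) * C) at_top"
    by (intro eventually_mono[OF eventually_ge_at_top[of 0]]) simp
  have "filterlim (\<lambda>x. - (2 * m * x)) at_bot at_top"
    using mM by (intro filterlim_uminus_at_bot[THEN iffD2]) (simp add: filterlim_tendsto_pos_mult_at_top[OF tendsto_const _ filterlim_ident])
  then have "((\<lambda>x. exp (- (2 * m * x)) * C) \<longlongrightarrow> 0 * C) at_top"
    by (intro tendsto_mult filterlim_compose[OF exp_at_bot] tendsto_const)
  then show ?thesis using Lim_null_comparison[OF *] by simp
qed

lemma form_DERIV_Re:
  assumes "bdd_kernel k" "\<And>w. w \<in> space \<mu>2 \<Longrightarrow> k1 w = \<alpha> w * k w"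
  shows "((\<lambda>x. Re (form k (Complex x y))) has_real_derivative - Re (form k1 (Complex x y))) (at x)"
proof -
  have "form k1 (Complex x y) = K.expint (\<lambda>w. of_real (\<alpha> w) * (of_real (k w) * (f (fst w) * cnj (f (snd w))))) (Complex x y)"
    unfolding form_def using assms(2) by (intro K.expint_cong) (simp add: mult.assoc flip: of_real_add)
  then show ?thesis using K.expint_DERIV_Re[OF bdd_meas_form[OF assms(1)], of y x] by (simp add: form_def)
qed

text \<open>Descend from infinity twice: \<open>P\<^sub>x\<^sub>x\<close> is nonnegative, and
  \<open>P\<^sub>x\<close> vanishes at infinity, so \<open>P\<^sub>x \<le> 0\<close>; since
  \<open>P\<close> vanishes there too, it is nonnegative and decreasing.\<close>

lemma
  shows Re_form_kP: "0 \<le> Re (form kP (Complex x y))"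
    and Re_form_kP_mono: "x \<le> x' \<Longrightarrow> Re (form kP (Complex x' y)) \<le> Re (form kP (Complex x y))"
proof -
  have 1: "kP1 w = \<alpha> w * kP w" "kP2 w = \<alpha> w * kP1 w" if "w \<in> space \<mu>2" for w
    using \<alpha>_pos[OF that] by (auto simp: kP_def kP1_def kP2_def)
  have "0 \<le> Re (form kP1 (Complex x y))" for x
    by (rule antimono_limit_0[OF form_DERIV_Re[OF bdd_kernel_kernels(5) 1(2)] _ form_tendsto_0[OF bdd_kernel_kernels(5)]])
      (use Re_form_kP2 in auto)
  then have 2: "- Re (form kP1 (Complex x y)) \<le> 0" for x by simp
  note * = antimono_limit_0[OF form_DERIV_Re[OF bdd_kernel_kernels(4) 1(1)] 2 form_tendsto_0[OF bdd_kernel_kernels(4)]]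
  show "0 \<le> Re (form kP (Complex x y))" by (rule *(1))
  show "x \<le> x' \<Longrightarrow> Re (form kP (Complex x' y)) \<le> Re (form kP (Complex x y))" by (rule *(2))
qed

section \<open>The integral of Q over y\<close>

definition Q :: "real \<Rightarrow> real" where "Q y = Re (form kP (Complex 0 y))"

lemma Q_nonneg: "0 \<le> Q y" unfolding Q_def by (rule Re_form_kP)

lemma form_continuous: "bdd_kernel k \<Longrightarrow> continuous_on UNIV (form k)"
  using form_has_derivative[OF _ refl refl] has_derivative_continuous
  by (blast intro: continuous_at_imp_continuous_on)

lemma Q_continuous: "continuous_on UNIV Q"
proof -
  have Q: "Q = (\<lambda>y. Re (form kP (\<i> * of_real y)))" by (simp add: Q_def fun_eq_iff Complex_eq)
  show ?thesis unfolding Q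
    by (intro continuous_intros continuous_on_compose2[OF form_continuous[OF bdd_kernel_kernels(4)]]) auto
qed

text \<open>A smoothed Plancherel theorem. Averaging over a Gaussian of width \<open>Y\<close>
  replaces the oscillating factor by the characteristic function
  \<open>exp (- (Y * \<beta> w)\<^sup>2 / 2)\<close>, a positive kernel to which Schur's test
  applies. The factor 4 in the denominator stems from \<open>kP \<le> 1 / 4\<close>.\<close>

lemma std_normal_integral_Q:
  assumes "0 < Y"
  shows "(LINT v|std_normal_distribution. Q (Y * v)) \<le> sqrt (2 * pi) / (4 * Y) * energy"
proof -
  define \<nu> where "\<nu> = std_normal_distribution"
  interpret \<nu>: prob_space \<nu> unfolding \<nu>_def by (rule prob_space_normal_density) simp
  interpret \<mu>2: finite_measure \<mu>2 by (rule finite_\<mu>2)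
  interpret P: pair_sigma_finite \<nu> \<mu>2 ..
  interpret P: finite_measure "\<nu> \<Otimes>\<^sub>M \<mu>2" by (rule finite_measure_pair_measure) unfold_locales
  define q where "q w = of_real (kP w) * (f (fst w) * cnj (f (snd w)))" for w
  have bq: "K.bdd_meas q" unfolding q_def by (intro bdd_meas_form bdd_kernel_kernels)
  then obtain d where d: "0 < d" "\<And>w. w \<in> space \<mu>2 \<Longrightarrow> norm (q w) \<le> d" by (metis K.bdd_measE)
  have [measurable]: "q \<in> borel_measurable \<mu>2" using K.bdd_measD[OF bq] .
  have [measurable]: "(\<lambda>v. v) \<in> borel_measurable \<nu>" unfolding \<nu>_def by simp
  define e where "e v w = exp (\<i> * of_real (v * (- (Y * \<beta> w))))" for v w
  have e: "K.expk (Complex 0 (Y * v)) w = e v w" for v w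
    by (simp add: K.expk_def e_def algebra_simps)
  have meas: "(\<lambda>(v, w). q w * e v w) \<in> borel_measurable (\<nu> \<Otimes>\<^sub>M \<mu>2)"
    unfolding e_def by measurable
  have int: "integrable (\<nu> \<Otimes>\<^sub>M \<mu>2) (\<lambda>(v, w). q w * e v w)"
    using meas d by (intro P.integrable_const_bound[of _ d])
      (auto intro!: AE_I2 simp: norm_mult e_def space_pair_measure)
  \<comment> \<open>This is AM-GM, \<open>4 t t' \<le> (t + t')\<^sup>2\<close>, read off from the
    identity behind \<open>form_decomp\<close>.\<close>
  have kP_le: "\<bar>kP w\<bar> \<le> 1 / 4" if "w \<in> space \<mu>2" for w
  proof -
    have "4 * kP w + kWy w = (\<alpha> w * inverse (\<alpha> w))\<^sup>2"
      by (simp add: kP_def kWy_def kWx_def power2_eq_square algebra_simps)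
    moreover have "\<alpha> w * inverse (\<alpha> w) = 1" using \<alpha>_pos[OF that] by (intro right_inverse) simp
    moreover have "0 \<le> kWy w" by (simp add: kWy_def)
    moreover have "0 \<le> kP w" using \<alpha>_pos[OF that] that mM by (auto simp: kP_def space_\<mu>2)
    ultimately show ?thesis by simp
  qed
  let ?G = "\<lambda>w. exp (- (Y * \<beta> w)\<^sup>2 / 2)"
  have char: "(LINT v|\<nu>. e v w) = of_real (?G w)" for w
    using fun_cong[OF char_std_normal_distribution, of "- (Y * \<beta> w)"]
    by (simp add: char_def e_def \<nu>_def mult.commute mult.left_commute)
  have "(LINT v|\<nu>. Q (Y * v)) = (LINT v|\<nu>. Re (LINT w|\<mu>2. q w * e v w))"
    by (simp add: Q_def form_def K.expint_def q_def e)
  also have "\<dots> = Re (LINT v|\<nu>. LINT w|\<mu>2. q w * e v w)"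
    using P.integrable_fst'[OF int] by (intro integral_Re) simp
  also have "(LINT v|\<nu>. LINT w|\<mu>2. q w * e v w) = (LINT w|\<mu>2. LINT v|\<nu>. q w * e v w)"
    using P.Fubini_integral[OF int] by simp
  also have "\<dots> = (LINT w|\<mu>2. q w * of_real (?G w))"
    by (simp add: char)
  also have "Re \<dots> \<le> norm \<dots>" by (rule complex_Re_le_cmod)
  also have "\<dots> \<le> (LINT w|\<mu>2. norm (q w * of_real (?G w)))"
    by (rule integral_norm_bound)
  also have "\<dots> \<le> (LINT w|\<mu>2. 1 / 4 * (?G w * absq w))"
  proof (rule integral_mono_AE')
    show "integrable \<mu>2 (\<lambda>w. 1 / 4 * (?G w * absq w))"
      by (intro integrable_mult_right bdd_kernel_absq_integrable bdd_kernelI[where b = 1]) auto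
    show "AE w in \<mu>2. norm (q w * of_real (?G w)) \<le> 1 / 4 * (?G w * absq w)"
    proof (rule AE_I2)
      fix w assume w: "w \<in> space \<mu>2"
      have "norm (q w * of_real (?G w)) = \<bar>kP w\<bar> * (?G w * absq w)"
        by (simp add: q_def absq_def norm_mult)
      also have "\<dots> \<le> 1 / 4 * (?G w * absq w)"
        using kP_le[OF w] by (intro mult_right_mono) (auto simp: absq_def)
      finally show "norm (q w * of_real (?G w)) \<le> 1 / 4 * (?G w * absq w)" .
    qed
  qed (auto simp: absq_def)
  also have "\<dots> \<le> 1 / 4 * (sqrt (2 * pi) / Y * energy)"
    using gaussian[OF assms] by simp
  finally show ?thesis by (simp add: \<nu>_def)
qed

text \<open>On \<open>{-Y..Y}\<close> the Gaussian of width \<open>Y\<close> is bounded below, so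
  the Gaussian average controls the plain integral, and \<open>Y\<close> cancels. Plancherel on the
  whole line would give \<open>pi / 2\<close>; the factor \<open>exp (1 / 2)\<close> is the price of
  the Gaussian.\<close>

lemma Q_primitive:
  assumes Y: "0 < Y" and B: "\<And>y. \<bar>y\<bar> \<le> Y \<Longrightarrow> (B has_vector_derivative Q y) (at y within {-Y..Y})"
    and y: "-Y \<le> y" "y \<le> y'" "y' \<le> Y"
  shows "0 \<le> B y' - B y" "B y' - B y \<le> pi / 2 * exp (1 / 2) * energy"
proof -
  have FTC: "(Q has_integral (B r' - B r)) {r..r'}" if "-Y \<le> r" "r \<le> r'" "r' \<le> Y" for r r'
    using that by (intro fundamental_theorem_of_calculus) (auto intro!: has_vector_derivative_within_subset[OF B])
  have mono: "0 \<le> B r' - B r" if "-Y \<le> r" "r \<le> r'" "r' \<le> Y" for r r'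
    using has_integral_nonneg[OF FTC[OF that]] Q_nonneg by simp
  show "0 \<le> B y' - B y" using mono y by simp
  have "B y' - B y \<le> B Y - B (- Y)" using mono[of "-Y" y] mono[of y' Y] y by simp
  also have "\<dots> \<le> pi / 2 * exp (1 / 2) * energy"
  proof -
    \<comment> \<open>The minimum of the standard normal density on \<open>{-1..1}\<close>.\<close>
    define D where "D = exp (- 1 / 2) / sqrt (2 * pi)"
    have "((\<lambda>v. Q (Y * v)) has_integral ((B Y - B (- Y)) / Y)) {-1..1}"
    proof -
      have "((\<lambda>v. Q (Y *\<^sub>R v + 0)) has_integral (1 / \<bar>Y\<bar> ^ DIM(real)) *\<^sub>R (B Y - B (- Y)))
          ((\<lambda>x. (1 / Y) *\<^sub>R x + - ((1 / Y) *\<^sub>R 0)) ` cbox (- Y) Y)"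
        using FTC[of "-Y" Y] Y by (intro has_integral_affinity) auto
      moreover have "(\<lambda>x. (1 / Y) *\<^sub>R x + - ((1 / Y) *\<^sub>R 0)) ` cbox (- Y) Y = {-1..1}"
        using Y image_affinity_atLeastAtMost[of "1 / Y" 0 "- Y" Y] by simp
      ultimately show ?thesis using Y by simp
    qed
    then have "(\<integral>\<^sup>+v. ennreal (indicator {-1..1} v * Q (Y * v)) \<partial>lborel) = ennreal ((B Y - B (- Y)) / Y)"
      using Q_nonneg by (intro nn_integral_has_integral_lebesgue)
    moreover have "(\<integral>\<^sup>+v. ennreal (Q (Y * v)) * indicator {-1..1} v \<partial>lborel) = (\<integral>\<^sup>+v. ennreal (indicator {-1..1} v * Q (Y * v)) \<partial>lborel)"
      by (intro nn_integral_cong) (auto simp: indicator_def)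
    ultimately have "(\<integral>\<^sup>+v. ennreal (Q (Y * v)) * indicator {-1..1} v \<partial>lborel) = ennreal ((B Y - B (- Y)) / Y)"
      by simp
    moreover have [measurable]: "(\<lambda>v. Q (Y * v)) \<in> borel_measurable borel"
      by (intro borel_measurable_continuous_onI continuous_intros continuous_on_compose2[OF Q_continuous]) auto
    moreover have "0 \<le> D" "0 \<le> (B Y - B (- Y)) / Y" using Y mono[of "-Y" Y] by (simp_all add: D_def)
    ultimately have "ennreal (D * ((B Y - B (- Y)) / Y)) = (\<integral>\<^sup>+v. ennreal D * (ennreal (Q (Y * v)) * indicator {-1..1} v) \<partial>lborel)"
      by (subst nn_integral_cmult) (auto simp: ennreal_mult simp del: times_divide_eq_right)
    also have "\<dots> \<le> (\<integral>\<^sup>+v. ennreal (std_normal_density v) * ennreal (Q (Y * v)) \<partial>lborel)"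
    proof (rule nn_integral_mono)
      fix v :: real
      have "D \<le> std_normal_density v" if "\<bar>v\<bar> \<le> 1"
      proof -
        have "v\<^sup>2 \<le> 1" using that by (simp add: abs_square_le_1)
        then show ?thesis by (simp add: D_def normal_density_def divide_right_mono)
      qed
      then show "ennreal D * (ennreal (Q (Y * v)) * indicator {-1..1} v) \<le> ennreal (std_normal_density v) * ennreal (Q (Y * v))"
        by (auto simp: indicator_def intro!: mult_right_mono ennreal_leI)
    qed
    also have "\<dots> = (\<integral>\<^sup>+v. ennreal (Q (Y * v)) \<partial>std_normal_distribution)"
      by (subst nn_integral_density) (auto intro!: borel_measurable_continuous_onI continuous_intros continuous_on_compose2[OF Q_continuous])
    also have "\<dots> = ennreal (LINT v|std_normal_distribution. Q (Y * v))"
    proof (rule nn_integral_eq_integral)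
      obtain d where d: "\<And>y. \<bar>Q y\<bar> \<le> d"
      proof -
        have abs: "bdd_kernel (\<lambda>w. \<bar>kP w\<bar>)" using bdd_kernel_kernels(4) by (auto simp: bdd_kernel_def)
        have "\<bar>Q y\<bar> \<le> majorant (\<lambda>w. \<bar>kP w\<bar>) (Re (Complex 0 y))" for y
          unfolding Q_def by (intro order.trans[OF abs_Re_le_cmod] norm_form_le bdd_kernel_kernels abs) simp
        then show thesis by (intro that) auto
      qed
      interpret \<nu>: prob_space std_normal_distribution by (rule prob_space_normal_density) simp
      show "integrable std_normal_distribution (\<lambda>v. Q (Y * v))"
        using d by (intro \<nu>.integrable_const_bound[of _ d])
          (auto intro!: borel_measurable_continuous_onI continuous_intros continuous_on_compose2[OF Q_continuous])
    qed (use Q_nonneg in auto)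
    finally have "D * ((B Y - B (- Y)) / Y) \<le> (LINT v|std_normal_distribution. Q (Y * v))"
      using Q_nonneg by (simp add: integral_nonneg_AE)
    also have "\<dots> \<le> sqrt (2 * pi) / (4 * Y) * energy" by (rule std_normal_integral_Q[OF Y])
    finally have "D * ((B Y - B (- Y)) / Y) * Y \<le> sqrt (2 * pi) / (4 * Y) * energy * Y"
      using Y by (intro mult_right_mono) auto
    then have "D * (B Y - B (- Y)) \<le> sqrt (2 * pi) / 4 * energy" using Y by simp
    moreover have "D = 1 / (exp (1 / 2) * sqrt (2 * pi))" by (simp add: D_def exp_minus field_simps)
    ultimately have "B Y - B (- Y) \<le> (sqrt (2 * pi) * sqrt (2 * pi)) * exp (1 / 2) / 4 * energy"
      by (simp add: field_simps del: real_sqrt_mult_self)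
    then show ?thesis by simp
  qed
  finally show "B y' - B y \<le> pi / 2 * exp (1 / 2) * energy" .
qed

section \<open>Bounds by G(x)^2 and its primitive\<close>

definition G2 :: "real \<Rightarrow> real" where
  "G2 = majorant (\<lambda>w. 1)"

text \<open>The primitive of \<open>G2\<close> that vanishes at infinity: integrating in
  \<open>x\<close> divides the kernel 1 by \<open>\<alpha>\<close>, which yields Hilbert's kernel.
  Hence the bound \<open>pi * energy\<close>.\<close>

definition A :: "real \<Rightarrow> real" where
  "A x = - majorant (\<lambda>w. inverse (\<alpha> w)) x"

lemma A_DERIV: "(A has_real_derivative G2 x) (at x)"
proof -
  let ?g = "\<lambda>w. of_real (inverse (\<alpha> w) * absq w) :: complex"
  have A: "A = (\<lambda>x. - Re (K.expint ?g (Complex x 0)))" unfolding A_def majorant_kint[symmetric] by simp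
  have "K.expint (\<lambda>w. of_real (\<alpha> w) * ?g w) (Complex x 0) = K.expint (\<lambda>w. of_real (1 * absq w)) (Complex x 0)"
  proof (rule K.expint_cong)
    fix w assume "w \<in> space \<mu>2"
    then have "\<alpha> w * inverse (\<alpha> w) = 1" using \<alpha>_pos[of w] by (intro right_inverse) simp
    then show "of_real (\<alpha> w) * ?g w = of_real (1 * absq w)"
      unfolding of_real_mult[symmetric] mult.assoc[symmetric] by simp
  qed
  then have G2: "G2 x = - (- Re (K.expint (\<lambda>w. of_real (\<alpha> w) * ?g w) (Complex x 0)))"
    by (simp only: G2_def minus_minus majorant_kint[symmetric] Re_complex_of_real)
  show ?thesis unfolding A G2 by (intro DERIV_minus K.expint_DERIV_Re bdd_meas_absq bdd_kernel_basic)
qed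

lemma exp_decay_le: "0 \<le> x \<Longrightarrow> 0 \<le> E \<Longrightarrow> exp (- (2 * m * x)) * E \<le> E"
  using mM by (intro mult_left_le_one_le) auto

lemma A_bound: assumes "0 \<le> x" shows "\<bar>A x\<bar> \<le> pi * energy"
proof -
  have "\<bar>A x\<bar> \<le> exp (- (2 * m * x)) * (LINT w|\<mu>2. inverse (\<alpha> w) * absq w)"
    unfolding A_def abs_minus_cancel using \<alpha>_pos
    by (intro majorant_le bdd_kernel_basic assms) (auto intro: less_imp_le)
  also have "\<dots> \<le> exp (- (2 * m * x)) * (pi * energy)"
    using hilbert by (intro mult_left_mono) (auto simp: inverse_eq_divide)
  also have "\<dots> \<le> pi * energy" using assms energy_nonneg by (intro exp_decay_le) auto
  finally show ?thesis .
qed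

text \<open>Since \<open>\<bar>\<beta>\<bar> \<le> \<alpha>\<close>, the kernel of \<open>W\<close>
  is dominated by Hilbert's kernel and that of \<open>W\<^sub>x\<close> by the constant kernel of
  \<open>G2\<close>.\<close>

lemma kW_le: "w \<in> space \<mu>2 \<Longrightarrow> \<bar>kW w\<bar> \<le> inverse (\<alpha> w)"
  and kWx_le: "w \<in> space \<mu>2 \<Longrightarrow> \<bar>kWx w\<bar> \<le> 1"
proof -
  assume w: "w \<in> space \<mu>2"
  show *: "\<bar>kWx w\<bar> \<le> 1"
    using \<alpha>_pos[OF w] \<beta>_le_\<alpha>[OF w] by (simp add: kWx_def abs_mult inverse_eq_divide divide_simps)
  have "\<bar>kW w\<bar> = \<bar>kWx w\<bar> * inverse (\<alpha> w)" using \<alpha>_pos[OF w] by (simp add: kW_def kWx_def abs_mult)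
  also have "\<dots> \<le> 1 * inverse (\<alpha> w)" using * \<alpha>_pos[OF w] by (intro mult_right_mono) auto
  finally show "\<bar>kW w\<bar> \<le> inverse (\<alpha> w)" by simp
qed

lemma W_bound: assumes "0 \<le> Re \<zeta>" shows "\<bar>Im (form kW \<zeta>)\<bar> \<le> pi * energy"
proof -
  have "\<bar>Im (form kW \<zeta>)\<bar> \<le> norm (form kW \<zeta>)" by (rule abs_Im_le_cmod)
  also have "\<dots> \<le> - A (Re \<zeta>)" unfolding A_def minus_minus
    by (intro norm_form_le bdd_kernel_kernels bdd_kernel_basic kW_le)
  also have "\<dots> \<le> pi * energy" using A_bound[OF assms] by simp
  finally show ?thesis .
qed

lemma Wx_le: "\<bar>Im (form kWx \<zeta>)\<bar> \<le> G2 (Re \<zeta>)"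
proof -
  have "\<bar>Im (form kWx \<zeta>)\<bar> \<le> norm (form kWx \<zeta>)" by (rule abs_Im_le_cmod)
  also have "\<dots> \<le> G2 (Re \<zeta>)" unfolding G2_def by (intro norm_form_le bdd_kernel_kernels bdd_kernel_basic kWx_le)
  finally show ?thesis .
qed

lemma F_sq_le_G2: "(norm (F \<zeta>))\<^sup>2 \<le> G2 (Re \<zeta>)"
proof -
  have "(norm (F \<zeta>))\<^sup>2 = norm (form (\<lambda>w. 1) \<zeta>)" unfolding form_1 norm_of_real by simp
  also have "\<dots> \<le> G2 (Re \<zeta>)" unfolding G2_def by (intro norm_form_le bdd_kernel_basic) auto
  finally show ?thesis .
qed

lemma F_sq_le_Q: assumes "0 \<le> Re \<zeta>" shows "(norm (F \<zeta>))\<^sup>2 \<le> 4 * Q (Im \<zeta>) + Re (form kWy \<zeta>)"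
proof -
  have "(norm (F \<zeta>))\<^sup>2 = 4 * Re (form kP \<zeta>) + Re (form kWy \<zeta>)"
    using arg_cong[OF form_decomp[of \<zeta>], of Re] by (simp add: form_1)
  also have "Re (form kP \<zeta>) \<le> Q (Im \<zeta>)"
    using Re_form_kP_mono[OF assms, of "Im \<zeta>"] by (simp add: Q_def)
  finally show ?thesis by simp
qed

lemma F_sq_continuous: "continuous_on UNIV (\<lambda>\<zeta>. (norm (F \<zeta>))\<^sup>2)"
proof -
  have "(\<lambda>\<zeta>. (norm (F \<zeta>))\<^sup>2) = (\<lambda>\<zeta>. Re (form (\<lambda>w. 1) \<zeta>))" by (simp add: form_1)
  moreover have "continuous_on UNIV (\<lambda>\<zeta>. Re (form (\<lambda>w. 1) \<zeta>))"
    by (intro continuous_intros form_continuous bdd_kernel_basic)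
  ultimately show ?thesis by (simp only:)
qed

text \<open>Up to sign, the \<open>x\<close>-derivative of the function \<open>H\<close> in the proof dominates \<open>\<bar>F\<bar>\<^sup>2\<close>, as \<open>\<bar>F\<bar>\<^sup>2\<close>
  and \<open>\<bar>W\<^sub>x\<bar>\<close> are at most \<open>G2\<close>; so does the \<open>y\<close>-derivative, by \<open>form_decomp\<close>. Hence \<open>H\<close> grows
  along the curve at least as fast as the integral, which needs no differentiability of the curve.\<close>

lemma L2_monotone_curve:
  fixes z :: "real \<Rightarrow> complex"
  assumes ab: "a \<le> b"
    and lip: "\<And>s s'. a \<le> s \<Longrightarrow> s \<le> s' \<Longrightarrow> s' \<le> b \<Longrightarrow> norm (z s' - z s) \<le> s' - s"
    and arc: "\<And>s s'. a \<le> s \<Longrightarrow> s \<le> s' \<Longrightarrow> s' \<le> b \<Longrightarrow> s' - s \<le> \<bar>Re (z s' - z s)\<bar> + \<bar>Im (z s' - z s)\<bar>"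
    and sgn: "\<bar>\<sigma>\<bar> = 1" "\<bar>\<tau>\<bar> = 1"
    and mon: "\<And>s s'. a \<le> s \<Longrightarrow> s \<le> s' \<Longrightarrow> s' \<le> b \<Longrightarrow> 0 \<le> \<sigma> * Re (z s' - z s)"
      "\<And>s s'. a \<le> s \<Longrightarrow> s \<le> s' \<Longrightarrow> s' \<le> b \<Longrightarrow> 0 \<le> \<tau> * Im (z s' - z s)"
    and pos: "\<And>s. a \<le> s \<Longrightarrow> s \<le> b \<Longrightarrow> 0 \<le> Re (z s)"
  shows "integral {a..b} (\<lambda>s. (norm (F (z s)))\<^sup>2) \<le> 10 * pi * energy"
proof -
  define u where "u \<zeta> = (norm (F \<zeta>))\<^sup>2" for \<zeta>
  have contz: "continuous_on {a..b} z" by (rule lipschitz_continuous_on) (auto intro: lip)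
  have contu: "continuous_on {a..b} (\<lambda>s. u (z s))"
    unfolding u_def by (rule continuous_on_compose2[OF F_sq_continuous contz]) simp
  obtain U where U: "\<And>s. s \<in> {a..b} \<Longrightarrow> (U has_vector_derivative u (z s)) (at s within {a..b})"
    using antiderivative_continuous[OF contu] by blast
  have int_u: "((\<lambda>s. u (z s)) has_integral (U b - U a)) {a..b}"
    by (rule fundamental_theorem_of_calculus[OF ab U])
  \<comment> \<open>The curve has to stay strictly inside the strip of height \<open>Y\<close>,
    because \<open>B\<close> is a primitive of \<open>Q\<close> on \<open>{-Y..Y}\<close> only and
    needs a two-sided derivative along the curve.\<close>
  define Y where "Y = \<bar>Im (z a)\<bar> + (b - a) + 1"
  have Y: "0 < Y" using ab by (simp add: Y_def)
  have Im_z: "\<bar>Im (z s)\<bar> < Y" if "a \<le> s" "s \<le> b" for s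
  proof -
    have "\<bar>Im (z s - z a)\<bar> \<le> s - a" using lip[of a s] abs_Im_le_cmod[of "z s - z a"] that by simp
    then show ?thesis using that by (simp add: Y_def)
  qed
  obtain B where B: "\<And>y. y \<in> {-Y..Y} \<Longrightarrow> (B has_vector_derivative Q y) (at y within {-Y..Y})"
    using antiderivative_continuous[OF continuous_on_subset[OF Q_continuous]] by blast
  \<comment> \<open>In the \<open>x\<close>-derivative one copy of \<open>G2\<close> pays for
    \<open>u\<close>, the other for the \<open>W\<^sub>x\<close> term, whose sign is unknown. The
    \<open>y\<close>-derivative is \<open>\<tau>\<close> times \<open>4 Q - W\<^sub>y\<close>. The
    signs \<open>\<sigma>\<close> and \<open>\<tau>\<close> make the increments of both coordinates
    count positively.\<close>
  define H where "H \<zeta> = 2 * \<sigma> * A (Re \<zeta>) + \<tau> * (4 * B (Im \<zeta>) - Im (form kW \<zeta>))" for \<zeta>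
  define H' where "H' \<zeta> h = Re h * (2 * \<sigma> * G2 (Re \<zeta>) + \<tau> * Im (form kWx \<zeta>)) + Im h * (\<tau> * (4 * Q (Im \<zeta>) + Re (form kWy \<zeta>)))" for \<zeta> h
  have derivH: "(H has_derivative H' \<zeta>) (at \<zeta>)" if "\<bar>Im \<zeta>\<bar> < Y" for \<zeta>
  proof -
    have "(form kW has_derivative (\<lambda>h. - of_real (Re h) * form kWx \<zeta> - \<i> * of_real (Im h) * form kWy \<zeta>)) (at \<zeta>)"
    proof (rule form_has_derivative[OF bdd_kernel_kernels(1)])
      fix w assume "w \<in> space \<mu>2"
      then have "\<alpha> w * inverse (\<alpha> w) = 1" using \<alpha>_pos[of w] by (intro right_inverse) simp
      moreover have "\<alpha> w * kW w = \<beta> w * inverse (\<alpha> w) * (\<alpha> w * inverse (\<alpha> w))"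
        by (simp only: kW_def mult_ac)
      ultimately show "kWx w = \<alpha> w * kW w" by (simp only: kWx_def mult_1_right)
      show "kWy w = \<beta> w * kW w" by (simp add: kW_def kWx_def kWy_def)
    qed
    then have 1: "((\<lambda>\<zeta>. Im (form kW \<zeta>)) has_derivative (\<lambda>h. Im (- of_real (Re h) * form kWx \<zeta> - \<i> * of_real (Im h) * form kWy \<zeta>))) (at \<zeta>)"
      by (rule bounded_linear.has_derivative[OF bounded_linear_Im])
    have "(A has_derivative (*) (G2 (Re \<zeta>))) (at (Re \<zeta>))"
      using A_DERIV by (simp add: has_field_derivative_def)
    then have 2: "((\<lambda>\<zeta>. A (Re \<zeta>)) has_derivative (\<lambda>h. G2 (Re \<zeta>) * Re h)) (at \<zeta>)"
      using has_derivative_compose[OF bounded_linear_imp_has_derivative[OF bounded_linear_Re]] by blast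
    have "at (Im \<zeta>) within {-Y..Y} = at (Im \<zeta>)" using that by (intro at_within_Icc_at) auto
    moreover have "Im \<zeta> \<in> {-Y..Y}" using that by (auto simp: abs_less_iff)
    ultimately have "(B has_derivative (*) (Q (Im \<zeta>))) (at (Im \<zeta>))"
      using B[of "Im \<zeta>"] by (simp add: has_real_derivative_iff_has_vector_derivative[symmetric] has_field_derivative_def)
    then have 3: "((\<lambda>\<zeta>. B (Im \<zeta>)) has_derivative (\<lambda>h. Q (Im \<zeta>) * Im h)) (at \<zeta>)"
      using has_derivative_compose[OF bounded_linear_imp_has_derivative[OF bounded_linear_Im]] by blast
    show ?thesis unfolding H_def
      by (rule has_derivative_eq_rhs, (rule 1 2 3 derivative_intros)+) (simp add: fun_eq_iff H'_def algebra_simps)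
  qed
  have H'_ge: "u \<zeta> * (\<bar>Re h\<bar> + \<bar>Im h\<bar>) \<le> H' \<zeta> h"
    if "0 \<le> Re \<zeta>" "0 \<le> \<sigma> * Re h" "0 \<le> \<tau> * Im h" for \<zeta> h
  proof -
    have s: "\<sigma> * Re h = \<bar>Re h\<bar>" "\<tau> * Im h = \<bar>Im h\<bar>" using sgn that(2,3) by (metis abs_mult abs_of_nonneg mult_1)+
    have st: "\<sigma> * \<sigma> = 1" using sgn by (metis abs_mult_self_eq mult_1)
    have "\<bar>\<tau> * \<sigma> * Im (form kWx \<zeta>)\<bar> \<le> G2 (Re \<zeta>)" using Wx_le[of \<zeta>] sgn by (simp add: abs_mult)
    then have "u \<zeta> \<le> 2 * G2 (Re \<zeta>) + \<tau> * \<sigma> * Im (form kWx \<zeta>)" using F_sq_le_G2[of \<zeta>] unfolding u_def by linarith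
    then have "u \<zeta> * \<bar>Re h\<bar> \<le> (2 * G2 (Re \<zeta>) + \<tau> * \<sigma> * Im (form kWx \<zeta>)) * \<bar>Re h\<bar>" by (rule mult_right_mono) simp
    also have "\<dots> = Re h * (2 * \<sigma> * G2 (Re \<zeta>) + \<sigma> * \<sigma> * \<tau> * Im (form kWx \<zeta>))" by (simp add: s(1)[symmetric] algebra_simps)
    also have "\<dots> = Re h * (2 * \<sigma> * G2 (Re \<zeta>) + \<tau> * Im (form kWx \<zeta>))" by (simp add: st)
    finally have x: "u \<zeta> * \<bar>Re h\<bar> \<le> Re h * (2 * \<sigma> * G2 (Re \<zeta>) + \<tau> * Im (form kWx \<zeta>))" .
    have "u \<zeta> * \<bar>Im h\<bar> \<le> (4 * Q (Im \<zeta>) + Re (form kWy \<zeta>)) * \<bar>Im h\<bar>"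
      using F_sq_le_Q[OF that(1)] by (intro mult_right_mono) (auto simp: u_def)
    also have "\<dots> = Im h * (\<tau> * (4 * Q (Im \<zeta>) + Re (form kWy \<zeta>)))" by (simp add: s(2)[symmetric] algebra_simps)
    finally show ?thesis using x by (simp add: H'_def distrib_left)
  qed
  define D where "D s = U s - H (z s)" for s
  have contH: "continuous_on (z ` {a..b}) H"
  proof (intro continuous_at_imp_continuous_on ballI)
    fix \<zeta> assume "\<zeta> \<in> z ` {a..b}"
    then have "\<bar>Im \<zeta>\<bar> < Y" using Im_z by auto
    then show "isCont H \<zeta>" by (rule has_derivative_continuous[OF derivH])
  qed
  have "D b \<le> D a"
  proof (rule nonincreasing_if_right_Dini_le_0[OF ab])
    have "continuous_on {a..b} U" unfolding continuous_on_eq_continuous_within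
      using U by (blast intro: has_vector_derivative_continuous)
    moreover have "continuous_on {a..b} (\<lambda>s. H (z s))" by (rule continuous_on_compose2[OF contH contz]) simp
    ultimately show "continuous_on {a..b} D" unfolding D_def by (intro continuous_intros)
    fix s e :: real assume s: "a \<le> s" "s < b" and e: "0 < e"
    obtain d1 where d1: "0 < d1" "\<And>y. y \<in> {a..b} \<Longrightarrow> norm (y - s) < d1 \<Longrightarrow> norm (U y - U s - (y - s) *\<^sub>R u (z s)) \<le> e / 2 * norm (y - s)"
      using U[of s] s e unfolding has_vector_derivative_def has_derivative_within_alt
      by (auto dest!: spec[of _ "e / 2"])
    obtain d2 where d2: "0 < d2" "\<And>\<zeta>. norm (\<zeta> - z s) < d2 \<Longrightarrow> norm (H \<zeta> - H (z s) - H' (z s) (\<zeta> - z s)) \<le> e / 2 * norm (\<zeta> - z s)"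
      using derivH[of "z s"] Im_z[of s] s e unfolding has_derivative_at_alt
      by (auto dest!: spec[of _ "e / 2"])
    \<comment> \<open>Small enough for the first-order expansions of \<open>U\<close> and
      \<open>H\<close> to hold, each with an error of at most \<open>e / 2 * h\<close>; for
      \<open>H\<close> this uses that the curve moves by at most \<open>h\<close>.\<close>
    define h where "h = min (b - s) (min (d1 / 2) (d2 / 2))"
    have h: "0 < h" "s + h \<le> b" "h < d1" "h < d2" using s d1(1) d2(1) by (auto simp: h_def min_def)
    define k where "k = z (s + h) - z s"
    have k: "norm k \<le> h" "h \<le> \<bar>Re k\<bar> + \<bar>Im k\<bar>" "0 \<le> \<sigma> * Re k" "0 \<le> \<tau> * Im k"
      using lip[of s "s + h"] arc[of s "s + h"] mon[of s "s + h"] s h by (auto simp: k_def)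
    have "\<bar>U (s + h) - U s - h * u (z s)\<bar> \<le> e / 2 * h" using d1(2)[of "s + h"] s h by auto
    then have "U (s + h) - U s \<le> h * u (z s) + e / 2 * h" by (simp only: abs_le_iff) linarith
    moreover have "H' (z s) k - e / 2 * h \<le> H (z (s + h)) - H (z s)"
    proof -
      have "norm (H (z (s + h)) - H (z s) - H' (z s) k) \<le> e / 2 * norm k"
        using d2(2)[of "z (s + h)"] k h by (simp add: k_def)
      also have "\<dots> \<le> e / 2 * h" using k e by (intro mult_left_mono) auto
      finally show ?thesis by (simp only: real_norm_def abs_le_iff) linarith
    qed
    moreover have "u (z s) * h \<le> H' (z s) k"
    proof -
      have "u (z s) * h \<le> u (z s) * (\<bar>Re k\<bar> + \<bar>Im k\<bar>)" using k by (intro mult_left_mono) (auto simp: u_def)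
      also have "\<dots> \<le> H' (z s) k" using k s pos[of s] by (intro H'_ge) auto
      finally show ?thesis .
    qed
    ultimately have "D (s + h) - D s \<le> e * h" by (simp add: D_def algebra_simps)
    then show "\<exists>h>0. s + h \<le> b \<and> D (s + h) - D s \<le> e * h" using h by blast
  qed
  then have "U b - U a \<le> H (z b) - H (z a)" by (simp add: D_def)
  also have "\<dots> = 2 * (\<sigma> * (A (Re (z b)) - A (Re (z a)))) + 4 * (\<tau> * (B (Im (z b)) - B (Im (z a))))
      - \<tau> * (Im (form kW (z b)) - Im (form kW (z a)))"
    by (simp add: H_def algebra_simps)
  \<comment> \<open>\<open>A\<close> and \<open>W\<close> are bounded by \<open>pi * energy\<close>,
    so each varies by at most twice that, while \<open>B\<close> varies by at most
    \<open>pi * energy\<close>. With the weights 2, 4 and 1 the total is 4 + 4 + 2 = 10.\<close>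
  also have "\<dots> \<le> 2 * (2 * (pi * energy)) + 4 * (pi * energy) + 2 * (pi * energy)"
  proof -
    have abs: "\<sigma> * x \<le> \<bar>x\<bar>" "\<tau> * x \<le> \<bar>x\<bar>" "- (\<tau> * x) \<le> \<bar>x\<bar>" for x
      using sgn by (metis abs_ge_self abs_mult mult_1, metis abs_ge_self abs_mult mult_1, metis abs_ge_minus_self abs_mult mult_1)
    have "\<bar>A (Re (z b)) - A (Re (z a))\<bar> \<le> 2 * (pi * energy)"
      using A_bound[OF pos[of a]] A_bound[OF pos[of b]] ab by (simp add: abs_le_iff)
    then have 1: "\<sigma> * (A (Re (z b)) - A (Re (z a))) \<le> 2 * (pi * energy)" using abs(1) order.trans by blast
    have "\<bar>Im (form kW (z b)) - Im (form kW (z a))\<bar> \<le> 2 * (pi * energy)"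
      using W_bound[OF pos[of a]] W_bound[OF pos[of b]] ab by (simp add: abs_le_iff)
    then have 2: "- (\<tau> * (Im (form kW (z b)) - Im (form kW (z a)))) \<le> 2 * (pi * energy)" using abs(3) order.trans by blast
    \<comment> \<open>This rounds the constant \<open>pi / 2 * exp (1 / 2)\<close> of
      \<open>Q_primitive\<close> up to \<open>pi\<close>.\<close>
    have "exp (1 / 2 :: real) \<le> 2" using exp_half_le2 by simp
    then have "pi / 2 * exp (1 / 2) * energy \<le> pi / 2 * 2 * energy"
      using energy_nonneg by (intro mult_right_mono mult_left_mono) auto
    then have le: "pi / 2 * exp (1 / 2) * energy \<le> pi * energy" by simp
    have Bd: "\<bar>B y' - B y\<bar> \<le> pi * energy" if y: "- Y \<le> y" "y \<le> y'" "y' \<le> Y" for y y'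
    proof -
      have B': "(B has_vector_derivative Q y) (at y within {-Y..Y})" if "\<bar>y\<bar> \<le> Y" for y
        using B[of y] that by (simp add: abs_le_iff)
      show ?thesis using Q_primitive[OF Y B' y] le by linarith
    qed
    have "\<bar>B (Im (z b)) - B (Im (z a))\<bar> \<le> pi * energy"
      using Bd[of "Im (z a)" "Im (z b)"] Bd[of "Im (z b)" "Im (z a)"] Im_z[of a] Im_z[of b] ab
      by (cases "Im (z a) \<le> Im (z b)") (auto simp: abs_minus_commute abs_less_iff)
    then have 3: "\<tau> * (B (Im (z b)) - B (Im (z a))) \<le> pi * energy" using abs(2) order.trans by blast
    show ?thesis using 1 2 3 by linarith
  qed
  finally have "U b - U a \<le> 10 * pi * energy" by simp
  then show ?thesis using integral_unique[OF int_u] by (simp add: u_def)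
qed

end

subsection \<open>Convex curves split into monotone arcs\<close>

lemma curve_length_dist:
  assumes "curve_length z a b = ennreal (b - a)" "a \<le> b"
  shows "norm (z b - z a) \<le> b - a"
proof -
  define \<tau> where "\<tau> i = (if i = 0 then a else b)" for i :: nat
  have "(\<Sum>i<1. ennreal (dist (z (\<tau> i)) (z (\<tau> (Suc i))))) \<le> curve_length z a b"
    unfolding curve_length_def
    by (rule SUP_upper2[of "(1, \<tau>)"]) (use assms(2) in \<open>auto simp: \<tau>_def mono_on_def\<close>)
  then show ?thesis using assms by (simp add: \<tau>_def dist_norm norm_minus_commute)
qed

text \<open>Each chord is at most the sum of its absolute coordinate increments. By monotonicity
  these are signed increments, so they telescope and every inscribed polygon obeys the same bound.
  This is \<open>ds \<le> \<bar>dx\<bar> + \<bar>dy\<bar>\<close> without derivatives.\<close>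

lemma curve_length_monotone_le:
  fixes \<sigma> \<tau> :: real
  assumes len: "curve_length z a b = ennreal (b - a)" and "a \<le> b" and sgn: "\<bar>\<sigma>\<bar> = 1" "\<bar>\<tau>\<bar> = 1"
    and mon: "\<And>s s'. a \<le> s \<Longrightarrow> s \<le> s' \<Longrightarrow> s' \<le> b \<Longrightarrow> 0 \<le> \<sigma> * Re (z s' - z s)"
      "\<And>s s'. a \<le> s \<Longrightarrow> s \<le> s' \<Longrightarrow> s' \<le> b \<Longrightarrow> 0 \<le> \<tau> * Im (z s' - z s)"
  shows "b - a \<le> \<bar>Re (z b - z a)\<bar> + \<bar>Im (z b - z a)\<bar>"
proof -
  have s: "\<sigma> * x = \<bar>x\<bar>" if "0 \<le> \<sigma> * x" for x using sgn that by (metis abs_mult abs_of_nonneg mult_1)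
  have t: "\<tau> * x = \<bar>x\<bar>" if "0 \<le> \<tau> * x" for x using sgn that by (metis abs_mult abs_of_nonneg mult_1)
  have "curve_length z a b \<le> ennreal (\<bar>Re (z b - z a)\<bar> + \<bar>Im (z b - z a)\<bar>)"
    unfolding curve_length_def
  proof (rule SUP_least)
    fix np :: "nat \<times> (nat \<Rightarrow> real)" assume "np \<in> {(n, \<tau>). mono_on {..n} \<tau> \<and> \<tau> 0 = a \<and> \<tau> n = b}"
    then obtain n p where np: "np = (n, p)" and p: "mono_on {..n} p" "p 0 = a" "p n = b" by auto
    have ord: "p i \<le> p j" if "i \<le> j" "j \<le> n" for i j
    proof -
      have "i \<le> n" using that by simp
      then show ?thesis using mono_onD[OF p(1), of i j] that by simp
    qed
    have "(\<Sum>i<n. dist (z (p i)) (z (p (Suc i)))) \<le> (\<Sum>i<n. \<sigma> * Re (z (p (Suc i)) - z (p i)) + \<tau> * Im (z (p (Suc i)) - z (p i)))"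
    proof (rule sum_mono)
      fix i assume "i \<in> {..<n}"
      then have i: "a \<le> p i" "p i \<le> p (Suc i)" "p (Suc i) \<le> b" using ord p by auto
      have "dist (z (p i)) (z (p (Suc i))) \<le> \<bar>Re (z (p (Suc i)) - z (p i))\<bar> + \<bar>Im (z (p (Suc i)) - z (p i))\<bar>"
        by (metis cmod_le dist_commute dist_norm)
      then show "dist (z (p i)) (z (p (Suc i))) \<le> \<sigma> * Re (z (p (Suc i)) - z (p i)) + \<tau> * Im (z (p (Suc i)) - z (p i))"
        using s[OF mon(1)[OF i]] t[OF mon(2)[OF i]] by simp
    qed
    also have "\<dots> = (\<Sum>i<n. (\<sigma> * Re (z (p (Suc i))) + \<tau> * Im (z (p (Suc i)))) - (\<sigma> * Re (z (p i)) + \<tau> * Im (z (p i))))"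
      by (simp add: algebra_simps)
    also have "\<dots> = \<sigma> * Re (z b - z a) + \<tau> * Im (z b - z a)"
      by (subst sum_lessThan_telescope) (simp add: p algebra_simps)
    also have "\<dots> = \<bar>Re (z b - z a)\<bar> + \<bar>Im (z b - z a)\<bar>"
      using s[OF mon(1)[of a b]] t[OF mon(2)[of a b]] \<open>a \<le> b\<close> by simp
    finally show "(case np of (n, \<tau>) \<Rightarrow> \<Sum>i<n. ennreal (dist (z (\<tau> i)) (z (\<tau> (Suc i))))) \<le> ennreal (\<bar>Re (z b - z a)\<bar> + \<bar>Im (z b - z a)\<bar>)"
      by (simp add: sum_ennreal np ennreal_leI del: ennreal_plus)
  qed
  then show ?thesis using len by (simp del: ennreal_plus)
qed

section \<open>Monotone pieces of a function with few points on each level\<close>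

definition monot_on :: "real set \<Rightarrow> (real \<Rightarrow> real) \<Rightarrow> bool" where
  "monot_on S g \<longleftrightarrow> mono_on S g \<or> antimono_on S g"

lemma monot_on_subset: "monot_on S g \<Longrightarrow> T \<subseteq> S \<Longrightarrow> monot_on T g"
  unfolding monot_on_def by (auto simp: monotone_on_def)

lemma monot_on_uminus: "monot_on S (\<lambda>s. - g s) \<longleftrightarrow> monot_on S g"
  unfolding monot_on_def by (auto simp: monotone_on_def)

lemma monot_on_sign:
  assumes "monot_on {a..b} g"
  obtains \<sigma> :: real where "\<bar>\<sigma>\<bar> = 1" "\<And>s s'. a \<le> s \<Longrightarrow> s \<le> s' \<Longrightarrow> s' \<le> b \<Longrightarrow> 0 \<le> \<sigma> * (g s' - g s)"
proof -
  from assms consider "mono_on {a..b} g" | "antimono_on {a..b} g" by (auto simp: monot_on_def)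
  then show thesis
  proof cases
    case 1 then show ?thesis by (intro that[of 1]) (auto simp: monotone_on_def)
  next
    case 2 then show ?thesis by (intro that[of "-1"]) (auto simp: monotone_on_def)
  qed
qed

lemma IVT_open:
  fixes g :: "real \<Rightarrow> real"
  assumes "continuous_on {s..t} g" "s \<le> t" "(g s < c \<and> c < g t) \<or> (g t < c \<and> c < g s)"
  obtains r where "s < r" "r < t" "g r = c"
proof -
  have "\<exists>r. s \<le> r \<and> r \<le> t \<and> g r = c"
    using assms IVT'[of g s c t] IVT2'[of g t c s] by (auto simp: less_imp_le)
  then obtain r where "s \<le> r" "r \<le> t" "g r = c" by blast
  moreover have "r \<noteq> s" "r \<noteq> t" using \<open>g r = c\<close> assms(3) by auto
  ultimately show thesis by (intro that[of r]) auto
qed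

lemma dense_avoid:
  fixes lo hi v :: real assumes "lo < hi" obtains c where "lo < c" "c < hi" "c \<noteq> v"
proof -
  obtain c1 where c1: "lo < c1" "c1 < hi" using dense[OF assms] by blast
  obtain c2 where c2: "lo < c2" "c2 < c1" using dense[OF c1(1)] by blast
  show thesis by (cases "c1 = v") (use c1 c2 that[of c1] that[of c2] in auto)
qed

text \<open>The cuts are a minimum point \<open>p\<close> and a maximum point \<open>q\<close>. If
  \<open>g\<close> moved the wrong way on one of the pieces, every level in the resulting gap would
  be crossed three times by the intermediate value theorem. A gap contains levels other than the
  exceptional \<open>v\<close>, and strict inequalities keep the crossings away from the
  endpoints.\<close>

lemma three_pieces_aux:
  fixes g :: "real \<Rightarrow> real"
  assumes cont: "continuous_on {a..b} g" and pq: "a \<le> p" "p \<le> q" "q \<le> b"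
    and p: "\<And>s. s \<in> {a..b} \<Longrightarrow> g p \<le> g s" and q: "\<And>s. s \<in> {a..b} \<Longrightarrow> g s \<le> g q"
    and level: "\<And>c r t1 t2 t3 t. c \<noteq> v \<Longrightarrow> r \<in> {a..b} \<Longrightarrow> t \<in> {a..b} \<Longrightarrow> g r < c \<Longrightarrow> c < g t \<Longrightarrow>
        a < t1 \<Longrightarrow> t1 < t2 \<Longrightarrow> t2 < t3 \<Longrightarrow> t3 < b \<Longrightarrow> g t1 = c \<Longrightarrow> g t2 = c \<Longrightarrow> g t3 = c \<Longrightarrow> False"
  shows "monot_on {a..p} g \<and> monot_on {p..q} g \<and> monot_on {q..b} g"
proof -
  have ivt: "\<exists>r. s < r \<and> r < t \<and> g r = c" if "a \<le> s" "s \<le> t" "t \<le> b" "(g s < c \<and> c < g t) \<or> (g t < c \<and> c < g s)" for s t c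
    using IVT_open[OF continuous_on_subset[OF cont] that(2,4)] that by (metis atLeastatMost_subset_iff)
  have "mono_on {p..q} g"
  proof (rule mono_onI, rule ccontr)
    fix s s' assume s: "s \<in> {p..q}" "s' \<in> {p..q}" "s \<le> s'" "\<not> g s \<le> g s'"
    then obtain c where c: "g s' < c" "c < g s" "c \<noteq> v" using dense_avoid[of "g s'" "g s" v] by auto
    have "g p < c" "c < g q" using c p[of s'] q[of s] s pq by auto
    then obtain t1 t2 t3 where "p < t1" "t1 < s" "g t1 = c" "s < t2" "t2 < s'" "g t2 = c" "s' < t3" "t3 < q" "g t3 = c"
      using ivt[of p s c] ivt[of s s' c] ivt[of s' q c] s pq c by auto
    then show False using level[of c p q t1 t2 t3] c \<open>g p < c\<close> \<open>c < g q\<close> pq by auto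
  qed
  moreover have "antimono_on {a..p} g"
  proof (rule monotone_onI, rule ccontr)
    fix s s' assume s: "s \<in> {a..p}" "s' \<in> {a..p}" "s \<le> s'" "\<not> g s \<ge> g s'"
    then obtain c where c: "g s < c" "c < g s'" "c \<noteq> v" using dense_avoid[of "g s" "g s'" v] by auto
    have "g p < c" "c < g q" using c p[of s] q[of s'] s pq by auto
    then obtain t1 t2 t3 where "s < t1" "t1 < s'" "g t1 = c" "s' < t2" "t2 < p" "g t2 = c" "p < t3" "t3 < q" "g t3 = c"
      using ivt[of s s' c] ivt[of s' p c] ivt[of p q c] s pq c by auto
    then show False using level[of c p q t1 t2 t3] c \<open>g p < c\<close> \<open>c < g q\<close> pq s by auto
  qed
  moreover have "antimono_on {q..b} g"
  proof (rule monotone_onI, rule ccontr)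
    fix s s' assume s: "s \<in> {q..b}" "s' \<in> {q..b}" "s \<le> s'" "\<not> g s \<ge> g s'"
    then obtain c where c: "g s < c" "c < g s'" "c \<noteq> v" using dense_avoid[of "g s" "g s'" v] by auto
    have "g p < c" "c < g q" using c p[of s] q[of s'] s pq by auto
    then obtain t1 t2 t3 where "p < t1" "t1 < q" "g t1 = c" "q < t2" "t2 < s" "g t2 = c" "s < t3" "t3 < s'" "g t3 = c"
      using ivt[of p q c] ivt[of q s c] ivt[of s s' c] s pq c by auto
    then show False using level[of c p q t1 t2 t3] c \<open>g p < c\<close> \<open>c < g q\<close> pq s by auto
  qed
  ultimately show ?thesis by (auto simp: monot_on_def)
qed

lemma three_pieces:
  fixes g :: "real \<Rightarrow> real"
  assumes "a \<le> b" and cont: "continuous_on {a..b} g"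
    and level: "\<And>c r t1 t2 t3 t. c \<noteq> v \<Longrightarrow> r \<in> {a..b} \<Longrightarrow> t \<in> {a..b} \<Longrightarrow> g r < c \<Longrightarrow> c < g t \<Longrightarrow>
        a < t1 \<Longrightarrow> t1 < t2 \<Longrightarrow> t2 < t3 \<Longrightarrow> t3 < b \<Longrightarrow> g t1 = c \<Longrightarrow> g t2 = c \<Longrightarrow> g t3 = c \<Longrightarrow> False"
  obtains p q where "a \<le> p" "p \<le> q" "q \<le> b" "monot_on {a..p} g" "monot_on {p..q} g" "monot_on {q..b} g"
proof -
  obtain p where p: "p \<in> {a..b}" "\<And>s. s \<in> {a..b} \<Longrightarrow> g p \<le> g s"
    using continuous_attains_inf[of "{a..b}" g] assms by auto
  obtain q where q: "q \<in> {a..b}" "\<And>s. s \<in> {a..b} \<Longrightarrow> g s \<le> g q"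
    using continuous_attains_sup[of "{a..b}" g] assms by auto
  show thesis
  proof (cases "p \<le> q")
    case True
    then show thesis using three_pieces_aux[OF cont _ True _ p(2) q(2) level] p q that by auto
  next
    case False
    \<comment> \<open>If the maximum comes first, negation exchanges the extrema and moves the
      exceptional level to \<open>- v\<close>.\<close>
    have "monot_on {a..q} (\<lambda>s. - g s) \<and> monot_on {q..p} (\<lambda>s. - g s) \<and> monot_on {p..b} (\<lambda>s. - g s)"
    proof (rule three_pieces_aux[where v = "- v"])
      fix c r t1 t2 t3 t
      assume "c \<noteq> - v" "r \<in> {a..b}" "t \<in> {a..b}" "- g r < c" "c < - g t" "a < t1" "t1 < t2" "t2 < t3" "t3 < b"
        "- g t1 = c" "- g t2 = c" "- g t3 = c"
      then show False using level[of "- c" t r t1 t2 t3] by auto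
    qed (use False p q cont in \<open>auto intro: continuous_intros\<close>)
    then show thesis using False p q that[of q p] by (auto simp: monot_on_uminus)
  qed
qed

section \<open>Level lines and the boundary of a convex set\<close>

lemma supporting_halfplane:
  fixes S :: "'a::euclidean_space set"
  assumes "convex S" "x \<notin> interior S" "x \<in> S"
  obtains a where "a \<noteq> 0" "\<And>y. y \<in> S \<Longrightarrow> a \<bullet> x \<le> a \<bullet> y"
proof (cases "interior S = {}")
  case True
  then obtain a b where "a \<noteq> 0" "S \<subseteq> {y. a \<bullet> y = b}"
    using empty_interior_subset_hyperplane[OF assms(1)] by blast
  moreover have "a \<bullet> y = b" if "y \<in> S" for y using \<open>S \<subseteq> {y. a \<bullet> y = b}\<close> that by blast
  ultimately show thesis using assms(3) by (intro that[of a]) auto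
next
  case False
  then obtain a b where ab: "a \<noteq> 0" "a \<bullet> x \<le> b" "\<forall>y\<in>interior S. b \<le> a \<bullet> y"
    using separating_hyperplane_sets[of "{x}" "interior S"] assms by (auto simp: convex_interior)
  have "closure (interior S) \<subseteq> {y. b \<le> a \<bullet> y}"
    using ab(3) by (intro closure_minimal closed_Collect_le continuous_intros) auto
  moreover have "S \<subseteq> closure (interior S)"
    using convex_closure_interior[OF assms(1) False] closure_subset by auto
  ultimately show thesis using ab by (intro that[of a]) force+
qed

text \<open>A coordinate of the plane is written as the inner product with \<open>d\<close>, where \<open>d\<close> is \<open>1\<close>
  for the real part and \<open>\<i>\<close> for the imaginary part.\<close>

lemma inner_decomp:
  fixes a w d :: complex assumes "d = 1 \<or> d = \<i>"
  shows "a \<bullet> w = (a \<bullet> d) * (w \<bullet> d) + (a \<bullet> (\<i> * d)) * (w \<bullet> (\<i> * d))"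
  using assms by (auto simp: inner_complex_def)

text \<open>Consider the supporting line at the middle point \<open>P2\<close>. The points
  \<open>P1\<close> and \<open>P3\<close> on the same level line, on either side of
  \<open>P2\<close>, force it to be that level line; but \<open>U\<close> and \<open>V\<close> lie
  strictly on opposite sides of the level line. So the normal vanishes, which is absurd.\<close>

lemma frontier_chord:
  fixes P1 P2 P3 U V d :: complex
  assumes K: "convex K" and P: "P1 \<in> frontier K" "P2 \<in> frontier K" "P3 \<in> frontier K"
    and UV: "U \<in> closure K" "V \<in> closure K"
    and d: "d = 1 \<or> d = \<i>" and lev: "P1 \<bullet> d = c" "P2 \<bullet> d = c" "P3 \<bullet> d = c" "U \<bullet> d < c" "c < V \<bullet> d"
    and ord: "P1 \<bullet> (\<i> * d) < P2 \<bullet> (\<i> * d)" "P2 \<bullet> (\<i> * d) < P3 \<bullet> (\<i> * d)"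
  shows False
proof -
  have "P2 \<notin> interior (closure K)" "P1 \<in> closure K" "P2 \<in> closure K" "P3 \<in> closure K"
    using P convex_interior_closure[OF K] by (auto simp: frontier_def)
  then obtain a where a: "a \<noteq> 0" "\<And>y. y \<in> closure K \<Longrightarrow> a \<bullet> P2 \<le> a \<bullet> y"
    using supporting_halfplane[OF convex_closure[OF K]] by metis
  define A B where "A = a \<bullet> d" and "B = a \<bullet> (\<i> * d)"
  have le: "A * c + B * (P2 \<bullet> (\<i> * d)) \<le> A * (y \<bullet> d) + B * (y \<bullet> (\<i> * d))" if "y \<in> closure K" for y
    using a(2)[OF that] inner_decomp[OF d, of a y] inner_decomp[OF d, of a P2] lev by (simp add: A_def B_def)
  have "B * (P2 \<bullet> (\<i> * d)) \<le> B * (P1 \<bullet> (\<i> * d))" "B * (P2 \<bullet> (\<i> * d)) \<le> B * (P3 \<bullet> (\<i> * d))"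
    using le[of P1] le[of P3] P lev by (auto simp: frontier_def)
  then have "B = 0" using ord by (auto simp: mult_le_cancel_left)
  then have "A * c \<le> A * (U \<bullet> d)" "A * c \<le> A * (V \<bullet> d)" using le[of U] le[of V] UV by auto
  then have "A = 0" using lev by (auto simp: mult_le_cancel_left)
  then show False using a(1) inner_decomp[OF d, of a a] \<open>B = 0\<close> by (simp add: A_def B_def)
qed

lemma frontier_level_le_2:
  fixes P1 P2 P3 U V d :: complex
  assumes K: "convex K" "{P1, P2, P3, U, V} \<subseteq> frontier K"
    and d: "d = 1 \<or> d = \<i>" and lev: "P1 \<bullet> d = c" "P2 \<bullet> d = c" "P3 \<bullet> d = c" "U \<bullet> d < c" "c < V \<bullet> d"
    and "P1 \<noteq> P2" "P2 \<noteq> P3" "P1 \<noteq> P3"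
  shows False
proof -
  have ne: "P \<bullet> (\<i> * d) \<noteq> P' \<bullet> (\<i> * d)" if "P \<noteq> P'" "P \<bullet> d = c" "P' \<bullet> d = c" for P P'
    using that d by (auto simp: inner_complex_def complex_eq_iff)
  have cl: "U \<in> closure K" "V \<in> closure K" using K by (auto simp: frontier_def)
  have fr: "P1 \<in> frontier K" "P2 \<in> frontier K" "P3 \<in> frontier K" using K by auto
  note ch = frontier_chord[OF K(1) _ _ _ cl d _ _ _ lev(4,5)]
  show False
    using ne[of P1 P2] ne[of P2 P3] ne[of P1 P3] assms(9-) lev(1-3) fr ch
    by (metis linorder_neqE_linordered_idom)
qed

text \<open>The level of \<open>c 0\<close> is exempt, because the starting point is visited at both
  parameters 0 and 1. On a simple curve the three parameters give three boundary points on one line.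
  On a doubly traversed segment the level meets only one inner point, which is visited just
  twice.\<close>

lemma convex_closed_curve_level:
  assumes c: "convex_closed_curve c" and d: "d = 1 \<or> d = \<i>"
    and v: "v \<noteq> c 0 \<bullet> d" and rq: "r \<in> {0..1}" "c r \<bullet> d < v" "q \<in> {0..1}" "v < c q \<bullet> d"
    and t: "0 \<le> t1" "t1 < t2" "t2 < t3" "t3 \<le> 1" "c t1 \<bullet> d = v" "c t2 \<bullet> d = v" "c t3 \<bullet> d = v"
  shows False
proof -
  have c01: "c 1 = c 0" using c by (simp add: convex_closed_curve_def pathfinish_def pathstart_def)
  obtain K where K: "convex K" "path_image c = frontier K" using c by (auto simp: convex_closed_curve_def)
  have mem: "c s \<in> path_image c" if "0 \<le> s" "s \<le> 1" for s using that by (auto simp: path_image_def)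
  have "t3 \<noteq> 1" "t1 \<noteq> 0" using t v c01 by auto
  with t have t': "0 < t1" "t3 < 1" by auto
  from c have "traversed_once c" by (simp add: convex_closed_curve_def)
  then show False unfolding traversed_once_def
  proof (elim disjE exE conjE)
    assume "simple_path c"
    then have inj: "x = y" if "x \<in> {0<..<1}" "y \<in> {0<..<1}" "c x = c y" for x y
      using that unfolding simple_path_def loop_free_def by fastforce
    show False
      by (rule frontier_level_le_2[OF K(1) _ d t(5-7) rq(2,4)])
        (use mem rq t t' K(2) inj[of t1 t2] inj[of t2 t3] inj[of t1 t3] in auto)
  next
    fix a b assume ab: "a \<noteq> b" "path_image c = closed_segment a b"
      and card: "\<forall>w\<in>open_segment a b. card {t \<in> {0..<1}. c t = w} = 2"
    obtain \<rho> where \<rho>: "0 \<le> \<rho>" "\<rho> \<le> 1" "c r = (1 - \<rho>) *\<^sub>R a + \<rho> *\<^sub>R b"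
      using mem[of r] rq ab(2) by (auto simp: in_segment)
    obtain \<eta> where \<eta>: "0 \<le> \<eta>" "\<eta> \<le> 1" "c q = (1 - \<eta>) *\<^sub>R a + \<eta> *\<^sub>R b"
      using mem[of q] rq ab(2) by (auto simp: in_segment)
    define l where "l = b \<bullet> d - a \<bullet> d"
    have r: "a \<bullet> d + \<rho> * l < v" and q: "v < a \<bullet> d + \<eta> * l"
      using rq \<rho>(3) \<eta>(3) by (auto simp: l_def inner_add_left algebra_simps)
    then have "l \<noteq> 0" by auto
    define \<omega> where "\<omega> = (v - a \<bullet> d) / l"
    define w where "w = (1 - \<omega>) *\<^sub>R a + \<omega> *\<^sub>R b"
    have eq: "c s = w" if "0 \<le> s" "s \<le> 1" "c s \<bullet> d = v" for s
    proof -
      have "c s \<in> closed_segment a b" using mem[of s] that ab(2) by simp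
      then obtain \<xi> where \<xi>: "c s = (1 - \<xi>) *\<^sub>R a + \<xi> *\<^sub>R b" by (auto simp: in_segment)
      have "c s \<bullet> d = a \<bullet> d + \<xi> * l" unfolding \<xi> by (simp add: l_def inner_add_left algebra_simps)
      then have "a \<bullet> d + \<xi> * l = v" using that by simp
      then have "\<xi> = \<omega>" using \<open>l \<noteq> 0\<close> by (simp add: \<omega>_def field_simps)
      then show ?thesis using \<xi> by (simp add: w_def)
    qed
    have "\<omega> * l = v - a \<bullet> d" using \<open>l \<noteq> 0\<close> by (simp add: \<omega>_def)
    with r q have "\<rho> * l < \<omega> * l" "\<omega> * l < \<eta> * l" by auto
    then have "0 < \<omega>" "\<omega> < 1" using \<rho> \<eta> by (auto simp: mult_less_cancel_right)
    then have "w \<in> open_segment a b" using ab by (auto simp: in_segment w_def)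
    then have card2: "card {t \<in> {0..<1}. c t = w} = 2" using card by blast
    then have "finite {t \<in> {0..<1}. c t = w}" by (intro card_ge_0_finite) simp
    moreover have "{t1, t2, t3} \<subseteq> {t \<in> {0..<1}. c t = w}" using eq[of t1] eq[of t2] eq[of t3] t t' by auto
    ultimately have "card {t1, t2, t3} \<le> 2" using card2 card_mono by metis
    then show False using t by simp
  qed
qed

lemma convex_on_compact_level:
  assumes z: "convex_on_compact a b z" and ab: "a < b" and d: "d = 1 \<or> d = \<i>"
    and v: "v \<noteq> z a \<bullet> d" and rq: "r \<in> {a..b}" "q \<in> {a..b}" "z r \<bullet> d < v" "v < z q \<bullet> d"
    and t: "a < t1" "t1 < t2" "t2 < t3" "t3 < b" "z t1 \<bullet> d = v" "z t2 \<bullet> d = v" "z t3 \<bullet> d = v"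
  shows False
proof -
  \<comment> \<open>\<open>\<kappa>\<close> is the share of the unit interval spent on
    \<open>z\<close>: all of it if the curve is closed, the first half if a closing chord is
    appended.\<close>
  obtain c \<kappa> where c: "convex_closed_curve c" "0 < \<kappa>" "\<kappa> \<le> 1"
    and cz: "\<And>s. s \<in> {a..b} \<Longrightarrow> c (\<kappa> * ((s - a) / (b - a))) = z s"
  proof (cases "z a = z b")
    case True
    have "subpath a b z (1 * ((s - a) / (b - a))) = z s" for s using ab by (simp add: subpath_def)
    then show thesis using z True by (intro that[of "subpath a b z" 1]) (auto simp: convex_on_compact_def)
  next
    case False
    have "(subpath a b z +++ linepath (z b) (z a)) (1 / 2 * ((s - a) / (b - a))) = z s" if "s \<in> {a..b}" for s
    proof -
      define x where "x = (s - a) / (b - a)"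
      have "x \<le> 1" "(b - a) * x + a = s" using that ab by (auto simp: x_def)
      then have "(subpath a b z +++ linepath (z b) (z a)) (1 / 2 * x) = z s"
        by (simp add: joinpaths_def subpath_def)
      then show ?thesis by (simp only: x_def)
    qed
    then show thesis using z False
      by (intro that[of "subpath a b z +++ linepath (z b) (z a)" "1 / 2"]) (auto simp: convex_on_compact_def)
  qed
  define k where "k s = \<kappa> * ((s - a) / (b - a))" for s
  have k01: "0 \<le> k s" "k s \<le> 1" if "s \<in> {a..b}" for s
  proof -
    have "0 \<le> (s - a) / (b - a)" "(s - a) / (b - a) \<le> 1" using that ab by auto
    then show "0 \<le> k s" "k s \<le> 1" unfolding k_def using c(2,3) mult_le_one[of \<kappa> "(s - a) / (b - a)"] mult_nonneg_nonneg[of \<kappa> "(s - a) / (b - a)"] by linarith+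
  qed
  have kmono: "k s < k s'" if "s < s'" for s s'
    using that ab c by (auto simp: k_def intro!: mult_strict_left_mono divide_strict_right_mono)
  have cz': "s \<in> {a..b} \<Longrightarrow> c (k s) = z s" for s using cz by (simp add: k_def)
  have "c 0 = z a" using cz'[of a] ab by (simp add: k_def)
  then show False
    using convex_closed_curve_level[OF c(1) d, of v "k r" "k q" "k t1" "k t2" "k t3"] v rq t k01 kmono cz'
    by auto
qed

lemma convex_on_compact_three_pieces:
  assumes z: "convex_on_compact a b z" and cont: "continuous_on {a..b} z" and d: "d = 1 \<or> d = \<i>"
  obtains p q where "a \<le> p" "p \<le> q" "q \<le> b"
    "monot_on {a..p} (\<lambda>s. z s \<bullet> d)" "monot_on {p..q} (\<lambda>s. z s \<bullet> d)" "monot_on {q..b} (\<lambda>s. z s \<bullet> d)"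
proof -
  have "a \<le> b" using z by (simp add: convex_on_compact_def)
  then show thesis
  proof (rule three_pieces[where g = "\<lambda>s. z s \<bullet> d" and v = "z a \<bullet> d"])
    show "continuous_on {a..b} (\<lambda>s. z s \<bullet> d)" by (intro continuous_intros cont)
  next
    fix c r t1 t2 t3 t
    assume "c \<noteq> z a \<bullet> d" "r \<in> {a..b}" "t \<in> {a..b}" "z r \<bullet> d < c" "c < z t \<bullet> d"
      "a < t1" "t1 < t2" "t2 < t3" "t3 < b" "z t1 \<bullet> d = c" "z t2 \<bullet> d = c" "z t3 \<bullet> d = c"
    then show False using convex_on_compact_level[OF z _ d, of c r t t1 t2 t3] by auto
  qed (use that in blast)
qed

subsection \<open>Interpolation between exponents one and two\<close>

text \<open>The analytic family of Riesz--Thorin: \<open>v\<close> keeps its argument, and its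
  modulus is raised to a power affine in \<open>w\<close>. The modulus becomes
  \<open>norm v powr p\<close> for \<open>Re w = 0\<close> and \<open>norm v powr (p / 2)\<close>
  for \<open>Re w = 1\<close>, so a function with unit \<open>p\<close>-norm is carried to unit
  vectors of L1 and of L2.\<close>

definition power_family :: "real \<Rightarrow> complex \<Rightarrow> complex \<Rightarrow> complex" where
  "power_family p w v = (if v = 0 then 0 else sgn v * exp (of_real (p * ln (norm v)) * (1 - w / 2)))"

lemma norm_power_family: "norm (power_family p w v) = norm v powr (p * (1 - Re w / 2))"
  by (auto simp: power_family_def norm_mult norm_sgn norm_exp_eq_Re powr_def mult_ac)

lemma power_family_0[simp]: "power_family p w 0 = 0"
  by (simp add: power_family_def)

lemma power_family_id: assumes "p * (1 - \<theta> / 2) = 1" shows "power_family p (of_real \<theta>) v = v"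
proof (cases "v = 0")
  case False
  have "of_real (p * ln (norm v)) * (1 - of_real \<theta> / 2) = (of_real (p * (1 - \<theta> / 2) * ln (norm v)) :: complex)"
    by simp
  also have "\<dots> = of_real (ln (norm v))" using assms by simp
  finally have "power_family p (of_real \<theta>) v = sgn v * exp (of_real (ln (norm v)))"
    using False by (simp only: power_family_def if_False)
  also have "\<dots> = sgn v * of_real (norm v)" using False by (simp add: exp_of_real)
  finally show ?thesis by (simp add: sgn_eq)
qed simp

lemma power_family_holomorphic: "(\<lambda>w. power_family p w v) holomorphic_on UNIV"
  unfolding power_family_def by (cases "v = 0") (auto intro!: holomorphic_intros)

lemma norm_power_family_le:
  assumes "0 \<le> p" "0 \<le> Re w" "Re w \<le> 1" shows "norm (power_family p w v) \<le> max 1 (norm v) powr p"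
proof -
  have "norm v powr (p * (1 - Re w / 2)) \<le> max 1 (norm v) powr (p * (1 - Re w / 2))"
    using assms by (intro powr_mono2) auto
  also have "\<dots> \<le> max 1 (norm v) powr p" using assms by (intro powr_mono mult_left_le) auto
  finally show ?thesis by (simp add: norm_power_family)
qed

text \<open>The bound 1 on the kernel gives the L1 to L-infinity endpoint with constant 1.
  Finiteness of both measures makes every simple function integrable.\<close>

locale bounded_kernel = \<mu>: finite_measure \<mu> + \<nu>: finite_measure \<nu>
  for \<mu> :: "'a measure" and \<nu> :: "'b measure" +
  fixes \<kappa> :: "'b \<Rightarrow> 'a \<Rightarrow> complex"
  assumes \<kappa>_meas[measurable]: "case_prod \<kappa> \<in> borel_measurable (\<nu> \<Otimes>\<^sub>M \<mu>)"
    and \<kappa>_le: "\<And>s t. s \<in> space \<nu> \<Longrightarrow> t \<in> space \<mu> \<Longrightarrow> norm (\<kappa> s t) \<le> 1"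
begin

definition T :: "('a \<Rightarrow> complex) \<Rightarrow> 'b \<Rightarrow> complex" where
  "T f s = (LINT t|\<mu>. f t * \<kappa> s t)"

lemma simple_comp_integrable:
  fixes f :: "'c \<Rightarrow> complex" and \<phi> :: "complex \<Rightarrow> 'd :: {banach, second_countable_topology}"
  assumes "finite_measure M" "simple_function M f"
  shows "integrable M (\<lambda>x. \<phi> (f x))"
proof -
  interpret finite_measure M by fact
  have s: "simple_function M (\<lambda>x. \<phi> (f x))" using simple_function_compose2[OF assms(2) assms(2), of "\<lambda>v _. \<phi> v"] by simp
  have fin: "finite ((\<lambda>x. \<phi> (f x)) ` space M)" using s by (rule simple_functionD)
  show ?thesis
    by (rule integrable_const_bound[of _ "\<Sum>v\<in>(\<lambda>x. \<phi> (f x)) ` space M. norm v"])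
      (auto intro!: AE_I2 member_le_sum[of _ _ norm, OF _ _ fin] borel_measurable_simple_function s)
qed

lemma simple_powr_integrable:
  fixes f :: "'c \<Rightarrow> complex"
  assumes "finite_measure M" "simple_function M f" shows "integrable M (\<lambda>x. norm (f x) powr p)"
  using simple_comp_integrable[OF assms, of "\<lambda>v. norm v powr p"] .

lemma \<kappa>_meas_sect[measurable]: "s \<in> space \<nu> \<Longrightarrow> \<kappa> s \<in> borel_measurable \<mu>"
  using measurable_compose[OF measurable_Pair1' \<kappa>_meas] by simp

lemma norm_T_le:
  assumes "integrable \<mu> f" "s \<in> space \<nu>" shows "norm (T f s) \<le> (LINT t|\<mu>. norm (f t))"
proof -
  have "norm (T f s) \<le> (LINT t|\<mu>. norm (f t * \<kappa> s t))" unfolding T_def by (rule integral_norm_bound)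
  also have "\<dots> \<le> (LINT t|\<mu>. norm (f t))"
    using \<kappa>_le[OF assms(2)] assms(1)
    by (intro integral_mono_AE') (auto intro!: AE_I2 simp: norm_mult mult_left_le)
  finally show ?thesis .
qed

lemma T_meas[measurable]: "f \<in> borel_measurable \<mu> \<Longrightarrow> T f \<in> borel_measurable \<nu>"
  unfolding T_def
proof (rule \<mu>.borel_measurable_lebesgue_integral)
  assume f: "f \<in> borel_measurable \<mu>"
  then show "(\<lambda>(s, t). f t * \<kappa> s t) \<in> borel_measurable (\<nu> \<Otimes>\<^sub>M \<mu>)"
    using measurable_compose[OF measurable_snd f, of \<nu>] \<kappa>_meas
    by (simp add: split_beta')
qed

lemma simple_expand:
  fixes f :: "'c \<Rightarrow> complex" and \<phi> :: "complex \<Rightarrow> complex"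
  assumes "finite_measure M" "simple_function M f" and h: "h \<in> borel_measurable M" "\<And>x. x \<in> space M \<Longrightarrow> norm (h x) \<le> b"
  shows "(LINT x|M. \<phi> (f x) * h x) = (\<Sum>v\<in>f ` space M. \<phi> v * (LINT x|M. indicator (f -` {v} \<inter> space M) x * h x))"
proof -
  interpret finite_measure M by fact
  have fin: "finite (f ` space M)" using assms(2) by (rule simple_functionD)
  have sets: "f -` {v} \<inter> space M \<in> sets M" for v using assms(2) by (rule simple_functionD)
  let ?I = "\<lambda>v x. indicator (f -` {v} \<inter> space M) x * h x"
  have int: "integrable M (\<lambda>x. ?I v x)" for v
  proof (rule integrable_const_bound[of _ b])
    show "AE x in M. norm (?I v x) \<le> b"
      using h(2) by (intro AE_I2) (auto simp: indicator_def norm_mult intro: order.trans[OF norm_ge_zero])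
    show "(\<lambda>x. ?I v x) \<in> borel_measurable M"
      using h(1) sets by (intro borel_measurable_times borel_measurable_indicator)
  qed
  have "(LINT x|M. \<phi> (f x) * h x) = (LINT x|M. (\<Sum>v\<in>f ` space M. \<phi> v * (?I v x)))"
  proof (rule Bochner_Integration.integral_cong[OF refl])
    fix x assume x: "x \<in> space M"
    have "(\<Sum>v\<in>f ` space M. \<phi> v * (?I v x)) = (\<Sum>v\<in>f ` space M. if v = f x then \<phi> v * h x else 0)"
      using x by (intro sum.cong) (auto simp: indicator_def)
    also have "\<dots> = \<phi> (f x) * h x" using fin x by (subst sum.delta) auto
    finally show "\<phi> (f x) * h x = (\<Sum>v\<in>f ` space M. \<phi> v * (?I v x))" by simp
  qed
  also have "\<dots> = (\<Sum>v\<in>f ` space M. \<phi> v * (LINT x|M. ?I v x))"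
    using int by (simp add: Bochner_Integration.integral_sum)
  finally show ?thesis .
qed

text \<open>The coefficients \<open>c\<close> depend on the level sets of \<open>f\<close> and
  \<open>g\<close> only, not on \<open>\<phi>\<close> and \<open>\<psi>\<close>. Inserting
  \<open>power_family p w\<close> for both therefore gives a finite sum of entire functions of
  \<open>w\<close>.\<close>

lemma bilinear_expand:
  fixes f :: "'a \<Rightarrow> complex" and g :: "'b \<Rightarrow> complex"
  assumes f: "simple_function \<mu> f" and g: "simple_function \<nu> g"
  obtains c where "\<And>\<phi> \<psi>. (LINT s|\<nu>. \<psi> (g s) * T (\<lambda>t. \<phi> (f t)) s) = (\<Sum>u\<in>g ` space \<nu>. \<Sum>v\<in>f ` space \<mu>. \<psi> u * \<phi> v * c u v)"
proof -
  define Iv where "Iv v t = (indicator (f -` {v} \<inter> space \<mu>) t :: complex)" for v t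
  have Iv_int: "integrable \<mu> (Iv v)" for v 
    unfolding Iv_def using simple_functionD(2)[OF f, of "{v}"] by (intro \<mu>.integrable_const_bound[of _ 1]) (auto simp: indicator_def intro!: borel_measurable_indicator)
  have Iv_meas[measurable]: "Iv v \<in> borel_measurable \<mu>" for v using borel_measurable_integrable[OF Iv_int] .
  have TIv: "norm (T (Iv v) s) \<le> (LINT t|\<mu>. norm (Iv v t))" if "s \<in> space \<nu>" for v s
    by (rule norm_T_le[OF Iv_int that])
  define Iu where "Iu u s = (indicator (g -` {u} \<inter> space \<nu>) s :: complex)" for u s
  have Iu_int: "integrable \<nu> (Iu u)" for u 
    unfolding Iu_def using simple_functionD(2)[OF g, of "{u}"] by (intro \<nu>.integrable_const_bound[of _ 1]) (auto simp: indicator_def intro!: borel_measurable_indicator)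
  define c where "c u v = (LINT s|\<nu>. Iu u s * T (Iv v) s)" for u v
  show thesis
  proof (rule that[of c])
    fix \<phi> \<psi> :: "complex \<Rightarrow> complex"
    have T\<phi>: "T (\<lambda>t. \<phi> (f t)) s = (\<Sum>v\<in>f ` space \<mu>. \<phi> v * T (Iv v) s)" if "s \<in> space \<nu>" for s
      unfolding T_def Iv_def using that \<kappa>_le
      by (intro simple_expand[OF \<mu>.finite_measure_axioms f, where b = 1]) measurable
    have bd: "norm (T (\<lambda>t. \<phi> (f t)) s) \<le> (LINT t|\<mu>. norm (\<phi> (f t)))" if "s \<in> space \<nu>" for s
      by (rule norm_T_le[OF simple_comp_integrable[OF \<mu>.finite_measure_axioms f] that])
    have T\<phi>_meas: "T (\<lambda>t. \<phi> (f t)) \<in> borel_measurable \<nu>"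
      by (intro T_meas borel_measurable_integrable simple_comp_integrable[OF \<mu>.finite_measure_axioms f])
    have "(LINT s|\<nu>. \<psi> (g s) * T (\<lambda>t. \<phi> (f t)) s) = (\<Sum>u\<in>g ` space \<nu>. \<psi> u * (LINT s|\<nu>. Iu u s * T (\<lambda>t. \<phi> (f t)) s))"
      unfolding Iu_def by (rule simple_expand[OF \<nu>.finite_measure_axioms g T\<phi>_meas bd])
    also have "\<dots> = (\<Sum>u\<in>g ` space \<nu>. \<psi> u * (\<Sum>v\<in>f ` space \<mu>. \<phi> v * c u v))"
    proof (intro sum.cong refl arg_cong2[where f = "(*)"])
      fix u
      have int: "integrable \<nu> (\<lambda>s. Iu u s * T (Iv v) s)" for v
      proof (rule Bochner_Integration.integrable_bound)
        show "integrable \<nu> (\<lambda>s. (LINT t|\<mu>. norm (Iv v t)) * norm (Iu u s))" using Iu_int by simp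
        show "(\<lambda>s. Iu u s * T (Iv v) s) \<in> borel_measurable \<nu>" using Iu_int by measurable
        show "AE s in \<nu>. norm (Iu u s * T (Iv v) s) \<le> norm ((LINT t|\<mu>. norm (Iv v t)) * norm (Iu u s))"
          using TIv by (intro AE_I2) (auto simp: norm_mult mult.commute[of "norm (Iu u _)"] intro!: mult_right_mono intro: order.trans[OF _ abs_ge_self])
      qed
      have "(LINT s|\<nu>. Iu u s * T (\<lambda>t. \<phi> (f t)) s) = (LINT s|\<nu>. (\<Sum>v\<in>f ` space \<mu>. \<phi> v * (Iu u s * T (Iv v) s)))"
        by (intro Bochner_Integration.integral_cong) (auto simp: T\<phi> sum_distrib_left mult_ac)
      also have "\<dots> = (\<Sum>v\<in>f ` space \<mu>. \<phi> v * c u v)"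
        using int by (simp add: Bochner_Integration.integral_sum c_def)
      finally show "(LINT s|\<nu>. Iu u s * T (\<lambda>t. \<phi> (f t)) s) = (\<Sum>v\<in>f ` space \<mu>. \<phi> v * c u v)" .
    qed
    finally show "(LINT s|\<nu>. \<psi> (g s) * T (\<lambda>t. \<phi> (f t)) s) = (\<Sum>u\<in>g ` space \<nu>. \<Sum>v\<in>f ` space \<mu>. \<psi> u * \<phi> v * c u v)"
      by (simp add: sum_distrib_left mult.assoc)
  qed
qed

end

locale L2_bounded_kernel = bounded_kernel +
  fixes C :: real
  assumes C: "0 < C"
    and L2: "\<And>f. simple_function \<mu> f \<Longrightarrow> (LINT s|\<nu>. (norm (T f s))\<^sup>2) \<le> C * (LINT t|\<mu>. (norm (f t))\<^sup>2)"
begin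

text \<open>Three lines for the pairing of the two analytic families: on the left edge the L1 norms
  and the kernel bound give 1, on the right edge the L2 bound gives \<open>sqrt C\<close>. The value
  \<open>\<theta> = 2 * (1 - 1 / p)\<close> restores \<open>f\<close> and \<open>g\<close>, and
  \<open>sqrt C powr \<theta>\<close> is the asserted constant.\<close>

lemma bilinear_bound_normalized:
  assumes f: "simple_function \<mu> f" and g: "simple_function \<nu> g" and p: "1 < p" "p \<le> 2"
    and nf: "(LINT t|\<mu>. norm (f t) powr p) = 1" and ng: "(LINT s|\<nu>. norm (g s) powr p) = 1"
  shows "norm (LINT s|\<nu>. g s * T f s) \<le> C powr (1 - 1 / p)"
proof -
  define \<theta> where "\<theta> = 2 * (1 - 1 / p)"
  have \<theta>: "0 \<le> \<theta>" "\<theta> \<le> 1" "p * (1 - \<theta> / 2) = 1"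
  proof -
    define r where "r = 1 / p"
    have r: "1 / 2 \<le> r" "r \<le> 1" "p * r = 1" and "\<theta> = 2 * (1 - r)" using p by (simp_all add: r_def \<theta>_def)
    then show "0 \<le> \<theta>" "\<theta> \<le> 1" by simp_all
    have "1 - \<theta> / 2 = r" using \<open>\<theta> = 2 * (1 - r)\<close> by (simp add: diff_divide_distrib)
    then show "p * (1 - \<theta> / 2) = 1" using r by simp
  qed
  obtain c where c: "\<And>\<phi> \<psi>. (LINT s|\<nu>. \<psi> (g s) * T (\<lambda>t. \<phi> (f t)) s) = (\<Sum>u\<in>g ` space \<nu>. \<Sum>v\<in>f ` space \<mu>. \<psi> u * \<phi> v * c u v)"
    using that by (rule bilinear_expand[OF f g])
  let ?T = "\<lambda>w. T (\<lambda>t. power_family p w (f t))"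
  define \<Phi> where "\<Phi> w = (\<Sum>u\<in>g ` space \<nu>. \<Sum>v\<in>f ` space \<mu>. power_family p w u * power_family p w v * c u v)" for w
  have \<Phi>: "\<Phi> w = (LINT s|\<nu>. power_family p w (g s) * ?T w s)" for w
    unfolding \<Phi>_def by (rule c[symmetric])
  have int_g: "integrable \<nu> (\<lambda>s. \<phi> (g s))" for \<phi> :: "complex \<Rightarrow> 'd :: {banach, second_countable_topology}"
    by (rule simple_comp_integrable[OF \<nu>.finite_measure_axioms g])
  have int_f: "integrable \<mu> (\<lambda>t. \<phi> (f t))" for \<phi> :: "complex \<Rightarrow> 'd :: {banach, second_countable_topology}"
    by (rule simple_comp_integrable[OF \<mu>.finite_measure_axioms f])
  have left: "norm (\<Phi> w) \<le> 1" if w: "Re w = 0" for w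
  proof -
    have n: "norm (power_family p w v) = norm v powr p" for v using w by (simp add: norm_power_family)
    have T1: "norm (?T w s) \<le> 1" if "s \<in> space \<nu>" for s
      using norm_T_le[OF int_f that, of "power_family p w"] nf by (simp add: n)
    have "norm (\<Phi> w) \<le> (LINT s|\<nu>. norm (power_family p w (g s) * ?T w s))"
      unfolding \<Phi> by (rule integral_norm_bound)
    also have "\<dots> \<le> (LINT s|\<nu>. norm (g s) powr p)"
    proof (rule integral_mono_AE')
      show "integrable \<nu> (\<lambda>s. norm (g s) powr p)" by (rule int_g)
      show "AE s in \<nu>. norm (power_family p w (g s) * ?T w s) \<le> norm (g s) powr p"
        using T1 by (intro AE_I2) (simp add: norm_mult n mult_left_le)
    qed auto
    finally show ?thesis using ng by simp
  qed
  have right: "norm (\<Phi> w) \<le> sqrt C" if w: "Re w = 1" for w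
  proof -
    have n: "(norm (power_family p w v))\<^sup>2 = norm v powr p" for v
      using w by (simp add: norm_power_family power2_eq_square powr_add[symmetric])
    define a where "a s = norm (power_family p w (g s))" for s
    define b where "b s = norm (?T w s)" for s
    have a2: "(LINT s|\<nu>. (a s)\<^sup>2) = 1" using ng by (simp add: a_def n)
    have "simple_function \<mu> (\<lambda>t. power_family p w (f t))"
      using simple_function_compose2[OF f f, of "\<lambda>v _. power_family p w v"] by simp
    from L2[OF this] have b2: "(LINT s|\<nu>. (b s)\<^sup>2) \<le> C" using nf by (simp add: b_def n)
    have int_a2: "integrable \<nu> (\<lambda>s. (a s)\<^sup>2)" unfolding a_def by (rule int_g)
    have b_meas: "b \<in> borel_measurable \<nu>"
      unfolding b_def by (rule measurable_compose[OF T_meas[OF borel_measurable_integrable[OF int_f]] borel_measurable_norm])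
    have int_b2: "integrable \<nu> (\<lambda>s. (b s)\<^sup>2)"
    proof (rule \<nu>.integrable_const_bound)
      show "(\<lambda>s. (b s)\<^sup>2) \<in> borel_measurable \<nu>" by (intro borel_measurable_power b_meas)
      have "b s \<le> (LINT t|\<mu>. norm (power_family p w (f t)))" if "s \<in> space \<nu>" for s
        unfolding b_def by (rule norm_T_le[OF int_f that])
      then show "AE s in \<nu>. norm ((b s)\<^sup>2) \<le> (LINT t|\<mu>. norm (power_family p w (f t)))\<^sup>2"
        by (intro AE_I2) (auto simp: b_def intro: power_mono)
    qed
    have sC: "0 < sqrt C" using C by simp
    have "norm (\<Phi> w) \<le> (LINT s|\<nu>. norm (power_family p w (g s) * ?T w s))"
      unfolding \<Phi> by (rule integral_norm_bound)
    \<comment> \<open>AM-GM in place of Cauchy--Schwarz, with weights balanced for the integral 1 of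
      \<open>a\<^sup>2\<close> and the bound \<open>C\<close> on the integral of
      \<open>b\<^sup>2\<close>.\<close>
    also have "\<dots> \<le> (LINT s|\<nu>. sqrt C / 2 * (a s)\<^sup>2 + 1 / (2 * sqrt C) * (b s)\<^sup>2)"
    proof (rule integral_mono_AE')
      show "integrable \<nu> (\<lambda>s. sqrt C / 2 * (a s)\<^sup>2 + 1 / (2 * sqrt C) * (b s)\<^sup>2)"
        using int_a2 int_b2 by (intro Bochner_Integration.integrable_add integrable_mult_right)
      have "a s * b s \<le> sqrt C / 2 * (a s)\<^sup>2 + 1 / (2 * sqrt C) * (b s)\<^sup>2" for s
      proof -
        have "0 \<le> (sqrt C * a s - b s)\<^sup>2" by simp
        then have "2 * sqrt C * (a s * b s) \<le> 2 * sqrt C * (sqrt C / 2 * (a s)\<^sup>2 + 1 / (2 * sqrt C) * (b s)\<^sup>2)"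
          using sC by (simp add: power2_eq_square algebra_simps)
        then show ?thesis using sC by (rule_tac mult_left_le_imp_le[of "2 * sqrt C"]) auto
      qed
      then show "AE s in \<nu>. norm (power_family p w (g s) * ?T w s) \<le> sqrt C / 2 * (a s)\<^sup>2 + 1 / (2 * sqrt C) * (b s)\<^sup>2"
        by (simp add: norm_mult a_def b_def)
    qed (use sC in auto)
    also have "\<dots> = sqrt C / 2 * (LINT s|\<nu>. (a s)\<^sup>2) + 1 / (2 * sqrt C) * (LINT s|\<nu>. (b s)\<^sup>2)"
      using int_a2 int_b2 by simp
    also have "\<dots> \<le> sqrt C / 2 * 1 + 1 / (2 * sqrt C) * C"
      using a2 b2 sC by (intro add_mono mult_left_mono) auto
    also have "\<dots> = sqrt C" using C real_div_sqrt[of C] by simp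
    finally show ?thesis .
  qed
  have "norm (\<Phi> (of_real \<theta>)) \<le> sqrt C powr \<theta>"
  proof (rule three_lines[OF _ _ _ left right \<theta>(1,2)])
    show "\<Phi> holomorphic_on UNIV"
      unfolding \<Phi>_def by (intro holomorphic_intros power_family_holomorphic)
    show "0 < sqrt C" using C by simp
    fix w :: complex assume w: "0 \<le> Re w" "Re w \<le> 1"
    show "norm (\<Phi> w) \<le> (\<Sum>u\<in>g ` space \<nu>. \<Sum>v\<in>f ` space \<mu>. max 1 (norm u) powr p * max 1 (norm v) powr p * norm (c u v))"
      unfolding \<Phi>_def using p w
      by (intro sum_norm_le) (auto intro!: sum_norm_le mult_right_mono mult_mono norm_power_family_le simp: norm_mult)
  qed
  moreover have "\<Phi> (of_real \<theta>) = (LINT s|\<nu>. g s * T f s)"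
    unfolding \<Phi> by (simp add: power_family_id[OF \<theta>(3)])
  moreover have "sqrt C powr \<theta> = C powr (1 - 1 / p)"
    using C by (simp add: powr_half_sqrt[symmetric] powr_powr \<theta>_def diff_divide_distrib)
  ultimately show ?thesis by simp
qed

lemma powr_scale_integral:
  fixes f :: "'c \<Rightarrow> complex" assumes "0 < a"
  shows "(LINT x|M. norm (of_real a * f x) powr p) = a powr p * (LINT x|M. norm (f x) powr p)"
  using assms by (simp add: norm_mult powr_mult)

lemma normalizing_factor:
  fixes G p :: real
  assumes "0 < G" "1 < p"
  obtains a where "0 < a" "a powr p = 1 / G" "\<And>q. 1 / a powr q = G powr (q / p)"
proof (rule that[of "G powr (- 1 / p)"])
  have *: "(G powr (- 1 / p)) powr q = G powr (- (q / p))" for q by (simp only: powr_powr) simp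
  show "(G powr (- 1 / p)) powr p = 1 / G" using assms by (simp only: *) (simp add: powr_minus_divide)
  show "1 / (G powr (- 1 / p)) powr q = G powr (q / p)" for q
    using assms by (simp only: *) (simp add: powr_minus_divide)
qed (use assms in simp)

lemma bilinear_bound:
  assumes f: "simple_function \<mu> f" and g: "simple_function \<nu> g" and p: "1 < p" "p \<le> 2"
    and nf: "(LINT t|\<mu>. norm (f t) powr p) = 1"
  shows "norm (LINT s|\<nu>. g s * T f s) \<le> C powr (1 - 1 / p) * (LINT s|\<nu>. norm (g s) powr p) powr (1 / p)"
proof -
  define G where "G = (LINT s|\<nu>. norm (g s) powr p)"
  have "0 \<le> G" unfolding G_def by (intro integral_nonneg_AE) auto
  then consider "G = 0" | "0 < G" by linarith
  then show ?thesis
  proof cases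
    case 1
    then have "AE s in \<nu>. norm (g s) powr p = 0"
      unfolding G_def using integral_nonneg_eq_0_iff_AE[OF simple_powr_integrable[OF \<nu>.finite_measure_axioms g]] by simp
    then have "(LINT s|\<nu>. g s * T f s) = (LINT s|\<nu>. 0)"
      using borel_measurable_simple_function[OF g] borel_measurable_simple_function[OF f]
      by (intro integral_cong_AE) auto
    then show ?thesis by (simp add: G_def[symmetric])
  next
    case 2
    obtain a where a: "0 < a" "a powr p = 1 / G" "\<And>q. 1 / a powr q = G powr (q / p)"
      using that by (rule normalizing_factor[OF 2 p(1)])
    have "simple_function \<nu> (\<lambda>s. of_real a * g s)"
      using simple_function_compose2[OF g g, of "\<lambda>v _. of_real a * v"] by simp
    moreover have "(LINT s|\<nu>. norm (of_real a * g s) powr p) = 1"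
      by (subst powr_scale_integral[OF a(1)]) (use a(2) 2 in \<open>simp add: G_def[symmetric]\<close>)
    ultimately have "norm (LINT s|\<nu>. of_real a * g s * T f s) \<le> C powr (1 - 1 / p)"
      by (intro bilinear_bound_normalized f p nf)
    then have "a * norm (LINT s|\<nu>. g s * T f s) \<le> C powr (1 - 1 / p)"
      using a(1) by (simp add: mult.assoc norm_mult)
    then have "norm (LINT s|\<nu>. g s * T f s) \<le> C powr (1 - 1 / p) * (1 / a)"
      using a(1) by (simp add: field_simps)
    also have "1 / a = G powr (1 / p)" using a(3)[of 1] a(1) by simp
    finally show ?thesis by (simp add: G_def)
  qed
qed

text \<open>Duality with the extremal test function \<open>h\<close>: it satisfies
  \<open>h * T f = \<bar>T f\<bar> powr q\<close> and
  \<open>\<bar>h\<bar> powr p = \<bar>T f\<bar> powr q\<close>. The bilinear bound becomes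
  \<open>X \<le> C powr (1 / q) * X powr (1 / p)\<close>, and dividing by the power of
  \<open>X\<close> leaves \<open>X \<le> C\<close>.\<close>

lemma Lp_bound_normalized:
  assumes f: "simple_function \<mu> f" and p: "1 < p" "p \<le> 2" and q: "q = p / (p - 1)"
    and nf: "(LINT t|\<mu>. norm (f t) powr p) = 1"
  shows "(LINT s|\<nu>. norm (T f s) powr q) \<le> C"
proof -
  have pq: "1 < q" "(q - 1) * p = q" "1 - 1 / p = 1 / q" using p by (auto simp: q field_simps)
  define X where "X = (LINT s|\<nu>. norm (T f s) powr q)"
  have "0 \<le> X" unfolding X_def by (intro integral_nonneg_AE) auto
  have int_f: "integrable \<mu> f" using simple_comp_integrable[OF \<mu>.finite_measure_axioms f, of "\<lambda>v. v"] .
  define b where "b = (LINT t|\<mu>. norm (f t))"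
  have Tb: "norm (T f s) \<le> b" if "s \<in> space \<nu>" for s unfolding b_def by (rule norm_T_le[OF int_f that])
  have b0: "0 \<le> b" unfolding b_def by (intro integral_nonneg_AE) auto
  have [measurable]: "T f \<in> borel_measurable \<nu>" using int_f by (intro T_meas) auto
  define h where "h s = cnj (sgn (T f s)) * of_real (norm (T f s) powr (q - 1))" for s
  have h_meas: "h \<in> borel_measurable \<nu>" 
  proof -
    have "(\<lambda>s. of_real (norm (T f s) powr (q - 1)) :: complex) \<in> borel_measurable \<nu>"
      using powr_real_measurable[of "\<lambda>s. norm (T f s)" \<nu> "\<lambda>s. q - 1"] by auto
    moreover have "(\<lambda>s. cnj (sgn (T f s))) \<in> borel_measurable \<nu>"
      unfolding sgn_div_norm by (intro borel_measurable_cnj borel_measurable_scaleR borel_measurable_inverse borel_measurable_norm) auto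
    ultimately show ?thesis unfolding h_def by (rule borel_measurable_times[rotated])
  qed
  have hT: "h s * T f s = of_real (norm (T f s) powr q)" for s
  proof (cases "T f s = 0")
    case False
    have "cnj (sgn (T f s)) * T f s = of_real (norm (T f s))"
      using complex_norm_square[of "T f s"] False by (simp add: sgn_eq power2_eq_square mult.commute divide_simps)
    then have "h s * T f s = of_real (norm (T f s) powr (q - 1) * norm (T f s))"
      unfolding h_def by (simp add: mult.commute mult.left_commute)
    also have "norm (T f s) powr (q - 1) * norm (T f s) = norm (T f s) powr q"
      using False powr_mult_base[of "norm (T f s)" "q - 1"] by (simp add: mult.commute)
    finally show ?thesis .
  qed (simp add: h_def)
  have nh: "norm (h s) = norm (T f s) powr (q - 1)" for s
    using pq(1) by (cases "T f s = 0") (auto simp: h_def norm_mult norm_sgn)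
  have nhp: "norm (h s) powr p = norm (T f s) powr q" for s
    by (simp add: nh powr_powr pq)
  \<comment> \<open>The bilinear bound covers simple functions only, whereas \<open>h\<close> need
    not be simple. Boundedness of \<open>h\<close> and \<open>T f\<close> makes both sides converge
    along the approximation.\<close>
  obtain g where g: "\<And>i. simple_function \<nu> (g i)" "\<And>s. s \<in> space \<nu> \<Longrightarrow> (\<lambda>i. g i s) \<longlonglongrightarrow> h s"
    "\<And>i s. s \<in> space \<nu> \<Longrightarrow> norm (g i s) \<le> 2 * norm (h s)"
    using borel_measurable_implies_sequence_metric[OF h_meas, of 0] unfolding dist_0_norm dist_commute[of _ 0] by blast
  have hb: "norm (h s) \<le> b powr (q - 1)" if "s \<in> space \<nu>" for s
    unfolding nh using Tb[OF that] pq by (intro powr_mono2) auto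
  have gb: "norm (g i s) \<le> 2 * b powr (q - 1)" if "s \<in> space \<nu>" for i s
    using g(3)[OF that, of i] hb[OF that] by linarith
  have g_meas[measurable]: "g i \<in> borel_measurable \<nu>" for i by (rule borel_measurable_simple_function[OF g(1)])
  have "(\<lambda>i. LINT s|\<nu>. g i s * T f s) \<longlonglongrightarrow> (LINT s|\<nu>. h s * T f s)"
  proof (rule integral_dominated_convergence[where w = "\<lambda>s. 2 * b powr (q - 1) * b"])
    show "AE s in \<nu>. (\<lambda>i. g i s * T f s) \<longlonglongrightarrow> h s * T f s"
      using g(2) by (intro AE_I2 tendsto_intros)
    fix i show "AE s in \<nu>. norm (g i s * T f s) \<le> 2 * b powr (q - 1) * b"
      using gb Tb b0 by (intro AE_I2) (auto simp: norm_mult intro!: mult_mono)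
  qed (use h_meas in auto)
  then have 1: "(\<lambda>i. norm (LINT s|\<nu>. g i s * T f s)) \<longlonglongrightarrow> norm (LINT s|\<nu>. h s * T f s)"
    by (rule tendsto_norm)
  have "(\<lambda>i. LINT s|\<nu>. norm (g i s) powr p) \<longlonglongrightarrow> (LINT s|\<nu>. norm (h s) powr p)"
  proof (rule integral_dominated_convergence[where w = "\<lambda>s. (2 * b powr (q - 1)) powr p"])
    show "AE s in \<nu>. (\<lambda>i. norm (g i s) powr p) \<longlonglongrightarrow> norm (h s) powr p"
      using g(2) p by (intro AE_I2 tendsto_powr' tendsto_norm tendsto_const) auto
    fix i show "AE s in \<nu>. norm (norm (g i s) powr p) \<le> (2 * b powr (q - 1)) powr p"
      using gb p by (intro AE_I2) (auto intro!: powr_mono2)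
  qed (use h_meas in auto)
  then have 2: "(\<lambda>i. C powr (1 / q) * (LINT s|\<nu>. norm (g i s) powr p) powr (1 / p)) \<longlonglongrightarrow> C powr (1 / q) * (LINT s|\<nu>. norm (h s) powr p) powr (1 / p)"
    using p by (intro tendsto_mult tendsto_const tendsto_powr') auto
  have "norm (LINT s|\<nu>. h s * T f s) \<le> C powr (1 / q) * (LINT s|\<nu>. norm (h s) powr p) powr (1 / p)"
    by (rule LIMSEQ_le[OF 1 2]) (use bilinear_bound[OF f g(1) p nf] in \<open>auto simp: pq\<close>)
  then have "X \<le> C powr (1 / q) * X powr (1 / p)"
    using \<open>0 \<le> X\<close> by (simp add: hT nhp X_def[symmetric])
  show "X \<le> C"
  proof (cases "X = 0")
    case False
    then have "0 < X" using \<open>0 \<le> X\<close> by simp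
    have "X powr (1 / q) * X powr (1 / p) = X" 
    proof -
      have "1 / q + 1 / p = 1" using pq(3) by linarith
      then show ?thesis using \<open>0 < X\<close> by (simp add: powr_add[symmetric])
    qed
    then have "X powr (1 / q) * X powr (1 / p) \<le> C powr (1 / q) * X powr (1 / p)"
      using \<open>X \<le> C powr (1 / q) * X powr (1 / p)\<close> by simp
    then have "X powr (1 / q) \<le> C powr (1 / q)" using \<open>0 < X\<close> by simp
    then have "(X powr (1 / q)) powr q \<le> (C powr (1 / q)) powr q" using pq by (auto intro: powr_mono2[of q "X powr (1 / q)" "C powr (1 / q)"])
    then show ?thesis using \<open>0 < X\<close> C pq by (simp add: powr_powr)
  qed (use C in simp)
qed

lemma Lp_bound:
  assumes f: "simple_function \<mu> f" and p: "1 < p" "p \<le> 2" and q: "q = p / (p - 1)"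
  shows "(LINT s|\<nu>. norm (T f s) powr q) \<le> C * (LINT t|\<mu>. norm (f t) powr p) powr (q / p)"
proof -
  define G where "G = (LINT t|\<mu>. norm (f t) powr p)"
  have "0 \<le> G" unfolding G_def by (intro integral_nonneg_AE) auto
  then consider "G = 0" | "0 < G" by linarith
  then show ?thesis
  proof cases
    case 1
    then have "AE t in \<mu>. norm (f t) powr p = 0"
      unfolding G_def using integral_nonneg_eq_0_iff_AE[OF simple_powr_integrable[OF \<mu>.finite_measure_axioms f]] by simp
    then have "T f s = 0" if "s \<in> space \<nu>" for s
      unfolding T_def using that borel_measurable_simple_function[OF f]
      by (subst integral_cong_AE[of _ _ "\<lambda>t. 0"]) auto
    then have "(LINT s|\<nu>. norm (T f s) powr q) = (LINT s|\<nu>. 0)"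
      by (intro Bochner_Integration.integral_cong) auto
    then show ?thesis by (simp add: G_def[symmetric] 1)
  next
    case 2
    obtain a where a: "0 < a" "a powr p = 1 / G" "\<And>q. 1 / a powr q = G powr (q / p)"
      using that by (rule normalizing_factor[OF 2 p(1)])
    have "simple_function \<mu> (\<lambda>t. of_real a * f t)"
      using simple_function_compose2[OF f f, of "\<lambda>v _. of_real a * v"] by simp
    moreover have "(LINT t|\<mu>. norm (of_real a * f t) powr p) = 1"
      by (subst powr_scale_integral[OF a(1)]) (use a(2) 2 in \<open>simp add: G_def[symmetric]\<close>)
    ultimately have "(LINT s|\<nu>. norm (T (\<lambda>t. of_real a * f t) s) powr q) \<le> C"
      by (rule Lp_bound_normalized[OF _ p q])
    moreover have "T (\<lambda>t. of_real a * f t) s = of_real a * T f s" for s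
      by (simp add: T_def mult.assoc)
    ultimately have "a powr q * (LINT s|\<nu>. norm (T f s) powr q) \<le> C"
      using powr_scale_integral[OF a(1), of \<nu> "T f" q] by (simp only:)
    then have "(LINT s|\<nu>. norm (T f s) powr q) \<le> C * (1 / a powr q)"
      using a(1) by (simp add: field_simps)
    also have "1 / a powr q = G powr (q / p)" by (rule a(3))
    finally show ?thesis by (simp add: G_def)
  qed
qed

end

subsection \<open>The Laplace transform along a curve\<close>

text \<open>The cuts \<open>p\<close> and \<open>q\<close> are clamped to \<open>{u..v}\<close> and
  pieces may degenerate to points. So the cuts for one coordinate can be used on any subinterval
  produced by the cuts for the other one.\<close>

lemma integral_three_pieces:
  fixes \<phi> :: "real \<Rightarrow> real"
  assumes int: "\<phi> integrable_on {u..v}" and "u \<le> v" "p \<le> q"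
    and K: "\<And>c d. u \<le> c \<Longrightarrow> c \<le> d \<Longrightarrow> d \<le> v \<Longrightarrow> d \<le> p \<or> p \<le> c \<and> d \<le> q \<or> q \<le> c \<Longrightarrow> integral {c..d} \<phi> \<le> K"
  shows "integral {u..v} \<phi> \<le> 3 * K"
proof -
  define p' q' where "p' = max u (min v p)" and "q' = max u (min v q)"
  have ord: "u \<le> p'" "p' \<le> q'" "q' \<le> v" using assms(2,3) by (auto simp: p'_def q'_def)
  have "integral {u..p'} \<phi> \<le> K" "integral {p'..q'} \<phi> \<le> K" "integral {q'..v} \<phi> \<le> K"
    by (rule K; use assms(2,3) in \<open>auto simp: p'_def q'_def max_def min_def split: if_splits\<close>)+
  moreover have "integral {u..p'} \<phi> + integral {p'..v} \<phi> = integral {u..v} \<phi>"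
    using ord int by (intro Henstock_Kurzweil_Integration.integral_combine) auto
  moreover have "integral {p'..q'} \<phi> + integral {q'..v} \<phi> = integral {p'..v} \<phi>"
    using ord int by (intro Henstock_Kurzweil_Integration.integral_combine) (auto intro: integrable_on_subinterval)
  ultimately show ?thesis by simp
qed

abbreviation halfline :: "real measure" where
  "halfline \<equiv> lebesgue_on {0<..}"

definition arclength_on :: "(real \<Rightarrow> complex) \<Rightarrow> real \<Rightarrow> real \<Rightarrow> bool" where
  "arclength_on z a b \<longleftrightarrow> (\<forall>s s'. a \<le> s \<longrightarrow> s \<le> s' \<longrightarrow> s' \<le> b \<longrightarrow> curve_length z s s' = ennreal (s' - s))"

lemma arclength_on_continuous: "arclength_on z a b \<Longrightarrow> continuous_on {a..b} z"
  by (rule lipschitz_continuous_on) (auto simp: arclength_on_def intro: curve_length_dist)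

context laplace_L2
begin

lemma L2_arclength_monotone:
  assumes "a \<le> b" and len: "arclength_on z a b" and pos: "\<And>s. s \<in> {a..b} \<Longrightarrow> 0 < Re (z s)"
    and mon: "monot_on {a..b} (\<lambda>s. Re (z s))" "monot_on {a..b} (\<lambda>s. Im (z s))"
  shows "integral {a..b} (\<lambda>s. (norm (F (z s)))\<^sup>2) \<le> 10 * pi * energy"
proof -
  obtain \<sigma> :: real where \<sigma>: "\<bar>\<sigma>\<bar> = 1" "\<And>s s'. a \<le> s \<Longrightarrow> s \<le> s' \<Longrightarrow> s' \<le> b \<Longrightarrow> 0 \<le> \<sigma> * (Re (z s') - Re (z s))"
    using monot_on_sign[OF mon(1)] by blast
  obtain \<tau> :: real where \<tau>: "\<bar>\<tau>\<bar> = 1" "\<And>s s'. a \<le> s \<Longrightarrow> s \<le> s' \<Longrightarrow> s' \<le> b \<Longrightarrow> 0 \<le> \<tau> * (Im (z s') - Im (z s))"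
    using monot_on_sign[OF mon(2)] by blast
  show ?thesis
  proof (rule L2_monotone_curve[where \<sigma> = \<sigma> and \<tau> = \<tau>])
    fix s s' assume s: "a \<le> s" "s \<le> s'" "s' \<le> b"
    then have l: "curve_length z s s' = ennreal (s' - s)" using len by (auto simp: arclength_on_def)
    show "norm (z s' - z s) \<le> s' - s" by (rule curve_length_dist[OF l s(2)])
    show "s' - s \<le> \<bar>Re (z s' - z s)\<bar> + \<bar>Im (z s' - z s)\<bar>"
      by (rule curve_length_monotone_le[OF l s(2) \<sigma>(1) \<tau>(1)]) (use \<sigma>(2) \<tau>(2) s in auto)
  qed (use assms(1) pos \<sigma> \<tau> in \<open>auto intro: less_imp_le\<close>)
qed

lemma L2_arclength_convex:
  assumes ab: "a \<le> b" and len: "arclength_on z a b" and pos: "\<And>s. s \<in> {a..b} \<Longrightarrow> 0 < Re (z s)"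
    and conv: "convex_on_compact a b z"
  shows "integral {a..b} (\<lambda>s. (norm (F (z s)))\<^sup>2) \<le> 90 * pi * energy"
proof -
  have contz: "continuous_on {a..b} z" by (rule arclength_on_continuous[OF len])
  have int: "(\<lambda>s. (norm (F (z s)))\<^sup>2) integrable_on {c..d}" if "a \<le> c" "d \<le> b" for c d
    using that by (intro integrable_continuous_real continuous_on_compose2[OF F_sq_continuous continuous_on_subset[OF contz]]) auto
  obtain p q where x: "a \<le> p" "p \<le> q" "q \<le> b" "monot_on {a..p} (\<lambda>s. z s \<bullet> 1)" "monot_on {p..q} (\<lambda>s. z s \<bullet> 1)" "monot_on {q..b} (\<lambda>s. z s \<bullet> 1)"
    using convex_on_compact_three_pieces[OF conv contz, of 1] by blast
  obtain p' q' where y: "a \<le> p'" "p' \<le> q'" "q' \<le> b" "monot_on {a..p'} (\<lambda>s. z s \<bullet> \<i>)" "monot_on {p'..q'} (\<lambda>s. z s \<bullet> \<i>)" "monot_on {q'..b} (\<lambda>s. z s \<bullet> \<i>)"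
    using convex_on_compact_three_pieces[OF conv contz, of \<i>] by blast
  have inner: "w \<bullet> 1 = Re w" "w \<bullet> \<i> = Im w" for w :: complex by (auto simp: inner_complex_def)
  have "integral {a..b} (\<lambda>s. (norm (F (z s)))\<^sup>2) \<le> 3 * (3 * (10 * pi * energy))"
  proof (rule integral_three_pieces[OF int ab x(2)])
    fix c d assume cd: "a \<le> c" "c \<le> d" "d \<le> b" "d \<le> p \<or> p \<le> c \<and> d \<le> q \<or> q \<le> c"
    then have mx: "monot_on {c..d} (\<lambda>s. Re (z s))"
    proof -
      have "{c..d} \<subseteq> {a..p} \<or> {c..d} \<subseteq> {p..q} \<or> {c..d} \<subseteq> {q..b}" using cd by auto
      then show ?thesis using x(4-6) monot_on_subset unfolding inner by blast
    qed
    show "integral {c..d} (\<lambda>s. (norm (F (z s)))\<^sup>2) \<le> 3 * (10 * pi * energy)"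
    proof (rule integral_three_pieces[OF int cd(2) y(2)])
      fix c' d' assume cd': "c \<le> c'" "c' \<le> d'" "d' \<le> d" "d' \<le> p' \<or> p' \<le> c' \<and> d' \<le> q' \<or> q' \<le> c'"
      then have my: "monot_on {c'..d'} (\<lambda>s. Im (z s))"
      proof -
        have "{c'..d'} \<subseteq> {a..p'} \<or> {c'..d'} \<subseteq> {p'..q'} \<or> {c'..d'} \<subseteq> {q'..b}" using cd cd' by auto
        then show ?thesis using y(4-6) monot_on_subset unfolding inner by blast
      qed
      show "integral {c'..d'} (\<lambda>s. (norm (F (z s)))\<^sup>2) \<le> 10 * pi * energy"
      proof (rule L2_arclength_monotone[OF cd'(2) _ _ _ my])
        show "arclength_on z c' d'" using len cd cd' by (auto simp: arclength_on_def)
        show "monot_on {c'..d'} (\<lambda>s. Re (z s))" by (rule monot_on_subset[OF mx]) (use cd' in auto)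
      qed (use pos cd cd' in auto)
    qed (use cd in auto)
  qed auto
  then show ?thesis by simp
qed

end

text \<open>The bound for exponent 2 with a constant uniform in the support interval and in the
  bound \<open>c\<close>, which is what the passage to the limit requires. The two kinds of curves
  enter the rest of the proof only through this estimate.\<close>

definition L2_bounded_on :: "(real \<Rightarrow> complex) \<Rightarrow> real set \<Rightarrow> real \<Rightarrow> bool" where
  "L2_bounded_on z S K \<longleftrightarrow> (\<forall>m M f c. 0 < m \<longrightarrow> m \<le> M \<longrightarrow> f \<in> borel_measurable (lebesgue_on {m..M}) \<longrightarrow>
     (\<forall>t\<in>{m..M}. norm (f t) \<le> c) \<longrightarrow>
     integral S (\<lambda>s. (norm (LINT t|lebesgue_on {m..M}. f t * exp (- z s * of_real t)))\<^sup>2)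
       \<le> K * (LINT t|lebesgue_on {m..M}. (norm (f t))\<^sup>2))"

lemma L2_bounded_onI:
  assumes "\<And>m M c f. laplace_L2 m M c f \<Longrightarrow>
    integral S (\<lambda>s. (norm (laplace_L2.F m M f (z s)))\<^sup>2) \<le> K * laplace_L2.energy m M f"
  shows "L2_bounded_on z S K"
  unfolding L2_bounded_on_def
proof (intro allI impI)
  fix m M c :: real and f :: "real \<Rightarrow> complex"
  assume "0 < m" "m \<le> M" "f \<in> borel_measurable (lebesgue_on {m..M})" "\<forall>t\<in>{m..M}. norm (f t) \<le> c"
  then interpret laplace_L2 m M c f by unfold_locales auto
  show "integral S (\<lambda>s. (norm (LINT t|lebesgue_on {m..M}. f t * exp (- z s * of_real t)))\<^sup>2)
       \<le> K * (LINT t|lebesgue_on {m..M}. (norm (f t))\<^sup>2)"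
    using assms[OF laplace_L2_axioms] unfolding F_def energy_def .
qed

lemma arclength_monotone_L2_bounded:
  assumes "a \<le> b" "arclength_on z a b" "\<And>s. s \<in> {a..b} \<Longrightarrow> 0 < Re (z s)"
    and "monot_on {a..b} (\<lambda>s. Re (z s))" "monot_on {a..b} (\<lambda>s. Im (z s))"
  shows "L2_bounded_on z {a..b} (10 * pi)"
  using laplace_L2.L2_arclength_monotone[OF _ assms] by (rule L2_bounded_onI)

lemma arclength_convex_L2_bounded:
  assumes "a \<le> b" "arclength_on z a b" "\<And>s. s \<in> {a..b} \<Longrightarrow> 0 < Re (z s)" "convex_on_compact a b z"
  shows "L2_bounded_on z {a..b} (90 * pi)"
  using laplace_L2.L2_arclength_convex[OF _ assms] by (rule L2_bounded_onI)

section \<open>Convergence and truncation of the Laplace integral\<close>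

lemma exp_meas_on[measurable]: "(\<lambda>t. exp (- \<zeta> * of_real t) :: complex) \<in> borel_measurable (lebesgue_on S)"
  by (rule measurable_restrict_space1, rule measurable_completion) (auto intro!: borel_measurable_continuous_onI continuous_intros)

lemma exp_decay_integrable:
  fixes x :: real assumes "0 < x" shows "integrable halfline (\<lambda>t. exp (- x * t))"
proof -
  have "(\<lambda>t. exp (- x * t)) absolutely_integrable_on {0..}"
    using has_integral_exp_minus_to_infinity[OF assms, of 0]
    by (intro nonnegative_absolutely_integrable_1) auto
  then have "(\<lambda>t. exp (- x * t)) absolutely_integrable_on {0<..}"
    by (rule set_integrable_subset) auto
  then show ?thesis by (simp add: integrable_restrict_space set_integrable_def)
qed

text \<open>A substitute for Hoelder's inequality: with \<open>e\<close> an exponential factor, both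
  terms on the right are integrable, so the Laplace integral converges absolutely.\<close>

lemma le_powr_plus_1:
  fixes v e :: real assumes "0 \<le> v" "0 \<le> e" "e \<le> 1" "1 \<le> p" shows "v * e \<le> v powr p + e"
proof (cases "1 \<le> v")
  case True
  then have "v powr 1 \<le> v powr p" using assms by (intro powr_mono) auto
  moreover have "v * e \<le> v" using assms by (intro mult_left_le) auto
  moreover have "v powr 1 = v" using True by simp
  ultimately show ?thesis using assms(2) by linarith
next
  case False
  then have "v * e \<le> 1 * e" using assms by (intro mult_right_mono) auto
  then show ?thesis by (simp add: add_increasing)
qed

lemma laplace_integrable:
  fixes f :: "real \<Rightarrow> complex"
  assumes [measurable]: "f \<in> borel_measurable halfline"
    and int: "integrable halfline (\<lambda>t. norm (f t) powr p)" and "1 \<le> p" and \<zeta>: "0 < Re \<zeta>"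
  shows "integrable halfline (\<lambda>t. f t * exp (- \<zeta> * of_real t))"
proof (rule Bochner_Integration.integrable_bound)
  show "integrable halfline (\<lambda>t. norm (f t) powr p + exp (- Re \<zeta> * t))"
    using int exp_decay_integrable[OF \<zeta>] by simp
  show "AE t in halfline. norm (f t * exp (- \<zeta> * of_real t)) \<le> norm (norm (f t) powr p + exp (- Re \<zeta> * t))"
  proof (rule AE_I2)
    fix t :: real assume "t \<in> space halfline"
    then have "exp (- Re \<zeta> * t) \<le> 1" using \<zeta> by simp
    then have "norm (f t) * exp (- Re \<zeta> * t) \<le> norm (f t) powr p + exp (- Re \<zeta> * t)"
      using \<open>1 \<le> p\<close> by (intro le_powr_plus_1) auto
    then show "norm (f t * exp (- \<zeta> * of_real t)) \<le> norm (norm (f t) powr p + exp (- Re \<zeta> * t))"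
      by (simp add: norm_mult norm_exp_eq_Re)
  qed
qed measurable

lemma integral_lebesgue_on_subset:
  fixes g :: "real \<Rightarrow> 'b :: {banach, second_countable_topology}"
  assumes "S \<subseteq> T" "S \<in> sets lebesgue" "T \<in> sets lebesgue"
  shows "(LINT t|lebesgue_on S. g t) = (LINT t|lebesgue_on T. indicator S t *\<^sub>R g t)"
proof -
  have "(LINT t|lebesgue_on T. indicator S t *\<^sub>R g t) = (LINT t|lebesgue. indicator T t *\<^sub>R (indicator S t *\<^sub>R g t))"
    using assms by (subst integral_restrict_space) auto
  also have "\<dots> = (LINT t|lebesgue. indicator S t *\<^sub>R g t)"
    using assms(1) by (intro Bochner_Integration.integral_cong) (auto simp: indicator_def)
  also have "\<dots> = (LINT t|lebesgue_on S. g t)" using assms by (subst integral_restrict_space) auto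
  finally show ?thesis ..
qed

lemma truncation_subset: "{inverse (real (Suc n))..real (Suc n)} \<subseteq> {0<..}"
proof
  fix t assume "t \<in> {inverse (real (Suc n))..real (Suc n)}"
  then have "inverse (real (Suc n)) \<le> t" by simp
  moreover have "0 < inverse (real (Suc n))" by simp
  ultimately show "t \<in> {0<..}" by (simp only: greaterThan_iff)
qed

lemma truncated_dominated_convergence:
  fixes \<phi> :: "nat \<Rightarrow> real \<Rightarrow> 'b :: {banach, second_countable_topology}"
  assumes [measurable]: "\<And>n. \<phi> n \<in> borel_measurable halfline" "\<psi> \<in> borel_measurable halfline"
    and w: "integrable halfline w"
    and lim: "\<And>t. 0 < t \<Longrightarrow> (\<lambda>n. \<phi> n t) \<longlonglongrightarrow> \<psi> t" and le: "\<And>n t. 0 < t \<Longrightarrow> norm (\<phi> n t) \<le> w t"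
  shows "(\<lambda>n. LINT t|lebesgue_on {inverse (real (Suc n))..real (Suc n)}. \<phi> n t) \<longlonglongrightarrow> (LINT t|halfline. \<psi> t)"
proof -
  define J where "J n = {inverse (real (Suc n))..real (Suc n)}" for n
  have J: "J n \<subseteq> {0<..}" for n unfolding J_def by (rule truncation_subset)
  have [measurable]: "(indicator (J n) :: real \<Rightarrow> real) \<in> borel_measurable halfline" for n
    unfolding J_def by (rule measurable_restrict_space1, rule measurable_completion) simp
  have "(\<lambda>n. LINT t|halfline. indicator (J n) t *\<^sub>R \<phi> n t) \<longlonglongrightarrow> (LINT t|halfline. \<psi> t)"
  proof (rule integral_dominated_convergence[where w = w])
    show "AE t in halfline. (\<lambda>n. indicator (J n) t *\<^sub>R \<phi> n t) \<longlonglongrightarrow> \<psi> t"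
    proof (rule AE_I2)
      fix t :: real assume "t \<in> space halfline"
      then have t: "0 < t" by simp
      have "eventually (\<lambda>n. inverse (real (Suc n)) < t) sequentially"
        using order_tendstoD(2)[OF LIMSEQ_inverse_real_of_nat t] .
      moreover have "eventually (\<lambda>n. t \<le> real n) sequentially"
        using filterlim_real_sequentially by (simp add: filterlim_at_top)
      ultimately have "eventually (\<lambda>n. indicator (J n) t *\<^sub>R \<phi> n t = \<phi> n t) sequentially"
        by eventually_elim (auto simp: J_def)
      then show "(\<lambda>n. indicator (J n) t *\<^sub>R \<phi> n t) \<longlonglongrightarrow> \<psi> t"
        by (intro Lim_transform_eventually[OF lim[OF t]]) (auto elim!: eventually_mono)
    qed
    show "AE t in halfline. norm (indicator (J n) t *\<^sub>R \<phi> n t) \<le> w t" for n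
      using le[of _ n] by (intro AE_I2) (auto simp: indicator_def intro: order.trans[OF norm_ge_zero])
  qed (use w in measurable)
  then show ?thesis unfolding J_def[symmetric]
    by (subst integral_lebesgue_on_subset[OF J]) (auto simp: J_def)
qed

text \<open>One sequence serves all \<open>\<zeta>\<close> and the \<open>p\<close>-norm at once,
  since \<open>norm (g n t) \<le> 2 * norm (f t)\<close> supplies a dominating function in each
  case.\<close>

lemma laplace_simple_approximation:
  fixes f :: "real \<Rightarrow> complex"
  assumes f[measurable]: "f \<in> borel_measurable halfline"
    and int: "integrable halfline (\<lambda>t. norm (f t) powr p)" and p: "1 \<le> p"
  obtains m M :: "nat \<Rightarrow> real" and g :: "nat \<Rightarrow> real \<Rightarrow> complex" where
    "\<And>n. 0 < m n" "\<And>n. m n \<le> M n" "\<And>n. simple_function (lebesgue_on {m n..M n}) (g n)"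
    "\<And>\<zeta>. 0 < Re \<zeta> \<Longrightarrow> (\<lambda>n. LINT t|lebesgue_on {m n..M n}. g n t * exp (- \<zeta> * of_real t))
        \<longlonglongrightarrow> (LINT t|halfline. f t * exp (- \<zeta> * of_real t))"
    "(\<lambda>n. LINT t|lebesgue_on {m n..M n}. norm (g n t) powr p) \<longlonglongrightarrow> (LINT t|halfline. norm (f t) powr p)"
proof -
  obtain g where "\<forall>i. simple_function halfline (g i)"
    "\<forall>t\<in>space halfline. (\<lambda>i. g i t) \<longlonglongrightarrow> f t"
    "\<forall>i. \<forall>t\<in>space halfline. norm (g i t) \<le> 2 * norm (f t)"
    using borel_measurable_implies_sequence_metric[OF f, of 0] unfolding dist_0_norm dist_commute[of _ 0] by blast
  then have g: "simple_function halfline (g i)" "0 < t \<Longrightarrow> (\<lambda>i. g i t) \<longlonglongrightarrow> f t"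
    "0 < t \<Longrightarrow> norm (g i t) \<le> 2 * norm (f t)" for i t by auto
  have [measurable]: "g i \<in> borel_measurable halfline" for i
    by (rule borel_measurable_simple_function[OF g(1)])
  let ?J = "\<lambda>n. {inverse (real (Suc n))..real (Suc n)}"
  show thesis
  proof (rule that[of "\<lambda>n. inverse (real (Suc n))" "\<lambda>n. real (Suc n)" g])
    fix n
    have "inverse (real (Suc n)) \<le> 1" by (simp add: inverse_le_1_iff)
    then show "inverse (real (Suc n)) \<le> real (Suc n)" by simp
    show "0 < inverse (real (Suc n))" by simp
    show "simple_function (lebesgue_on (?J n)) (g n)"
    proof (rule simple_function_borel_measurable)
      show "g n \<in> borel_measurable (lebesgue_on (?J n))"
        by (rule measurable_restrict_mono[OF _ truncation_subset]) measurable
      have "finite (g n ` {0<..})" using simple_functionD(1)[OF g(1)[of n]] by simp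
      then show "finite (g n ` space (lebesgue_on (?J n)))"
        by (rule rev_finite_subset) (use truncation_subset[of n] in auto)
    qed
  next
    fix \<zeta> :: complex assume \<zeta>: "0 < Re \<zeta>"
    show "(\<lambda>n. LINT t|lebesgue_on (?J n). g n t * exp (- \<zeta> * of_real t))
        \<longlonglongrightarrow> (LINT t|halfline. f t * exp (- \<zeta> * of_real t))"
    proof (rule truncated_dominated_convergence[where w = "\<lambda>t. 2 * norm (f t * exp (- \<zeta> * of_real t))"])
      show "integrable halfline (\<lambda>t. 2 * norm (f t * exp (- \<zeta> * of_real t)))"
        using laplace_integrable[OF f int p \<zeta>] by (intro integrable_mult_right integrable_norm)
      fix t :: real assume t: "0 < t"
      show "(\<lambda>n. g n t * exp (- \<zeta> * of_real t)) \<longlonglongrightarrow> f t * exp (- \<zeta> * of_real t)"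
        by (intro tendsto_intros g(2) t)
      show "norm (g n t * exp (- \<zeta> * of_real t)) \<le> 2 * norm (f t * exp (- \<zeta> * of_real t))" for n
        unfolding norm_mult mult.assoc[symmetric] by (rule mult_right_mono[OF g(3)[OF t]]) simp
    qed measurable
  next
    show "(\<lambda>n. LINT t|lebesgue_on (?J n). norm (g n t) powr p)
        \<longlonglongrightarrow> (LINT t|halfline. norm (f t) powr p)"
    proof (rule truncated_dominated_convergence[where w = "\<lambda>t. 2 powr p * norm (f t) powr p"])
      fix t :: real assume t: "0 < t"
      show "(\<lambda>n. norm (g n t) powr p) \<longlonglongrightarrow> norm (f t) powr p"
        using p by (intro tendsto_powr' tendsto_norm g(2) t tendsto_const) auto
      have "norm (g n t) powr p \<le> (2 * norm (f t)) powr p" for n using p by (intro powr_mono2 g(3)[OF t]) auto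
      then show "norm (norm (g n t) powr p) \<le> 2 powr p * norm (f t) powr p" for n by (simp add: powr_mult)
    qed (use int in \<open>simp_all\<close>)
  qed
qed

lemma laplace_kernel_measurable:
  assumes z: "continuous_on I z" and I: "I \<in> sets lebesgue"
  shows "(\<lambda>(s, t). exp (- z s * of_real t) :: complex) \<in> borel_measurable (lebesgue_on I \<Otimes>\<^sub>M lebesgue_on S)"
proof -
  have 1: "z \<in> borel_measurable (lebesgue_on I)" by (rule continuous_imp_measurable_on_sets_lebesgue[OF z I])
  have 2: "(\<lambda>t. of_real t :: complex) \<in> borel_measurable (lebesgue_on S)"
    by (rule measurable_restrict_space1, rule measurable_completion) (auto intro!: borel_measurable_continuous_onI continuous_intros)
  have [measurable]: "(\<lambda>w. z (fst w)) \<in> borel_measurable (lebesgue_on I \<Otimes>\<^sub>M lebesgue_on S)"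
    "(\<lambda>w. of_real (snd w) :: complex) \<in> borel_measurable (lebesgue_on I \<Otimes>\<^sub>M lebesgue_on S)"
    using measurable_compose[OF measurable_fst 1] measurable_compose[OF measurable_snd 2] by auto
  have "(\<lambda>w. exp (- z (fst w) * of_real (snd w)) :: complex) \<in> borel_measurable (lebesgue_on I \<Otimes>\<^sub>M lebesgue_on S)"
    by (rule borel_measurable_continuous_on[OF continuous_on_exp[OF continuous_on_id]]) measurable
  then show ?thesis by (simp add: split_beta')
qed

text \<open>A pointwise limit of truncated transforms, each of which is a parameter integral over a
  finite measure.\<close>

lemma laplace_curve_measurable:
  assumes z: "continuous_on I z" "\<And>s. s \<in> I \<Longrightarrow> 0 < Re (z s)" and I: "I \<in> sets lebesgue"
    and f: "f \<in> borel_measurable halfline"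
    and int: "integrable halfline (\<lambda>t. norm (f t) powr p)" and p: "1 \<le> p"
  shows "laplace_curve z f \<in> borel_measurable (lebesgue_on I)"
proof -
  obtain m M g where "\<And>n. 0 < m n" "\<And>n. m n \<le> M n" and g: "\<And>n. simple_function (lebesgue_on {m n..M n}) (g n)"
    "\<And>\<zeta>. 0 < Re \<zeta> \<Longrightarrow> (\<lambda>n. LINT t|lebesgue_on {m n..M n::real}. g n t * exp (- \<zeta> * of_real t))
        \<longlonglongrightarrow> (LINT t|halfline. f t * exp (- \<zeta> * of_real t))"
    "(\<lambda>n. LINT t|lebesgue_on {m n..M n}. norm (g n t) powr p) \<longlonglongrightarrow> (LINT t|halfline. norm (f t) powr p)"
    using that by (rule laplace_simple_approximation[OF f int p])
  show ?thesis
  proof (rule borel_measurable_LIMSEQ_metric)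
    fix n
    interpret finite_measure "lebesgue_on {m n..M n}" by (rule finite_measure_lebesgue_on) auto
    have "g n \<in> borel_measurable (lebesgue_on {m n..M n})" by (rule borel_measurable_simple_function[OF g(1)])
    then show "(\<lambda>s. LINT t|lebesgue_on {m n..M n}. g n t * exp (- z s * of_real t)) \<in> borel_measurable (lebesgue_on I)"
      using measurable_compose[OF measurable_snd, of "g n" "lebesgue_on {m n..M n}" borel "lebesgue_on I"]
        laplace_kernel_measurable[OF z(1) I, of "{m n..M n}"]
      by (intro borel_measurable_lebesgue_integral) (simp add: split_beta')
    fix s assume "s \<in> space (lebesgue_on I)"
    then show "(\<lambda>n. LINT t|lebesgue_on {m n..M n}. g n t * exp (- z s * of_real t)) \<longlonglongrightarrow> laplace_curve z f s"
      unfolding laplace_curve_def using z(2) by (intro g(2)) auto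
  qed
qed

text \<open>Interpolation is applied to each truncated simple function. The transforms converge
  pointwise on the curve and the \<open>p\<close>-norms converge, so Fatou's lemma in
  \<open>s\<close> carries the bound over to \<open>f\<close>.\<close>

lemma laplace_Lp_compact:
  assumes K: "L2_bounded_on z {a..b} K" "0 < K" and z: "continuous_on {a..b} z" "\<And>s. s \<in> {a..b} \<Longrightarrow> 0 < Re (z s)"
    and f: "f \<in> borel_measurable halfline"
    and int: "integrable halfline (\<lambda>t. norm (f t) powr p)" and p: "1 < p" "p \<le> 2" and q: "q = p / (p - 1)"
  shows "(\<integral>\<^sup>+s. ennreal (norm (laplace_curve z f s) powr q) \<partial>lebesgue_on {a..b})
     \<le> ennreal (K * (LINT t|halfline. norm (f t) powr p) powr (q / p))"
proof -
  have p1: "1 \<le> p" using p by simp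
  have q0: "0 < q" using p q by simp
  obtain m M g where mM: "\<And>n. 0 < m n" "\<And>n. m n \<le> M n" and g: "\<And>n. simple_function (lebesgue_on {m n..M n}) (g n)"
    "\<And>\<zeta>. 0 < Re \<zeta> \<Longrightarrow> (\<lambda>n. LINT t|lebesgue_on {m n..M n::real}. g n t * exp (- \<zeta> * of_real t))
        \<longlonglongrightarrow> (LINT t|halfline. f t * exp (- \<zeta> * of_real t))"
    "(\<lambda>n. LINT t|lebesgue_on {m n..M n}. norm (g n t) powr p) \<longlonglongrightarrow> (LINT t|halfline. norm (f t) powr p)"
    using that by (rule laplace_simple_approximation[OF f int p1])
  let ?\<nu> = "lebesgue_on {a..b}" and ?\<mu> = "\<lambda>n. lebesgue_on {m n..M n}"
  let ?\<kappa> = "\<lambda>s t. exp (- z s * complex_of_real t)"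
  define T where "T n s = (LINT t|?\<mu> n. g n t * exp (- z s * of_real t))" for n s
  define X where "X n = (LINT t|?\<mu> n. norm (g n t) powr p)" for n
  have base: "bounded_kernel (?\<mu> n) (?\<nu>) ?\<kappa>" for n
  proof (intro bounded_kernel.intro bounded_kernel_axioms.intro finite_measure_lebesgue_on)
    show "(\<lambda>(s, t). exp (- z s * of_real t)) \<in> borel_measurable (?\<nu> \<Otimes>\<^sub>M ?\<mu> n)"
      by (rule laplace_kernel_measurable[OF z(1)]) simp
    show "norm (exp (- z s * of_real t)) \<le> 1"
      if "s \<in> space (?\<nu>)" "t \<in> space (?\<mu> n)" for s t
      using that z(2)[of s] mM(1)[of n] by (auto simp: norm_exp_eq_Re intro!: mult_nonneg_nonneg)
  qed auto
  have kernel: "L2_bounded_kernel (?\<mu> n) (?\<nu>) ?\<kappa> K" for n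
  proof -
    interpret B: bounded_kernel "?\<mu> n" "?\<nu>" "?\<kappa>" by (rule base)
    show ?thesis
    proof unfold_locales
      show "0 < K" by fact
      fix h :: "real \<Rightarrow> complex" assume h: "simple_function (?\<mu> n) h"
      have hm: "h \<in> borel_measurable (?\<mu> n)" by (rule borel_measurable_simple_function[OF h])
      have fin: "finite (h ` {m n..M n})" using simple_functionD(1)[OF h] by simp
      have hb: "norm (h t) \<le> (\<Sum>v\<in>h ` {m n..M n}. norm v)" if "t \<in> {m n..M n}" for t
        using that by (intro member_le_sum[of _ _ norm, OF _ _ fin]) auto
      have hi: "integrable (?\<mu> n) h"
        using B.simple_comp_integrable[OF B.\<mu>.finite_measure_axioms h, of "\<lambda>v. v"] .
      \<comment> \<open>\<open>L2_bounded_on\<close> speaks of the gauge integral; integrability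
        identifies it with the Lebesgue integral.\<close>
      have "integrable (?\<nu>) (\<lambda>s. (norm (B.T h s))\<^sup>2)"
      proof (rule B.\<nu>.integrable_const_bound)
        show "AE s in ?\<nu>. norm ((norm (B.T h s))\<^sup>2) \<le> (LINT t|?\<mu> n. norm (h t))\<^sup>2"
          using B.norm_T_le[OF hi] by (intro AE_I2) (auto intro!: power_mono)
        show "(\<lambda>s. (norm (B.T h s))\<^sup>2) \<in> borel_measurable (?\<nu>)"
          by (intro borel_measurable_power measurable_compose[OF B.T_meas[OF hm] borel_measurable_norm])
      qed
      then have "(LINT s|?\<nu>. (norm (B.T h s))\<^sup>2) = integral {a..b} (\<lambda>s. (norm (B.T h s))\<^sup>2)"
        by (intro lebesgue_integral_eq_integral) auto
      also have "\<dots> \<le> K * (LINT t|?\<mu> n. (norm (h t))\<^sup>2)"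
        using K(1) mM hm hb unfolding L2_bounded_on_def B.T_def by blast
      finally show "(LINT s|?\<nu>. (norm (B.T h s))\<^sup>2) \<le> K * (LINT t|?\<mu> n. (norm (h t))\<^sup>2)" .
    qed
  qed
  have T_meas: "T n \<in> borel_measurable (?\<nu>)"
    and T_le: "(\<integral>\<^sup>+s. ennreal (norm (T n s) powr q) \<partial>?\<nu>) \<le> ennreal (K * X n powr (q / p))" for n
  proof -
    interpret B: L2_bounded_kernel "?\<mu> n" "?\<nu>" "?\<kappa>" K by (rule kernel)
    have T: "T n = B.T (g n)" by (rule ext) (simp only: T_def B.T_def)
    have int_g: "integrable (?\<mu> n) (g n)"
      using B.simple_comp_integrable[OF B.\<mu>.finite_measure_axioms g(1), of "\<lambda>v. v"] .
    show meas: "T n \<in> borel_measurable (?\<nu>)" unfolding T using int_g by (intro B.T_meas) auto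
    have "integrable (?\<nu>) (\<lambda>s. norm (T n s) powr q)"
    proof (rule B.\<nu>.integrable_const_bound)
      show "AE s in ?\<nu>. norm (norm (T n s) powr q) \<le> (LINT t|?\<mu> n. norm (g n t)) powr q"
        using B.norm_T_le[OF int_g] q0 unfolding T by (intro AE_I2) (auto intro!: powr_mono2)
      show "(\<lambda>s. norm (T n s) powr q) \<in> borel_measurable (?\<nu>)"
        using meas by measurable
    qed
    then have "(\<integral>\<^sup>+s. ennreal (norm (T n s) powr q) \<partial>?\<nu>) = ennreal (LINT s|?\<nu>. norm (T n s) powr q)"
      by (intro nn_integral_eq_integral) auto
    also have "\<dots> \<le> ennreal (K * X n powr (q / p))"
      unfolding T X_def by (intro ennreal_leI B.Lp_bound g(1) p q)
    finally show "(\<integral>\<^sup>+s. ennreal (norm (T n s) powr q) \<partial>?\<nu>) \<le> ennreal (K * X n powr (q / p))" .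
  qed
  have lim: "(\<lambda>n. ennreal (norm (T n s) powr q)) \<longlonglongrightarrow> ennreal (norm (laplace_curve z f s) powr q)" if "s \<in> {a..b}" for s
    unfolding T_def laplace_curve_def using q0
    by (intro tendsto_ennrealI tendsto_powr' tendsto_norm g(2) z(2)[OF that] tendsto_const) auto
  have "(\<integral>\<^sup>+s. ennreal (norm (laplace_curve z f s) powr q) \<partial>?\<nu>)
      = (\<integral>\<^sup>+s. liminf (\<lambda>n. ennreal (norm (T n s) powr q)) \<partial>?\<nu>)"
    using lim_imp_Liminf[OF _ lim] by (intro nn_integral_cong) auto
  also have "\<dots> \<le> liminf (\<lambda>n. \<integral>\<^sup>+s. ennreal (norm (T n s) powr q) \<partial>?\<nu>)"
    using T_meas by (intro nn_integral_liminf) measurable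
  also have "\<dots> \<le> liminf (\<lambda>n. ennreal (K * X n powr (q / p)))"
    by (intro Liminf_mono) (simp add: T_le)
  also have "\<dots> = ennreal (K * (LINT t|halfline. norm (f t) powr p) powr (q / p))"
  proof (rule lim_imp_Liminf)
    have "0 < q / p" using q0 p by simp
    then show "(\<lambda>n. ennreal (K * X n powr (q / p))) \<longlonglongrightarrow> ennreal (K * (LINT t|halfline. norm (f t) powr p) powr (q / p))"
      using g(3) unfolding X_def by (intro tendsto_ennrealI tendsto_mult tendsto_powr' tendsto_const) auto
  qed simp
  finally show ?thesis .
qed

section \<open>Exhaustion of the parameter interval\<close>

lemma coinitial_sequence:
  fixes I :: "real set"
  assumes "I \<noteq> {}"
  obtains a :: "nat \<Rightarrow> real" where "decseq a" "\<And>n. a n \<in> I" "\<And>x. x \<in> I \<Longrightarrow> \<exists>n. a n \<le> x"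
proof (cases "\<exists>l\<in>I. \<forall>x\<in>I. l \<le> x")
  case True
  then obtain l where "l \<in> I" "\<forall>x\<in>I. l \<le> x" by blast
  then show thesis by (intro that[of "\<lambda>_. l"]) (auto simp: decseq_def)
next
  case False
  \<comment> \<open>Extended reals treat intervals bounded and unbounded below alike. As there is no
    least element, each \<open>x\<close> in \<open>I\<close> lies strictly above the infimum, and
    the sequence eventually gets below it.\<close>
  have "ereal ` I \<noteq> {}" using assms by simp
  from Inf_countable_INF[OF this] obtain f :: "nat \<Rightarrow> ereal" where
    f: "decseq f" "range f \<subseteq> ereal ` I" "Inf (ereal ` I) = (INF i. f i)" by blast
  then have "\<forall>n. \<exists>a. a \<in> I \<and> f n = ereal a" by blast
  then obtain a where a: "\<And>n. a n \<in> I" "\<And>n. f n = ereal (a n)" by metis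
  show thesis
  proof (rule that[of a])
    show "decseq a" using f(1) a(2) by (simp add: decseq_def)
    fix x assume "x \<in> I"
    then obtain y where "y \<in> I" "y < x" using False by force
    then have "(INF i. f i) \<le> ereal y" unfolding f(3)[symmetric] by (intro Inf_lower) auto
    also have "\<dots> < ereal x" using \<open>y < x\<close> by simp
    finally obtain n where "f n < ereal x" by (auto simp: INF_less_iff)
    then show "\<exists>n. a n \<le> x" using a(2) by (auto intro: less_imp_le)
  qed (rule a)
qed

lemma interval_exhaustion:
  fixes I :: "real set"
  assumes I: "is_interval I" "I \<noteq> {}"
  obtains a b :: "nat \<Rightarrow> real" where "incseq (\<lambda>n. {a n..b n})" "(\<Union>n. {a n..b n}) = I"
    "\<And>n. a n \<in> I" "\<And>n. b n \<in> I"
proof -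
  obtain a where a: "decseq a" "\<And>n::nat. a n \<in> I" "\<And>x. x \<in> I \<Longrightarrow> \<exists>n. a n \<le> x"
    using that by (rule coinitial_sequence[OF I(2)])
  \<comment> \<open>The right endpoints are the negatives of a coinitial sequence of the reflected
    interval.\<close>
  obtain b where b: "decseq b" "\<And>n::nat. b n \<in> uminus ` I" "\<And>x. x \<in> uminus ` I \<Longrightarrow> \<exists>n. b n \<le> x"
  proof -
    have "uminus ` I \<noteq> {}" using I(2) by simp
    then show thesis using that by (rule coinitial_sequence)
  qed
  have b': "- b n \<in> I" for n using b(2)[of n] by auto
  show thesis
  proof (rule that[of a "\<lambda>n. - b n"])
    show "incseq (\<lambda>n. {a n..- b n})"
      using a(1) b(1) by (auto simp: incseq_def decseq_def intro: order.trans)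
    show "(\<Union>n. {a n..- b n}) = I"
    proof (intro equalityI subsetI)
      fix x assume "x \<in> (\<Union>n. {a n..- b n})"
      then obtain n where "a n \<le> x" "x \<le> - b n" by auto
      then show "x \<in> I" using I(1) a(2)[of n] b'[of n] unfolding is_interval_1 by blast
    next
      fix x assume x: "x \<in> I"
      obtain i where i: "a i \<le> x" using a(3)[OF x] by blast
      obtain j where j: "b j \<le> - x" using b(3)[of "- x"] x by blast
      have "a (max i j) \<le> a i" "b (max i j) \<le> b j" using a(1) b(1) by (auto simp: decseq_def)
      then have "x \<in> {a (max i j)..- b (max i j)}" using i j by auto
      then show "x \<in> (\<Union>n. {a n..- b n})" by blast
    qed
  qed (use a b' in auto)
qed

text \<open>The exhaustion is existentially quantified because convexity of a curve on a noncompact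
  interval supplies a particular one; for monotone curves any exhaustion would do.\<close>

definition L2_exhausted :: "(real \<Rightarrow> complex) \<Rightarrow> real set \<Rightarrow> real \<Rightarrow> bool" where
  "L2_exhausted z I K \<longleftrightarrow> (\<exists>a b :: nat \<Rightarrow> real. incseq (\<lambda>n. {a n..b n}) \<and> (\<Union>n. {a n..b n}) = I \<and>
     (\<forall>n. L2_bounded_on z {a n..b n} K))"

text \<open>The bound on each compact interval has the same constant, so monotone convergence along
  the exhaustion preserves it.\<close>

lemma laplace_Lp_exhausted:
  assumes K: "L2_exhausted z I K" "0 < K" and z: "continuous_on I z" "\<And>s. s \<in> I \<Longrightarrow> 0 < Re (z s)"
    and I: "I \<in> sets lebesgue"
    and f: "f \<in> borel_measurable halfline"
    and int: "integrable halfline (\<lambda>t. norm (f t) powr p)" and p: "1 < p" "p \<le> 2" and q: "q = p / (p - 1)"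
  shows "(\<integral>\<^sup>+s. ennreal (norm (laplace_curve z f s) powr q) \<partial>lebesgue_on I)
     \<le> ennreal (K * (LINT t|halfline. norm (f t) powr p) powr (q / p))"
proof -
  obtain a b where ab: "incseq (\<lambda>n::nat. {a n..b n})" "(\<Union>n. {a n..b n}) = I" "\<And>n. L2_bounded_on z {a n..b n} K"
    using K(1) unfolding L2_exhausted_def by blast
  define u where "u s = ennreal (norm (laplace_curve z f s) powr q)" for s
  have sub: "{a n..b n} \<subseteq> I" for n using ab(2) by blast
  have "laplace_curve z f \<in> borel_measurable (lebesgue_on I)"
    by (rule laplace_curve_measurable[OF z I f int]) (use p in auto)
  then have u_meas: "u \<in> borel_measurable (lebesgue_on I)" unfolding u_def by measurable
  have ind: "(indicator {a n..b n} :: real \<Rightarrow> ennreal) \<in> borel_measurable (lebesgue_on I)" for n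
    by (rule measurable_restrict_space1, rule measurable_completion) simp
  have eq: "(\<integral>\<^sup>+s. u s * indicator {a n..b n} s \<partial>lebesgue_on I) = (\<integral>\<^sup>+s. u s \<partial>lebesgue_on {a n..b n})" for n
  proof -
    have "(\<integral>\<^sup>+s. u s * indicator {a n..b n} s \<partial>lebesgue_on I) = (\<integral>\<^sup>+s. u s * indicator {a n..b n} s * indicator I s \<partial>lebesgue)"
      using I by (subst nn_integral_restrict_space) auto
    also have "\<dots> = (\<integral>\<^sup>+s. u s * indicator {a n..b n} s \<partial>lebesgue)"
      using sub[of n] by (intro nn_integral_cong) (auto simp: indicator_def)
    also have "\<dots> = (\<integral>\<^sup>+s. u s \<partial>lebesgue_on {a n..b n})" by (subst nn_integral_restrict_space) auto
    finally show ?thesis .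
  qed
  have "(\<integral>\<^sup>+s. u s \<partial>lebesgue_on I) = (\<integral>\<^sup>+s. (SUP n. u s * indicator {a n..b n} s) \<partial>lebesgue_on I)"
  proof (rule nn_integral_cong)
    fix s assume "s \<in> space (lebesgue_on I)"
    then obtain n where "s \<in> {a n..b n}" using ab(2) by auto
    then have "u s \<le> (SUP n. u s * indicator {a n..b n} s)" by (intro SUP_upper2[of n]) auto
    moreover have "(SUP n. u s * indicator {a n..b n} s) \<le> u s" by (intro SUP_least) (auto simp: indicator_def)
    ultimately show "u s = (SUP n. u s * indicator {a n..b n} s)" by (rule antisym)
  qed
  also have "\<dots> = (SUP n. \<integral>\<^sup>+s. u s * indicator {a n..b n} s \<partial>lebesgue_on I)"
  proof (rule nn_integral_monotone_convergence_SUP)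
    show "incseq (\<lambda>n s. u s * indicator {a n..b n} s)"
    proof (intro monoI le_funI mult_left_mono)
      fix i j :: nat and s assume "i \<le> j"
      then have "{a i..b i} \<subseteq> {a j..b j}" using ab(1) by (simp only: incseq_def)
      then show "indicator {a i..b i} s \<le> (indicator {a j..b j} s :: ennreal)" by (auto simp: indicator_def)
    qed simp
    show "(\<lambda>s. u s * indicator {a n..b n} s) \<in> borel_measurable (lebesgue_on I)" for n
      by (rule borel_measurable_times_ennreal[OF u_meas ind])
  qed
  also have "\<dots> \<le> ennreal (K * (LINT t|halfline. norm (f t) powr p) powr (q / p))"
    unfolding eq unfolding u_def
    by (intro SUP_least, rule laplace_Lp_compact[OF ab(3) K(2) continuous_on_subset[OF z(1) sub] z(2)[OF subsetD[OF sub]] f int p q])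
  finally show ?thesis by (simp add: u_def)
qed

lemma arclength_curvesD:
  assumes "(I, z) \<in> arclength_curves right_halfplane"
  shows "is_interval I" "\<And>s. s \<in> I \<Longrightarrow> 0 < Re (z s)" "continuous_on I z" "I \<in> sets lebesgue"
    "\<And>a b. a \<in> I \<Longrightarrow> b \<in> I \<Longrightarrow> arclength_on z a b"
    "z ` I \<subseteq> right_halfplane"
proof -
  from assms have *: "is_interval I" "z ` I \<subseteq> right_halfplane"
    "\<And>a b. a \<in> I \<Longrightarrow> b \<in> I \<Longrightarrow> a \<le> b \<Longrightarrow> curve_length z a b = ennreal (b - a)"
    by (auto simp: arclength_curves_def)
  show "is_interval I" "z ` I \<subseteq> right_halfplane" by fact+
  show "s \<in> I \<Longrightarrow> 0 < Re (z s)" for s using *(2) by (auto simp: right_halfplane_def)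
  show "continuous_on I z"
    by (rule lipschitz_continuous_on) (auto intro: curve_length_dist *(3))
  show "I \<in> sets lebesgue"
    using *(1) by (intro sets_completionI_sets) (simp add: real_interval_borel_measurable)
  show "arclength_on z a b" if "a \<in> I" "b \<in> I" for a b
    unfolding arclength_on_def
  proof (intro allI impI *(3))
    fix s s' assume "a \<le> s" "s \<le> s'" "s' \<le> b"
    then show "s \<in> I" "s' \<in> I" using *(1) that unfolding is_interval_1 by (meson order.trans)+
  qed
qed

lemma L2_bounded_on_empty: "0 \<le> K \<Longrightarrow> L2_bounded_on z {} K"
  unfolding L2_bounded_on_def by (auto intro!: mult_nonneg_nonneg integral_nonneg_AE)

lemma monotone_curve_L2_exhausted:
  assumes "(I, z) \<in> monotone_curves right_halfplane"
  shows "L2_exhausted z I (10 * pi)"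
proof (cases "I = {}")
  case True
  then show ?thesis unfolding L2_exhausted_def
    \<comment> \<open>The intervals \<open>{1..0}\<close> are empty.\<close>
    by (intro exI[of _ "\<lambda>_. 1"] exI[of _ "\<lambda>_. 0"]) (auto simp: incseq_def L2_bounded_on_empty)
next
  case False
  have arc: "(I, z) \<in> arclength_curves right_halfplane"
    and mon: "monot_on I (\<lambda>s. Re (z s))" "monot_on I (\<lambda>s. Im (z s))"
    using assms by (auto simp: monotone_curves_def monot_on_def)
  note D = arclength_curvesD[OF arc]
  obtain a b where ab: "incseq (\<lambda>n::nat. {a n..b n})" "(\<Union>n. {a n..b n}) = I" "\<And>n. a n \<in> I" "\<And>n. b n \<in> I"
    using that by (rule interval_exhaustion[OF D(1) False])
  have sub: "{a n..b n} \<subseteq> I" for n using ab(2) by blast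
  have "L2_bounded_on z {a n..b n} (10 * pi)" for n
  proof (cases "a n \<le> b n")
    case True
    show ?thesis
      by (rule arclength_monotone_L2_bounded[OF True D(5)[OF ab(3,4)] _ monot_on_subset[OF mon(1) sub] monot_on_subset[OF mon(2) sub]])
        (use D(2) subsetD[OF sub] in blast)
  qed (simp add: L2_bounded_on_empty)
  then show ?thesis unfolding L2_exhausted_def using ab by blast
qed

lemma convex_curve_L2_exhausted:
  assumes "(I, z) \<in> convex_curves right_halfplane"
  shows "L2_exhausted z I (90 * pi)"
proof -
  have arc: "(I, z) \<in> arclength_curves right_halfplane" using assms by (auto simp: convex_curves_def)
  note D = arclength_curvesD[OF arc]
  obtain a b where ab: "incseq (\<lambda>n::nat. {a n..b n})" "(\<Union>n. {a n..b n}) = I" "\<And>n. convex_on_compact (a n) (b n) z"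
  proof (cases "compact I")
    case True
    then obtain a b where "I = {a..b}" "convex_on_compact a b z" using assms by (auto simp: convex_curves_def)
    then show thesis by (intro that[of "\<lambda>_. a" "\<lambda>_. b"]) (auto simp: incseq_def)
  next
    case False
    then show thesis using assms that by (auto simp: convex_curves_def)
  qed
  have sub: "{a n..b n} \<subseteq> I" for n using ab(2) by blast
  have "L2_bounded_on z {a n..b n} (90 * pi)" for n
  proof -
    have le: "a n \<le> b n" using ab(3)[of n] by (simp add: convex_on_compact_def)
    then have "a n \<in> I" "b n \<in> I" using sub[of n] by auto
    then show ?thesis
      by (intro arclength_convex_L2_bounded[OF le _ _ ab(3)] D(5) D(2)) (use subsetD[OF sub] in blast)+
  qed
  then show ?thesis unfolding L2_exhausted_def using ab by blast
qed

lemma conjugate_exponents_cases: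
  fixes p p' :: ennreal
  assumes "1 \<le> p" "p \<le> 2" "inverse p + inverse p' = 1"
  obtains "p = 1" "p' = \<infinity>" | r where "1 < r" "r \<le> 2" "p = ennreal r" "p' = ennreal (r / (r - 1))"
proof -
  have "p < \<infinity>" using assms(2) by (rule order.strict_trans1) simp
  then obtain r where r0: "0 \<le> r" "p = ennreal r" by (cases p) auto
  then have "ennreal 1 \<le> ennreal r" "ennreal r \<le> ennreal 2" using assms(1,2) by simp_all
  then have r: "1 \<le> r" "r \<le> 2" using r0 by (simp_all add: ennreal_le_iff del: ennreal_numeral ennreal_1)
  then have inv_p: "inverse p = ennreal (inverse r)" using r0 by (simp add: inverse_ennreal)
  show thesis
  proof (cases p')
    case top
    then have "ennreal (inverse r) = 1" using assms(3) inv_p by simp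
    then have "r = 1" by (simp add: ennreal_eq_1)
    then show thesis using top r0 that(1) by simp
  next
    case (real t)
    have "t \<noteq> 0" using assms(3) real by auto
    then have t: "0 < t" using real by simp
    then have "ennreal (inverse r + inverse t) = ennreal 1" using assms(3) inv_p real r
      by (simp add: inverse_ennreal)
    then have e: "inverse r + inverse t = 1" using r t by (subst (asm) ennreal_inj) auto
    have "r \<noteq> 1" using e t by auto
    then have "1 < r" using r by simp
    moreover from this have "t = r / (r - 1)" using e t by (simp add: field_simps)
    ultimately show thesis using r r0 real that(2) by blast
  qed
qed

section \<open>Operator bounds between Lp spaces\<close>

lemma Lp_norm_ennreal:
  assumes "0 < r" "(\<integral>\<^sup>+x. ennreal (norm (g x) powr r) \<partial>M) = ennreal X" "0 \<le> X"
  shows "Lp_norm (ennreal r) M g = ennreal (X powr (1 / r))"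
  using assms by (simp add: Lp_norm_def)

lemma Lp_space_integrable:
  assumes "f \<in> Lp_space (ennreal r) M" "0 < r"
  shows "f \<in> borel_measurable M" "integrable M (\<lambda>x. norm (f x) powr r)"
    "Lp_norm (ennreal r) M f = ennreal ((LINT x|M. norm (f x) powr r) powr (1 / r))"
proof -
  show meas[measurable]: "f \<in> borel_measurable M" using assms(1) by (simp add: Lp_space_def)
  have "Lp_norm (ennreal r) M f < \<infinity>" using assms(1) by (simp add: Lp_space_def)
  then have "(\<integral>\<^sup>+x. ennreal (norm (f x) powr r) \<partial>M) < \<infinity>"
    using assms(2) by (auto simp: Lp_norm_def Let_def less_top[symmetric] split: if_splits)
  then show int: "integrable M (\<lambda>x. norm (f x) powr r)"
    by (intro integrableI_bounded) auto
  have "(\<integral>\<^sup>+x. ennreal (norm (f x) powr r) \<partial>M) = ennreal (LINT x|M. norm (f x) powr r)"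
    using int by (intro nn_integral_eq_integral) auto
  then show "Lp_norm (ennreal r) M f = ennreal ((LINT x|M. norm (f x) powr r) powr (1 / r))"
    using assms(2) by (intro Lp_norm_ennreal) (auto intro!: integral_nonneg_AE)
qed

lemma laplace_curve_bound:
  assumes K: "L2_exhausted z I K" "0 < K" and z: "continuous_on I z" "z ` I \<subseteq> right_halfplane"
    and I: "I \<in> sets lebesgue"
    and p: "1 \<le> p" "p \<le> 2" "inverse p + inverse p' = 1"
    and f: "f \<in> Lp_space p halfline"
  shows "\<And>s. s \<in> I \<Longrightarrow> integrable halfline (\<lambda>t. f t * exp (- z s * of_real t))"
    "laplace_curve z f \<in> borel_measurable (lebesgue_on I)"
    "Lp_norm p' (lebesgue_on I) (laplace_curve z f)
       \<le> ennreal (K powr enn2real (inverse p')) * Lp_norm p halfline f"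
proof -
  have z2: "0 < Re (z s)" if "s \<in> I" for s using z(2) that by (auto simp: right_halfplane_def)
  obtain r where r: "1 \<le> r" "p = ennreal r"
    using conjugate_exponents_cases[OF p] by (metis ennreal_1 less_imp_le order_refl)
  have f': "f \<in> Lp_space (ennreal r) halfline" "0 < r" using f r by auto
  note fp = Lp_space_integrable[OF f']
  define X where "X = (LINT t|halfline. norm (f t) powr r)"
  have X0: "0 \<le> X" unfolding X_def by (intro integral_nonneg_AE) auto
  show int: "integrable halfline (\<lambda>t. f t * exp (- z s * of_real t))" if "s \<in> I" for s
    by (rule laplace_integrable[OF fp(1,2) r(1) z2[OF that]])
  show meas: "laplace_curve z f \<in> borel_measurable (lebesgue_on I)"
    by (rule laplace_curve_measurable[OF z(1) z2 I fp(1,2) r(1)])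
  show "Lp_norm p' (lebesgue_on I) (laplace_curve z f)
       \<le> ennreal (K powr enn2real (inverse p')) * Lp_norm p halfline f"
  proof (cases rule: conjugate_exponents_cases[OF p])
    case 1
    then have "r = 1" using r by (metis ennreal_1 ennreal_inj order.trans zero_le_one)
    have "norm (laplace_curve z f s) \<le> X" if "s \<in> I" for s
    proof -
      have "norm (laplace_curve z f s) \<le> (LINT t|halfline. norm (f t * exp (- z s * of_real t)))"
        unfolding laplace_curve_def by (rule integral_norm_bound)
      also have "\<dots> \<le> (LINT t|halfline. norm (f t) powr r)"
      proof (rule integral_mono_AE')
        show "AE t in halfline. norm (f t * exp (- z s * of_real t)) \<le> norm (f t) powr r"
        proof (rule AE_I2)
          fix t :: real assume "t \<in> space halfline"
          then have "norm (exp (- z s * of_real t)) \<le> 1" using z2[OF that] by (simp add: norm_exp_eq_Re)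
          then show "norm (f t * exp (- z s * of_real t)) \<le> norm (f t) powr r"
            unfolding norm_mult \<open>r = 1\<close> by (simp add: mult_left_le)
        qed
      qed (use fp(2) in auto)
      finally show ?thesis by (simp add: X_def)
    qed
    then have "esssup (lebesgue_on I) (\<lambda>s. ennreal (norm (laplace_curve z f s))) \<le> ennreal X"
      using meas by (intro esssup_I AE_I2) (auto intro: ennreal_leI)
    moreover have "Lp_norm p' (lebesgue_on I) (laplace_curve z f) = esssup (lebesgue_on I) (\<lambda>s. ennreal (norm (laplace_curve z f s)))"
      using 1 by (simp add: Lp_norm_def)
    moreover have "Lp_norm p halfline f = ennreal X"
    proof -
      have "Lp_norm (ennreal r) halfline f = ennreal (X powr (1 / r))" using fp(3) by (simp only: X_def)
      then show ?thesis using X0 \<open>r = 1\<close> r(2) by simp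
    qed
    \<comment> \<open>As \<open>inverse \<infinity> = 0\<close>, the constant is
      \<open>K powr 0 = 1\<close>.\<close>
    ultimately show ?thesis using 1 K(2) by simp
  next
    case (2 r')
    then have "r' = r" using r by (metis ennreal_inj less_imp_le order.trans zero_le_one)
    with 2 have r2: "1 < r" "r \<le> 2" and p': "p' = ennreal (r / (r - 1))" by auto
    define q where "q = r / (r - 1)"
    have q: "0 < q" "q / r * (1 / q) = 1 / r" using r2 by (auto simp: q_def)
    define J where "J = (\<integral>\<^sup>+s. ennreal (norm (laplace_curve z f s) powr q) \<partial>lebesgue_on I)"
    have J: "J \<le> ennreal (K * X powr (q / r))"
      unfolding J_def X_def by (rule laplace_Lp_exhausted[OF K z(1) z2 I fp(1,2) r2 q_def])
    then have "J < \<infinity>" by (rule order.strict_trans1) simp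
    then obtain Y where Y: "0 \<le> Y" "J = ennreal Y" by (cases J) auto
    then have YX: "Y \<le> K * X powr (q / r)" using J K(2) X0 by simp
    have "Lp_norm p' (lebesgue_on I) (laplace_curve z f) = ennreal (Y powr (1 / q))"
      unfolding p' q_def[symmetric] by (rule Lp_norm_ennreal[OF q(1) Y(2)[unfolded J_def] Y(1)])
    also have "\<dots> \<le> ennreal ((K * X powr (q / r)) powr (1 / q))"
      using YX Y q by (intro ennreal_leI powr_mono2) auto
    also have "(K * X powr (q / r)) powr (1 / q) = K powr (1 / q) * X powr (1 / r)"
      using K(2) X0 q by (simp add: powr_mult powr_powr)
    also have "ennreal (K powr (1 / q) * X powr (1 / r)) = ennreal (K powr enn2real (inverse p')) * Lp_norm p halfline f"
    proof -
      have "enn2real (inverse p') = 1 / q"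
        unfolding p' q_def[symmetric] using q(1) by (simp add: inverse_ennreal inverse_eq_divide)
      then show ?thesis using fp(3) r by (simp add: X_def[symmetric] ennreal_mult)
    qed
    finally show ?thesis .
  qed
qed

lemma laplace_curve_continuous_operator:
  assumes K: "L2_exhausted z I K" "0 < K" and z: "continuous_on I z" "z ` I \<subseteq> right_halfplane"
    and I: "I \<in> sets lebesgue"
    and p: "1 \<le> p" "p \<le> 2" "inverse p + inverse p' = 1"
  shows "continuous_Lp_operator p halfline p' (lebesgue_on I) (laplace_curve z)"
proof -
  let ?N = "Lp_norm p halfline" and ?N' = "Lp_norm p' (lebesgue_on I)"
  let ?L = "Lp_space p halfline" and ?T = "laplace_curve z"
  note B = laplace_curve_bound[OF K z I p]
  define k where "k = ennreal (K powr enn2real (inverse p'))"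
  have k: "0 < k" "k < \<infinity>" using K(2) by (auto simp: k_def)
  have space: "?T f \<in> Lp_space p' (lebesgue_on I)" if f: "f \<in> ?L" for f :: "real \<Rightarrow> complex"
  proof -
    have "?N f < \<infinity>" using f by (simp add: Lp_space_def)
    then have "k * ?N f < \<infinity>" using k by (simp add: ennreal_mult_less_top)
    then have "?N' (?T f) < \<infinity>"
      using B(3)[OF f] unfolding k_def by (rule order.strict_trans1[rotated])
    then show ?thesis using B(2)[OF f] by (simp add: Lp_space_def)
  qed
  have linear: "?T (\<lambda>t. c * f t + d * g t) s = c * ?T f s + d * ?T g s"
    if "f \<in> ?L" "g \<in> ?L" "s \<in> I" for f g :: "real \<Rightarrow> complex" and c d s
  proof -
    have "?T (\<lambda>t. c * f t + d * g t) s =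
      (LINT t|halfline. c * (f t * exp (- z s * of_real t)) + d * (g t * exp (- z s * of_real t)))"
      unfolding laplace_curve_def by (intro Bochner_Integration.integral_cong) (auto simp: algebra_simps)
    also have "\<dots> = c * ?T f s + d * ?T g s"
      unfolding laplace_curve_def using B(1)[OF that(1,3)] B(1)[OF that(2,3)] by simp
    finally show ?thesis .
  qed
  have cont: "\<exists>d>0. \<forall>g\<in>?L. ?N (\<lambda>x. g x - f x) < d \<longrightarrow>
      ?N' (\<lambda>s. ?T g s - ?T f s) < e"
    if f: "f \<in> ?L" and e: "0 < e" for f :: "real \<Rightarrow> complex" and e :: ennreal
  \<comment> \<open>The operator norm is at most \<open>k\<close>, which is positive and finite;
    hence \<open>e / k\<close> is a valid choice even for \<open>e = \<infinity>\<close>.\<close>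
  proof (intro exI[of _ "e / k"] conjI ballI impI)
    show "0 < e / k" using e k by (simp add: ennreal_zero_less_divide)
    fix g assume g: "g \<in> ?L"
      and less: "?N (\<lambda>x. g x - f x) < e / k"
    have [measurable]: "f \<in> borel_measurable halfline" "g \<in> borel_measurable halfline"
      using f g by (auto simp: Lp_space_def)
    have "?N (\<lambda>x. g x - f x) < \<infinity>"
      using less by (rule order.strict_trans2) simp
    then have gf: "(\<lambda>x. g x - f x) \<in> ?L" by (simp add: Lp_space_def)
    have cong: "?N' h = ?N' h'"
      if "\<And>s. s \<in> I \<Longrightarrow> h s = h' s" "h \<in> borel_measurable (lebesgue_on I)" "h' \<in> borel_measurable (lebesgue_on I)" for h h' :: "real \<Rightarrow> complex"
    proof -
      have "(\<integral>\<^sup>+ x. ennreal (norm (h x) powr a) \<partial>lebesgue_on I) = (\<integral>\<^sup>+ x. ennreal (norm (h' x) powr a) \<partial>lebesgue_on I)" for a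
        using that(1) by (intro nn_integral_cong) auto
      moreover have "esssup (lebesgue_on I) (\<lambda>x. ennreal (norm (h x))) = esssup (lebesgue_on I) (\<lambda>x. ennreal (norm (h' x)))"
        using that by (intro esssup_AE_cong AE_I2) auto
      ultimately show ?thesis by (simp add: Lp_norm_def)
    qed
    have "?N' (\<lambda>s. ?T g s - ?T f s) = ?N' (?T (\<lambda>x. g x - f x))"
      using linear[OF g f, of _ 1 "-1"] B(2)[OF f] B(2)[OF g] B(2)[OF gf] by (intro cong) auto
    also have "\<dots> \<le> k * ?N (\<lambda>x. g x - f x)"
      unfolding k_def by (rule B(3)[OF gf])
    also have "\<dots> < e / k * k"
      using ennreal_mult_strict_right_mono[OF less k(1)] k(2) by (simp add: mult.commute)
    also have "e / k * k = e" using k by (simp add: ennreal_divide_times)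
    finally show "?N' (\<lambda>s. ?T g s - ?T f s) < e" .
  qed
  show ?thesis
    unfolding continuous_Lp_operator_def
    using space linear cont by (auto intro!: AE_I2)
qed

lemma laplace_curve_operator_norm:
  assumes K: "L2_exhausted z I K" "0 < K" and z: "continuous_on I z" "z ` I \<subseteq> right_halfplane"
    and I: "I \<in> sets lebesgue"
    and p: "1 \<le> p" "p \<le> 2" "inverse p + inverse p' = 1" and "K \<le> K'"
  shows "Lp_operator_norm p halfline p' (lebesgue_on I) (laplace_curve z)
    \<le> ennreal (K' powr enn2real (inverse p'))"
  unfolding Lp_operator_norm_def
proof (rule SUP_least)
  fix f :: "real \<Rightarrow> complex" assume f: "f \<in> {f \<in> Lp_space p halfline. Lp_norm p halfline f \<le> 1}"
  then have "Lp_norm p' (lebesgue_on I) (laplace_curve z f)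
       \<le> ennreal (K powr enn2real (inverse p')) * Lp_norm p halfline f"
    by (intro laplace_curve_bound(3)[OF K z I p]) auto
  also have "\<dots> \<le> ennreal (K powr enn2real (inverse p')) * 1" using f by (intro mult_left_mono) auto
  also have "\<dots> \<le> ennreal (K' powr enn2real (inverse p'))"
    using assms(2,9) by (simp add: powr_mono2 ennreal_leI)
  finally show "Lp_norm p' (lebesgue_on I) (laplace_curve z f) \<le> ennreal (K' powr enn2real (inverse p'))" .
qed

theorem theorem7:
  fixes p p' :: ennreal
  assumes "1 \<le> p" "p \<le> 2" "inverse p + inverse p' = 1"
  shows "(\<forall>(I, z)\<in>monotone_curves right_halfplane \<union> convex_curves right_halfplane.
            (\<forall>f\<in>Lp_space p (lebesgue_on {0<..}). \<forall>s\<in>I.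
               integrable (lebesgue_on {0<..}) (\<lambda>t. f t * exp (- z s * of_real t))) \<and>
            continuous_Lp_operator p (lebesgue_on {0<..}) p' (lebesgue_on I) (laplace_curve z)) \<and>
         (SUP (I, z)\<in>monotone_curves right_halfplane.
            Lp_operator_norm p (lebesgue_on {0<..}) p' (lebesgue_on I) (laplace_curve z))
           \<le> ennreal ((224 * pi) powr enn2real (inverse p')) \<and>
         (SUP (I, z)\<in>convex_curves right_halfplane.
            Lp_operator_norm p (lebesgue_on {0<..}) p' (lebesgue_on I) (laplace_curve z))
           \<le> ennreal ((16 * 224 * pi) powr enn2real (inverse p'))"
proof -
  have arc: "(I, z) \<in> arclength_curves right_halfplane"
    if "(I, z) \<in> monotone_curves right_halfplane \<union> convex_curves right_halfplane" for I z
    using that by (auto simp: monotone_curves_def convex_curves_def)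
  have 1: "(\<forall>f\<in>Lp_space p (lebesgue_on {0<..}). \<forall>s\<in>I.
             integrable (lebesgue_on {0<..}) (\<lambda>t. f t * exp (- z s * of_real t))) \<and>
          continuous_Lp_operator p (lebesgue_on {0<..}) p' (lebesgue_on I) (laplace_curve z)"
    if c: "(I, z) \<in> monotone_curves right_halfplane \<union> convex_curves right_halfplane" for I z
  proof -
    note D = arclength_curvesD[OF arc[OF c]]
    obtain K where K: "L2_exhausted z I K" "0 < K"
    proof (cases "(I, z) \<in> monotone_curves right_halfplane")
      case True
      then show thesis by (intro that[of "10 * pi"] monotone_curve_L2_exhausted) auto
    next
      case False
      then show thesis using c by (intro that[of "90 * pi"] convex_curve_L2_exhausted) auto
    qed
    show ?thesis
      using laplace_curve_bound(1)[OF K D(3,6,4) assms] laplace_curve_continuous_operator[OF K D(3,6,4) assms] by blast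
  qed
  have 2: "Lp_operator_norm p (lebesgue_on {0<..}) p' (lebesgue_on I) (laplace_curve z) \<le> ennreal ((224 * pi) powr enn2real (inverse p'))"
    if c: "(I, z) \<in> monotone_curves right_halfplane" for I z
  proof -
    note D = arclength_curvesD[OF arc[OF UnI1[OF c]]]
    show ?thesis
      by (rule laplace_curve_operator_norm[OF monotone_curve_L2_exhausted[OF c] _ D(3,6,4) assms]) auto
  qed
  have 3: "Lp_operator_norm p (lebesgue_on {0<..}) p' (lebesgue_on I) (laplace_curve z) \<le> ennreal ((16 * 224 * pi) powr enn2real (inverse p'))"
    if c: "(I, z) \<in> convex_curves right_halfplane" for I z
  proof -
    note D = arclength_curvesD[OF arc[OF UnI2[OF c]]]
    show ?thesis
      by (rule laplace_curve_operator_norm[OF convex_curve_L2_exhausted[OF c] _ D(3,6,4) assms]) auto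
  qed
  show ?thesis
    using 1 2 3 by (intro conjI SUP_least) (auto split: prod.split)
qed

end
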